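(* Let $N=2$. With $\widetilde\beta_1(p)$, $p>1$, the first radial eigenvalue of the weighted linearized problem in the annulus $A_{n_p}$ (see context) and $\ell=\lim_{p\to+\infty}s_p/\varepsilon_p^-\approx 7.1979$, $$\lim_{p\to+\infty}\widetilde\beta_1(p)=-\frac{\ell^2+2}{2}\simeq-26.9 .$$
   Context: Let $B\subset\mathbb R^2$ be the open unit disc centered at $0$. For $p>1$ let $u_p$ be a least energy sign-changing (nodal) radial solution, with $u_p(0)>0$, of $-\Delta u=|u|^{p-1}u$ in $B$, $u=0$ on $\partial B$; that is, $u_p$ minimizes $E_p(u)=\frac12\int_B|\nabla u|^2-\frac1{p+1}\int_B|u|^{p+1}$ on $\{u\in H^1_{0,rad}(B): u^\pm\ne0,\ E_p'(u)u^\pm=0\}$, where $H^1_{0,rad}$ denotes radial functions in $H^1_0$ and $u^\pm$ are the positive and negative parts. Write $u_p(r)=u_p(|x|)$. It is known that $u_p$ has exactly one zero $r_p\in(0,1)$ (nodal radius), and a unique minimum radius $s_p\in(r_p,1)$, $u_p(s_p)=\min u_p$. Set $(\varepsilon_p^+)^{-2}=p\,u_p(0)^{p-1}$ and $(\varepsilon_p^-)^{-2}=p\,|u_p(s_p)|^{p-1}$. It is known that $\ell:=\lim_{p\to+\infty}s_p/\varepsilon_p^-$ exists and $\ell\approx7.1979$. For an integer $n\ge2$ let $A_n=\{x\in\mathbb R^2:\frac1n<|x|<1\}$. Let $\widetilde\mu_i^n(p)$, $i\ge1$, be the eigenvalues (nondecreasing, counted with multiplicity) of $\widetilde L_p^nv=|x|^2(-\Delta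 v-p|u_p|^{p-1}v)$ with Dirichlet conditions on $\partial A_n$, i.e. of $-\Delta h-p|u_p|^{p-1}h=\mu\, h/|x|^2$ in $A_n$, $h=0$ on $\partial A_n$, and let $\widetilde\beta_i^n(p)$, $i\ge1$, be those among them with radial eigenfunctions: $$\widetilde\beta_i^n(p)=\inf_{V\subset H^1_{0,rad}(A_n),\,\dim V=i}\ \max_{v\in V\setminus\{0\}}\frac{\int_{A_n}(|\nabla v|^2-p|u_p|^{p-1}v^2)dx}{\int_{A_n}v^2/|x|^2dx}.$$ Let $n'_p$ be an integer such that for all $n\ge n'_p$ at least $4$ of the $\widetilde\mu_i^n(p)$ and exactly $2$ of the $\widetilde\beta_i^n(p)$ are negative, and let $n''_p$ be an integer such that $\widetilde\beta_2^n(p)>-1$ for all $n\ge n''_p$ (such integers exist). Fix such choices, set $n_p:=\max\{n'_p,n''_p,[(\varepsilon_p^+)^{-2}]+1\}$, with $[\cdot]$ the integer part, and $\widetilde\beta_1(p):=\widetilde\beta_1^{n_p}(p)$. *)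

theory Defs
  imports "HOL-Analysis.Analysis"
begin

section \<open>Smooth functions on the plane\<close>

definition partial :: "2 \<Rightarrow> (real^2 \<Rightarrow> real) \<Rightarrow> real^2 \<Rightarrow> real"
  where "partial i f x = frechet_derivative f (at x) (axis i 1)"

definition laplacian :: "(real^2 \<Rightarrow> real) \<Rightarrow> real^2 \<Rightarrow> real"
  where "laplacian f x = (\<Sum>i\<in>UNIV. partial i (partial i f) x)"

text \<open>Meaningful for open \<open>S\<close> only, since derivatives are taken at points of \<open>S\<close> in the full space.\<close>

primrec Ck_on :: "nat \<Rightarrow> (real^2) set \<Rightarrow> (real^2 \<Rightarrow> real) \<Rightarrow> bool"
  where
    "Ck_on 0 S f \<longleftrightarrow> continuous_on S f"
  | "Ck_on (Suc k) S f \<longleftrightarrow> (\<forall>x\<in>S. f differentiable (at x)) \<and> (\<forall>i. Ck_on k S (partial i f))"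

definition test_functions :: "(real^2) set \<Rightarrow> (real^2 \<Rightarrow> real) set"
  where "test_functions \<Omega> =
    {\<phi>. (\<forall>k. Ck_on k UNIV \<phi>) \<and> compact (closure {x. \<phi> x \<noteq> 0}) \<and> closure {x. \<phi> x \<noteq> 0} \<subseteq> \<Omega>}"


section \<open>Sobolev spaces\<close>

text \<open>
  Elements of the function spaces are honest functions, not classes modulo equality almost
  everywhere, and only their values on \<open>\<Omega>\<close> matter. Hence ``nonzero'' and ``linearly independent''
  are always to be understood almost everywhere below.
\<close>

definition L2 :: "(real^2) set \<Rightarrow> (real^2 \<Rightarrow> 'b::euclidean_space) \<Rightarrow> bool"
  where "L2 \<Omega> f \<longleftrightarrow> f \<in> borel_measurable (lebesgue_on \<Omega>)
    \<and> integrable (lebesgue_on \<Omega>) (\<lambda>x. (norm (f x))\<^sup>2)"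

definition weak_gradient :: "(real^2) set \<Rightarrow> (real^2 \<Rightarrow> real) \<Rightarrow> (real^2 \<Rightarrow> real^2) \<Rightarrow> bool"
  where "weak_gradient \<Omega> v g \<longleftrightarrow> (\<forall>\<phi>\<in>test_functions \<Omega>. \<forall>i.
    (\<integral>x. v x * partial i \<phi> x \<partial>lebesgue_on \<Omega>) = - (\<integral>x. g x $ i * \<phi> x \<partial>lebesgue_on \<Omega>))"

definition H1 :: "(real^2) set \<Rightarrow> (real^2 \<Rightarrow> real) set"
  where "H1 \<Omega> = {v. L2 \<Omega> v \<and> (\<exists>g. L2 \<Omega> g \<and> weak_gradient \<Omega> v g)}"

text \<open>The choice is unique up to a null set.\<close>

definition grad :: "(real^2) set \<Rightarrow> (real^2 \<Rightarrow> real) \<Rightarrow> real^2 \<Rightarrow> real^2"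
  where "grad \<Omega> v = (SOME g. L2 \<Omega> g \<and> weak_gradient \<Omega> v g)"

definition H1_norm :: "(real^2) set \<Rightarrow> (real^2 \<Rightarrow> real) \<Rightarrow> real"
  where "H1_norm \<Omega> v =
    sqrt ((\<integral>x. (v x)\<^sup>2 \<partial>lebesgue_on \<Omega>) + (\<integral>x. (norm (grad \<Omega> v x))\<^sup>2 \<partial>lebesgue_on \<Omega>))"

definition H10 :: "(real^2) set \<Rightarrow> (real^2 \<Rightarrow> real) set"
  where "H10 \<Omega> = {v \<in> H1 \<Omega>. \<forall>e>0. \<exists>\<phi>\<in>test_functions \<Omega>. H1_norm \<Omega> (\<lambda>x. v x - \<phi> x) < e}"

definition H10_rad :: "(real^2) set \<Rightarrow> (real^2 \<Rightarrow> real) set"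
  where "H10_rad \<Omega> = {v \<in> H10 \<Omega>. \<forall>x\<in>\<Omega>. \<forall>y\<in>\<Omega>. norm x = norm y \<longrightarrow> v x = v y}"

definition ae_zero :: "(real^2) set \<Rightarrow> (real^2 \<Rightarrow> real) \<Rightarrow> bool"
  where "ae_zero \<Omega> v \<longleftrightarrow> (AE x in lebesgue_on \<Omega>. v x = 0)"

definition lincomb :: "nat \<Rightarrow> (nat \<Rightarrow> real) \<Rightarrow> (nat \<Rightarrow> real^2 \<Rightarrow> real) \<Rightarrow> real^2 \<Rightarrow> real"
  where "lincomb k c v x = (\<Sum>j<k. c j * v j x)"

definition ae_independent :: "(real^2) set \<Rightarrow> nat \<Rightarrow> (nat \<Rightarrow> real^2 \<Rightarrow> real) \<Rightarrow> bool"
  where "ae_independent \<Omega> k v \<longleftrightarrow> (\<forall>c. ae_zero \<Omega> (lincomb k c v) \<longrightarrow> (\<forall>j<k. c j = 0))"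


section \<open>Least energy nodal radial solutions in the unit disc\<close>

abbreviation disc :: "(real^2) set"
  where "disc \<equiv> ball 0 1"

definition energy :: "real \<Rightarrow> (real^2 \<Rightarrow> real) \<Rightarrow> real"
  where "energy p v = 1/2 * (\<integral>x. (norm (grad disc v x))\<^sup>2 \<partial>lebesgue_on disc)
    - 1/(p+1) * (\<integral>x. \<bar>v x\<bar> powr (p+1) \<partial>lebesgue_on disc)"

text \<open>The derivative of the energy at \<open>v\<close>, applied to the direction \<open>w\<close>.\<close>

definition energy_deriv :: "real \<Rightarrow> (real^2 \<Rightarrow> real) \<Rightarrow> (real^2 \<Rightarrow> real) \<Rightarrow> real"
  where "energy_deriv p v w = deriv (\<lambda>t. energy p (\<lambda>x. v x + t * w x)) 0"

definition pos_part :: "(real^2 \<Rightarrow> real) \<Rightarrow> real^2 \<Rightarrow> real"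
  where "pos_part v x = max (v x) 0"

definition neg_part :: "(real^2 \<Rightarrow> real) \<Rightarrow> real^2 \<Rightarrow> real"
  where "neg_part v x = max (- v x) 0"

definition nodal_set :: "real \<Rightarrow> (real^2 \<Rightarrow> real) set"
  where "nodal_set p = {v \<in> H10_rad disc.
    \<not> ae_zero disc (pos_part v) \<and> \<not> ae_zero disc (neg_part v) \<and>
    energy_deriv p v (pos_part v) = 0 \<and> energy_deriv p v (neg_part v) = 0}"

definition solution :: "real \<Rightarrow> (real^2 \<Rightarrow> real) \<Rightarrow> bool"
  where "solution p u \<longleftrightarrow> Ck_on 2 disc u \<and> continuous_on (cball 0 1) u \<and>
    (\<forall>x\<in>disc. - laplacian u x = \<bar>u x\<bar> powr (p - 1) * u x) \<and> (\<forall>x\<in>sphere 0 1. u x = 0)"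

text \<open>
  A minimizer has a unique representative that is continuous up to the boundary, and this one is a
  classical solution by elliptic regularity. Requiring \<open>solution\<close> selects this representative, so
  that values such as \<open>u 0\<close> make sense.
\<close>

definition least_energy_nodal_radial_solution :: "real \<Rightarrow> (real^2 \<Rightarrow> real) \<Rightarrow> bool"
  where "least_energy_nodal_radial_solution p u \<longleftrightarrow>
    solution p u \<and> u \<in> nodal_set p \<and> (\<forall>v\<in>nodal_set p. energy p u \<le> energy p v)"

definition profile :: "(real^2 \<Rightarrow> real) \<Rightarrow> real \<Rightarrow> real"
  where "profile u t = u (t *\<^sub>R axis 1 1)"

definition nodal_radius :: "(real^2 \<Rightarrow> real) \<Rightarrow> real \<Rightarrow> bool"
  where "nodal_radius u r \<longleftrightarrow> r \<in> {0<..<1} \<and> (\<forall>t\<in>{0<..<1}. profile u t = 0 \<longleftrightarrow> t = r)"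

definition min_radius :: "(real^2 \<Rightarrow> real) \<Rightarrow> real \<Rightarrow> bool"
  where "min_radius u s \<longleftrightarrow> s \<in> {0<..<1} \<and> (\<forall>t\<in>{0..1}. t \<noteq> s \<longrightarrow> profile u s < profile u t)"

text \<open>The scaling parameter belonging to an extremal value \<open>m\<close> of the solution:
  \<open>\<epsilon> > 0\<close> with \<open>\<epsilon>\<^sup>-\<^sup>2 = p |m|\<^sup>p\<^sup>-\<^sup>1\<close>.\<close>

definition scale :: "real \<Rightarrow> real \<Rightarrow> real"
  where "scale p m = (p * \<bar>m\<bar> powr (p - 1)) powr (-1/2)"

definition eps_plus :: "real \<Rightarrow> (real^2 \<Rightarrow> real) \<Rightarrow> real"
  where "eps_plus p u = scale p (u 0)"

definition eps_minus :: "real \<Rightarrow> (real^2 \<Rightarrow> real) \<Rightarrow> real \<Rightarrow> real"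
  where "eps_minus p u s = scale p (profile u s)"


section \<open>The weighted linearized eigenvalue problem in annuli\<close>

definition annulus :: "nat \<Rightarrow> (real^2) set"
  where "annulus n = {x. 1 / real n < norm x \<and> norm x < 1}"

text \<open>Weak formulation of \<open>-\<Delta>h - p|u|\<^sup>p\<^sup>-\<^sup>1h = \<mu>h/|x|\<^sup>2\<close> with Dirichlet conditions.\<close>

definition eigenpair ::
    "real \<Rightarrow> (real^2 \<Rightarrow> real) \<Rightarrow> nat \<Rightarrow> real \<Rightarrow> (real^2 \<Rightarrow> real) \<Rightarrow> bool"
  where "eigenpair p u n \<mu> h \<longleftrightarrow> h \<in> H10 (annulus n) \<and> \<not> ae_zero (annulus n) h \<and>
    (\<forall>\<phi>\<in>H10 (annulus n).
      (\<integral>x. (grad (annulus n) h x \<bullet> grad (annulus n) \<phi> x - p * \<bar>u x\<bar> powr (p - 1) * h x * \<phi> x)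
         \<partial>lebesgue_on (annulus n))
      = \<mu> * (\<integral>x. h x * \<phi> x / (norm x)\<^sup>2 \<partial>lebesgue_on (annulus n)))"

text \<open>
  The \<open>i\<close>-th eigenvalue, \<open>i \<ge> 1\<close>, in nondecreasing order and counted with multiplicity: the least
  \<open>b\<close> such that there are \<open>i\<close> linearly independent eigenfunctions with eigenvalues at most \<open>b\<close>.
\<close>

definition eigenvalue :: "real \<Rightarrow> (real^2 \<Rightarrow> real) \<Rightarrow> nat \<Rightarrow> nat \<Rightarrow> real"
  where "eigenvalue p u n i = Inf {b. \<exists>\<mu> h.
    (\<forall>j<i. eigenpair p u n (\<mu> j) (h j) \<and> \<mu> j \<le> b) \<and> ae_independent (annulus n) i h}"

definition rayleigh :: "real \<Rightarrow> (real^2 \<Rightarrow> real) \<Rightarrow> nat \<Rightarrow> (real^2 \<Rightarrow> real) \<Rightarrow> real"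
  where "rayleigh p u n v =
    (\<integral>x. ((norm (grad (annulus n) v x))\<^sup>2 - p * \<bar>u x\<bar> powr (p - 1) * (v x)\<^sup>2)
       \<partial>lebesgue_on (annulus n))
    / (\<integral>x. (v x)\<^sup>2 / (norm x)\<^sup>2 \<partial>lebesgue_on (annulus n))"

text \<open>
  The \<open>i\<close>-th radial eigenvalue, \<open>i \<ge> 1\<close>. The \<open>i\<close>-dimensional subspaces \<open>V\<close> of the min-max formula
  are given by bases \<open>v 0, \<dots>, v (i - 1)\<close>, the nonzero elements of \<open>V\<close> by nonzero coefficient vectors.
\<close>

definition radial_eigenvalue :: "real \<Rightarrow> (real^2 \<Rightarrow> real) \<Rightarrow> nat \<Rightarrow> nat \<Rightarrow> real"
  where "radial_eigenvalue p u n i =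
    (INF v \<in> {v. (\<forall>j<i. v j \<in> H10_rad (annulus n)) \<and> ae_independent (annulus n) i v}.
     SUP c \<in> {c. \<exists>j<i. c j \<noteq> 0}. rayleigh p u n (lincomb i c v))"

end

theory Submission
  imports Defs
begin

text \<open>
  In the variable \<open>t = ln |x|\<close> a radial solution becomes a function \<open>U\<close> with
  \<open>U'' = - e\<^sup>2\<^sup>t |U|\<^sup>p\<^sup>-\<^sup>1 U\<close>, and the radial part of the weighted eigenvalue problem becomes that of the
  one-dimensional operator \<open>- h'' - W h\<close> with the potential \<open>W = p |U|\<^sup>p\<^sup>-\<^sup>1 e\<^sup>2\<^sup>t\<close>. Put
  \<open>y = (ln W)' = 2 + (p - 1) U' / U\<close>. Away from the nodal circle the equation is the planar system
  \<open>W' = y W\<close>, \<open>y' = - (1 - 1/p) W - (y - 2)\<^sup>2 / (p - 1)\<close>. For large \<open>p\<close> it is a small perturbation of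
  \<open>W' = y W\<close>, \<open>y' = - W\<close>, whose trajectories lie on the parabolas \<open>W + y\<^sup>2 / 2 = 2 k\<^sup>2\<close>; along such a
  trajectory \<open>W = 2 k\<^sup>2 sech\<^sup>2 (k (t - t\<^sub>0))\<close>, and this potential has the lowest eigenvalue \<open>- k\<^sup>2\<close> with
  the eigenfunction \<open>sech (k (t - t\<^sub>0))\<close>, which is \<open>W\<^sup>1\<^sup>/\<^sup>2\<close> up to a factor. At the minimum of the solution
  \<open>U' = 0\<close>, hence \<open>y = 2\<close>, and \<open>W\<close> is the square of the quotient that tends to \<open>l\<close>. So
  \<open>2 k\<^sup>2 = l\<^sup>2 + 2\<close> in the limit, which gives the asserted value \<open>- k\<^sup>2\<close>. Where the solution is positive,
  the trajectory starts at \<open>W = 0\<close>, \<open>y = 2\<close>, so that \<open>W \<le> 4 < k\<^sup>2\<close> and this part does not contribute.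

  Both bounds are read off from the phase plane: where the solution is negative,
  \<open>F = (1 - 1/p) W + y\<^sup>2 / 2\<close> is almost constant as long as \<open>y\<close> is bounded and \<open>W\<close> is not small (\<open>F_almost_constant\<close>), and \<open>W\<close> is small where \<open>|y|\<close> exceeds
  \<open>K = 2 k\<close> (\<open>W_small_where_y_large\<close>).

  For the lower bound, \<open>\<integral> |\<nabla>\<phi> + \<phi> g(ln |x|) x / |x|\<^sup>2|\<^sup>2 \<ge> 0\<close> yields
  \<open>\<integral> |\<nabla>\<phi>|\<^sup>2 \<ge> \<integral> (g' - g\<^sup>2)(ln |x|) \<phi>\<^sup>2 / |x|\<^sup>2\<close> for every test function, radial or not
  (\<open>radial_hardy\<close>). It remains to find \<open>g\<close> with \<open>g' - g\<^sup>2 \<ge> W - k\<^sup>2 - \<delta>\<close>. The negative logarithmic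
  derivative \<open>- y / 2\<close> of \<open>W\<^sup>1\<^sup>/\<^sup>2\<close> does this for \<open>|y| \<le> K\<close>; to the right it is continued by a constant and
  to the left it returns to \<open>0\<close> at the nodal circle (\<open>field_fn_inequality\<close>).

  For the upper bound, \<open>W\<^sup>1\<^sup>/\<^sup>2\<close> is cut off smoothly from below. The result is still almost a
  subsolution of the eigenvalue equation (\<open>cut_w_subsolution\<close>). It is a test function: \<open>W\<close>
  vanishes on the nodal circle and on the boundary, so that the support is compact, and \<open>W\<^sup>1\<^sup>/\<^sup>2\<close> and
  \<open>y\<close> are smooth in between because they solve a polynomial system (\<open>bump_test_function\<close>). The support
  lies in the annulus since \<open>1 / n\<close> is below the nodal radius (\<open>initial_scale\<close>).

  Weak gradients enter only through their uniqueness, which rests on the fundamental lemma of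
  the calculus of variations, and through the density of test functions (\<open>H10_quadratic_form_nonneg\<close>).
\<close>

section \<open>Smooth functions\<close>

lemma Ck_on_SucD: "Ck_on (Suc k) S f \<Longrightarrow> Ck_on k S f"
proof (induction k arbitrary: f)
  case 0
  then show ?case
    using differentiable_imp_continuous_on differentiable_on_def differentiable_at_withinI
    by (metis Ck_on.simps)
next
  case (Suc k)
  then show ?case by auto
qed

lemma partial_has_derivative:
  "(f has_derivative D) (at x) \<Longrightarrow> partial i f x = D (axis i 1)"
  by (metis frechet_derivative_at partial_def)

lemma differentiable_has_derivative_partial:
  fixes f :: "real^2 \<Rightarrow> real"
  assumes "f differentiable (at x)"
  shows "(f has_derivative (\<lambda>h. \<Sum>i\<in>UNIV. partial i f x * h $ i)) (at x)"
proof -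
  from assms obtain D where D: "(f has_derivative D) (at x)" by (auto simp: differentiable_def)
  have L: "linear D" using D by (rule has_derivative_linear)
  have "D h = (\<Sum>i\<in>UNIV. partial i f x * h $ i)" for h
  proof -
    have "h = (\<Sum>i\<in>UNIV. h $ i *\<^sub>R axis i 1)"
      by (simp add: vec_eq_iff axis_def if_distrib cong: if_cong)
    then have "D h = D (\<Sum>i\<in>UNIV. h $ i *\<^sub>R axis i 1)" by simp
    also have "\<dots> = (\<Sum>i\<in>UNIV. h $ i * D (axis i 1))"
      by (simp add: linear_sum[OF L] linear_scale[OF L])
    finally show ?thesis by (simp add: partial_has_derivative[OF D] mult.commute)
  qed
  then have "D = (\<lambda>h. \<Sum>i\<in>UNIV. partial i f x * h $ i)" by blast
  then show ?thesis using D by simp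
qed

text \<open>A Frechet derivative is chosen by a description operator, and functions that agree near \<open>x\<close> offer the
  same candidates, so the choices agree even where there is no derivative.\<close>

lemma partial_cong_open:
  assumes "open S" "x \<in> S" "\<And>y. y \<in> S \<Longrightarrow> f y = g y"
  shows "partial i f x = partial i g x"
proof -
  have "(f has_derivative D) (at x) \<longleftrightarrow> (g has_derivative D) (at x)" for D
    using has_derivative_transform_within_open[of f D x UNIV S g]
      has_derivative_transform_within_open[of g D x UNIV S f] assms by auto
  then show ?thesis by (simp add: partial_def frechet_derivative_def)
qed

lemma Ck_on_cong_open:
  assumes "open S" "\<And>y. y \<in> S \<Longrightarrow> f y = g y" "Ck_on k S f"
  shows "Ck_on k S g"
  using assms(2,3)
proof (induction k arbitrary: f g)
  case 0
  then show ?case by (auto cong: continuous_on_cong)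
next
  case (Suc k)
  have "g differentiable (at x)" if "x \<in> S" for x
  proof -
    have "f differentiable (at x)" using Suc.prems(2) that by simp
    then obtain D where "(f has_derivative D) (at x)" by (auto simp: differentiable_def)
    then have "(g has_derivative D) (at x)"
      using has_derivative_transform_within_open[of f D x UNIV S g] assms(1) that Suc.prems by auto
    then show ?thesis by (auto simp: differentiable_def)
  qed
  moreover have "Ck_on k S (partial i g)" for i
    using Suc.IH[of "partial i f" "partial i g"] partial_cong_open[OF assms(1), of _ f g] Suc.prems by auto
  ultimately show ?case by simp
qed

lemma Ck_on_Un_open:
  assumes "open S" "open T" "Ck_on k S f" "Ck_on k T f"
  shows "Ck_on k (S \<union> T) f"
  using assms(3,4)
  by (induction k arbitrary: f) (auto intro: continuous_on_open_Un assms)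

text \<open>Smoothness has to be checked near the support only, since elsewhere the function vanishes.\<close>

lemma Ck_on_UNIV_extend:
  assumes "open S" "closed K" "K \<subseteq> S" "\<And>x. x \<notin> K \<Longrightarrow> f x = 0" "Ck_on k S f"
  shows "Ck_on k UNIV f"
proof -
  have "Ck_on k T (\<lambda>x. 0)" for T
  proof (induction k)
    case (Suc k)
    have "partial i (\<lambda>x. 0) = (\<lambda>x. 0)" for i
      using partial_has_derivative[OF has_derivative_const, of i 0] by auto
    then show ?case using Suc by simp
  qed simp
  then have "Ck_on k (- K) f"
    using Ck_on_cong_open[of "- K" "\<lambda>x. 0" f] assms by (auto simp: open_Compl)
  then have "Ck_on k (S \<union> - K) f" using Ck_on_Un_open assms by (simp add: open_Compl)
  moreover have "S \<union> - K = UNIV" using assms by auto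
  ultimately show ?thesis by simp
qed

text \<open>Lets the partial derivatives be given by any convenient formula that is valid on \<open>S\<close>.\<close>

lemma Ck_on_SucI:
  assumes S: "open S" and d: "\<And>x. x \<in> S \<Longrightarrow> (f has_derivative D x) (at x)"
    and "\<And>i. Ck_on k S (\<lambda>x. D x (axis i 1))"
  shows "Ck_on (Suc k) S f"
proof -
  have "Ck_on k S (partial i f)" for i
    by (rule Ck_on_cong_open[OF S _ assms(3)[of i]]) (simp add: partial_has_derivative[OF d])
  then show ?thesis using d by (auto simp: differentiable_def)
qed

lemma Ck_on_const: "open S \<Longrightarrow> Ck_on k S (\<lambda>x. c)"
proof (induction k arbitrary: c)
  case (Suc k)
  show ?case by (rule Ck_on_SucI[OF Suc.prems has_derivative_const]) (use Suc in simp)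
qed simp

lemma Ck_on_add: "open S \<Longrightarrow> Ck_on k S f \<Longrightarrow> Ck_on k S g \<Longrightarrow> Ck_on k S (\<lambda>x. f x + g x)"
proof (induction k arbitrary: f g)
  case (Suc k)
  show ?case
    apply (rule Ck_on_SucI[OF Suc.prems(1) has_derivative_add[OF differentiable_has_derivative_partial
      differentiable_has_derivative_partial]])
    using Suc by (auto simp: axis_def if_distrib cong: if_cong)
qed (simp add: continuous_on_add)

lemma Ck_on_mult: "open S \<Longrightarrow> Ck_on k S f \<Longrightarrow> Ck_on k S g \<Longrightarrow> Ck_on k S (\<lambda>x. f x * g x)"
proof (induction k arbitrary: f g)
  case (Suc k)
  have fg: "Ck_on k S f" "Ck_on k S g" using Suc.prems Ck_on_SucD by blast+
  show ?case
    apply (rule Ck_on_SucI[OF Suc.prems(1) has_derivative_mult[OF differentiable_has_derivative_partial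
      differentiable_has_derivative_partial]])
    using Suc fg by (auto simp: axis_def if_distrib cong: if_cong intro!: Ck_on_add)
qed (simp add: continuous_on_mult)

lemma Ck_on_nth: "open S \<Longrightarrow> Ck_on k S (\<lambda>x. x $ i)"
proof (induction k)
  case (Suc k)
  have "((\<lambda>x. x $ i) has_derivative (\<lambda>h. h $ i)) (at x)" for x :: "real^2"
    by (rule bounded_linear_imp_has_derivative[OF bounded_linear_vec_nth])
  from Ck_on_SucI[OF Suc.prems this] show ?case by (simp add: Ck_on_const Suc.prems)
qed (auto intro: continuous_intros)

lemma Ck_on_minus: "open S \<Longrightarrow> Ck_on k S f \<Longrightarrow> Ck_on k S (\<lambda>x. - f x)"
  using Ck_on_mult[OF _ Ck_on_const[of S k "-1"], of f] by simp

lemma Ck_on_diff: "open S \<Longrightarrow> Ck_on k S f \<Longrightarrow> Ck_on k S g \<Longrightarrow> Ck_on k S (\<lambda>x. f x - g x)"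
  using Ck_on_add[OF _ _ Ck_on_minus, of S k f g] by simp

lemma Ck_on_compose_field:
  assumes "open S" "Ck_on (Suc k) S q" "\<And>x. x \<in> S \<Longrightarrow> (F has_real_derivative F' (q x)) (at (q x))"
    "Ck_on k S (\<lambda>x. F' (q x))"
  shows "Ck_on (Suc k) S (\<lambda>x. F (q x))"
proof -
  have d: "((\<lambda>x. F (q x)) has_derivative (\<lambda>h. (\<Sum>i\<in>UNIV. partial i q x * h $ i) * F' (q x))) (at x)" if "x \<in> S" for x
  proof -
    have "(q has_derivative (\<lambda>h. \<Sum>i\<in>UNIV. partial i q x * h $ i)) (at x)"
      using assms(2) that by (intro differentiable_has_derivative_partial) simp
    from has_derivative_compose[OF this assms(3)[OF that, unfolded has_field_derivative_def]]
    show ?thesis by (simp add: mult.commute)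
  qed
  show ?thesis
    by (rule Ck_on_SucI[OF assms(1) d])
      (use assms in \<open>auto simp: axis_def if_distrib cong: if_cong intro!: Ck_on_mult\<close>)
qed

section \<open>A flat function\<close>

text \<open>The functions \<open>P(1/x) exp(-1/x)\<close>, extended by \<open>0\<close> to \<open>x \<le> 0\<close>. Taking all polynomials \<open>P\<close> at once makes
  the family closed under differentiation, so that smoothness is an induction with no bookkeeping
  of higher derivatives.\<close>

definition flat :: "real poly \<Rightarrow> real \<Rightarrow> real"
  where "flat P x = (if x > 0 then poly P (1 / x) * exp (- (1 / x)) else 0)"

lemma poly_exp_minus_tendsto_0: "((\<lambda>z::real. poly P z * exp (- z)) \<longlongrightarrow> 0) at_top"
proof -
  have "((\<lambda>z. \<Sum>i\<le>degree P. coeff P i * (z ^ i / exp z)) \<longlongrightarrow> (\<Sum>i\<le>degree P. coeff P i * 0)) at_top"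
    by (intro tendsto_intros tendsto_power_div_exp_0)
  then show ?thesis by (simp add: poly_altdef sum_distrib_right exp_minus divide_inverse mult.assoc)
qed

text \<open>At \<open>0\<close> the difference quotient from the right is a polynomial times an exponential in \<open>z = 1 / h\<close>.\<close>

lemma flat_has_derivative:
  "(flat P has_real_derivative flat ([:0, 0, 1:] * (P - pderiv P)) x) (at x)"
proof -
  consider "x > 0" | "x < 0" | "x = 0" by linarith
  then show ?thesis
  proof cases
    case 1
    have "((\<lambda>x. poly P (1 / x) * exp (- (1 / x))) has_real_derivative flat ([:0, 0, 1:] * (P - pderiv P)) x) (at x)"
      using 1 by (auto simp: flat_def intro!: derivative_eq_intros) (simp add: field_simps power2_eq_square)
    then show ?thesis
      by (rule DERIV_cong_ev[THEN iffD1, rotated -1])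
        (use 1 eventually_nhds_in_open[of "{0<..}" x] in \<open>auto simp: flat_def elim: eventually_mono\<close>)
  next
    case 2
    have "((\<lambda>x. 0) has_real_derivative flat ([:0, 0, 1:] * (P - pderiv P)) x) (at x)"
      using 2 by (auto simp: flat_def)
    then show ?thesis
      by (rule DERIV_cong_ev[THEN iffD1, rotated -1])
        (use 2 eventually_nhds_in_open[of "{..<0}" x] in \<open>auto simp: flat_def elim: eventually_mono\<close>)
  next
    case 3
    have "((\<lambda>h. flat P h / h) \<longlongrightarrow> 0) (at_right 0)"
      unfolding filterlim_at_right_to_top
      by (rule Lim_transform_eventually[OF poly_exp_minus_tendsto_0[of "[:0, 1:] * P"]])
        (use eventually_gt_at_top[of 0] in \<open>eventually_elim, simp add: flat_def field_simps\<close>)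
    moreover have "((\<lambda>h. flat P h / h) \<longlongrightarrow> 0) (at_left 0)"
      by (rule Lim_transform_eventually[OF tendsto_const])
        (auto simp: eventually_at_left_field flat_def intro: exI[of _ "-1"])
    ultimately show ?thesis using 3 by (simp add: DERIV_def flat_def[of _ 0] filterlim_split_at)
  qed
qed

lemma Ck_on_flat: "open S \<Longrightarrow> Ck_on k S q \<Longrightarrow> Ck_on k S (\<lambda>x. flat P (q x))"
proof (induction k arbitrary: P)
  case 0
  have "continuous_on UNIV (flat P)"
    using flat_has_derivative[of P] by (meson DERIV_continuous_on has_field_derivative_at_within)
  then show ?case using 0 continuous_on_compose2[of UNIV "flat P" S q] by simp
next
  case (Suc k)
  show ?case
    by (rule Ck_on_compose_field[OF Suc.prems flat_has_derivative])
      (rule Suc.IH[OF Suc.prems(1) Ck_on_SucD[OF Suc.prems(2)]])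
qed

lemma flat_1_bounds: "0 \<le> flat 1 x" "flat 1 x \<le> 1"
  by (auto simp: flat_def)

section \<open>The divergence theorem for compactly supported Lipschitz functions\<close>

lemma integral_affine_real2:
  fixes F :: "real^2 \<Rightarrow> real"
  assumes "F \<in> borel_measurable borel" "c \<noteq> 0"
  shows "(\<integral>x. F x \<partial>lborel) = c\<^sup>2 * (\<integral>x. F (t + c *\<^sub>R x) \<partial>lborel)"
proof -
  have "(\<integral>x. F x \<partial>lborel) = (\<integral>x. F x \<partial>density (distr lborel borel (\<lambda>x. t + c *\<^sub>R x)) (\<lambda>_. \<bar>c\<bar>^DIM(real^2)))"
    using lborel_affine[OF assms(2), of t] by simp
  also have "\<dots> = (\<integral>x. \<bar>c\<bar>^DIM(real^2) * F x \<partial>distr lborel borel (\<lambda>x. t + c *\<^sub>R x))"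
    using assms by (subst integral_density) (auto simp: enn2real_def)
  also have "\<dots> = (\<integral>x. \<bar>c\<bar>^DIM(real^2) * F (t + c *\<^sub>R x) \<partial>lborel)"
    using assms by (subst integral_distr) auto
  finally show ?thesis by simp
qed

lemma integrable_continuous_compact_support:
  fixes F :: "real^2 \<Rightarrow> real"
  assumes "continuous_on UNIV F" "\<And>x. norm x > R \<Longrightarrow> F x = 0"
  shows "integrable lborel F"
proof -
  have "integrable lborel (\<lambda>x. indicator (cball 0 R) x *\<^sub>R F x)"
    by (rule borel_integrable_compact) (auto intro: continuous_on_subset[OF assms(1)])
  moreover have "(\<lambda>x. indicator (cball 0 R) x *\<^sub>R F x) = F"
    using assms(2) by (force simp: indicator_def)
  ultimately show ?thesis by simp
qed

text \<open>The divergence theorem for the field \<open>F(x) (\<alpha> x + e)\<close>: for \<open>\<alpha> = 0\<close> it says that the integral of a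
  directional derivative vanishes, for \<open>\<alpha> = 1\<close>, \<open>e = 0\<close> it is the case of radial fields. The integral
  of \<open>c\<^sup>2 F(c x + t) - F(x)\<close> is zero by substitution. With \<open>c = 1 + \<alpha>/k\<close>, \<open>t = e/k\<close> and after
  multiplication by \<open>k\<close> the integrands converge to the divergence wherever \<open>F\<close> is differentiable, and
  the Lipschitz bound dominates them. The function \<open>h\<close> is the divergence off the exceptional null
  set \<open>Z\<close>.\<close>

lemma integral_divergence_affine:
  fixes F :: "real^2 \<Rightarrow> real"
  assumes lip: "L-lipschitz_on UNIV F" and supp: "\<And>x. norm x > R \<Longrightarrow> F x = 0"
    and Z: "Z \<in> null_sets lborel" and D: "\<And>x. x \<notin> Z \<Longrightarrow> (F has_derivative D x) (at x)"
    and \<alpha>: "0 \<le> \<alpha>"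
  obtains h where "has_bochner_integral lborel h 0"
    "\<And>x. x \<notin> Z \<Longrightarrow> h x = 2 * \<alpha> * F x + D x (\<alpha> *\<^sub>R x + e)"
proof -
  define c where "c k = 1 + \<alpha> / real (Suc k)" for k
  define t where "t k = (1 / real (Suc k)) *\<^sub>R e" for k
  define s where "s k x = real (Suc k) * ((c k)\<^sup>2 * F (t k + c k *\<^sub>R x) - F x)" for k x
  define h where "h x = (if x \<in> Z then 0 else 2 * \<alpha> * F x + D x (\<alpha> *\<^sub>R x + e))" for x
  have cont: "continuous_on UNIV F" using lip by (rule lipschitz_on_continuous_on)
  have Fm [measurable]: "F \<in> borel_measurable borel"
    using cont by (rule borel_measurable_continuous_onI)
  have Zs [measurable]: "Z \<in> sets borel" using Z by auto
  have c1: "c k \<ge> 1" for k using \<alpha> by (simp add: c_def)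
  have intF: "integrable lborel F" using integrable_continuous_compact_support[OF cont supp] by blast
  have s_zero: "norm x > R + norm e \<Longrightarrow> s k x = 0" for k x
  proof -
    assume x: "norm x > R + norm e"
    have "norm (t k) \<le> norm e" by (simp add: t_def divide_le_eq mult_le_cancel_left1)
    moreover have "norm x \<le> norm (c k *\<^sub>R x)" using c1[of k] by (simp add: mult_le_cancel_right1)
    moreover have "norm (c k *\<^sub>R x) \<le> norm (t k + c k *\<^sub>R x) + norm (t k)"
      by (metis add_diff_cancel_left' norm_triangle_ineq4 add.commute)
    ultimately have "norm (t k + c k *\<^sub>R x) > R" using x by linarith
    moreover have "norm x > R" using x norm_ge_zero[of e] by linarith
    ultimately show "s k x = 0" using supp by (simp add: s_def)
  qed
  have conts: "continuous_on UNIV (s k)" for k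
    unfolding s_def by (intro continuous_intros continuous_on_compose2[OF cont]) auto
  have int_s: "integrable lborel (s k)" for k
    using integrable_continuous_compact_support[OF conts s_zero] by blast
  have s_int0: "(\<integral>x. s k x \<partial>lborel) = 0" for k
  proof -
    have ia: "integrable lborel (\<lambda>x. F (t k + c k *\<^sub>R x))"
    proof (rule integrable_continuous_compact_support)
      show "continuous_on UNIV (\<lambda>x. F (t k + c k *\<^sub>R x))"
        by (intro continuous_intros continuous_on_compose2[OF cont]) auto
      show "norm x > R + norm e \<Longrightarrow> F (t k + c k *\<^sub>R x) = 0" for x
        using s_zero[of x k] supp[of x] norm_ge_zero[of e] c1[of k] by (simp add: s_def)
    qed
    show ?thesis
      using integral_affine_real2[OF Fm, of "c k" "t k"] c1[of k] ia intF by (simp add: s_def)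
  qed
  obtain M where M: "\<And>x. \<bar>F x\<bar> \<le> M" "M \<ge> 0"
  proof -
    have "compact (F ` cball 0 R)" by (intro compact_continuous_image continuous_on_subset[OF cont]) auto
    then obtain M where "\<forall>y\<in>F ` cball 0 R. norm y \<le> M"
      using compact_imp_bounded bounded_iff by metis
    then have "\<bar>F x\<bar> \<le> M" if "x \<in> cball 0 R" for x using that by auto
    then have "\<bar>F x\<bar> \<le> max M 0" for x
      by (cases "norm x > R") (auto simp: supp le_max_iff_disj not_less)
    then show ?thesis using that[of "max M 0"] by simp
  qed
  define B where "B = (2 * \<alpha> + \<alpha>\<^sup>2) * M + L * (\<alpha> * (R + norm e) + norm e)"
  have L0: "L \<ge> 0" using lip by (rule lipschitz_on_nonneg)
  \<comment> \<open>The first summand converges by continuity, the second one is a difference quotient of \<open>F\<close>.\<close>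
  have s_eq: "s k x = (2 * \<alpha> + \<alpha>\<^sup>2 / real (Suc k)) * F (t k + c k *\<^sub>R x)
      + real (Suc k) * (F (x + (1 / real (Suc k)) *\<^sub>R (\<alpha> *\<^sub>R x + e)) - F x)" for k x
  proof -
    have "t k + c k *\<^sub>R x = x + (1 / real (Suc k)) *\<^sub>R (\<alpha> *\<^sub>R x + e)"
      by (simp add: t_def c_def algebra_simps)
    moreover have "real (Suc k) * (c k)\<^sup>2 = 2 * \<alpha> + \<alpha>\<^sup>2 / real (Suc k) + real (Suc k)"
      by (simp add: c_def power2_eq_square field_simps del: of_nat_Suc)
    moreover have "s k x = (real (Suc k) * (c k)\<^sup>2) * F (t k + c k *\<^sub>R x) - real (Suc k) * F x"
      by (simp add: s_def algebra_simps del: of_nat_Suc)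
    ultimately show ?thesis by (simp add: ring_distribs del: of_nat_Suc)
  qed
  have s_bound: "\<bar>s k x\<bar> \<le> B * indicator (cball 0 (R + norm e)) x" for k x
  proof (cases "norm x > R + norm e")
    case False
    have "\<bar>F (x + (1 / real (Suc k)) *\<^sub>R (\<alpha> *\<^sub>R x + e)) - F x\<bar> \<le> L * norm ((1 / real (Suc k)) *\<^sub>R (\<alpha> *\<^sub>R x + e))"
      using lipschitz_onD[OF lip, of "x + (1 / real (Suc k)) *\<^sub>R (\<alpha> *\<^sub>R x + e)" x] by (simp add: dist_norm)
    then have "real (Suc k) * \<bar>F (x + (1 / real (Suc k)) *\<^sub>R (\<alpha> *\<^sub>R x + e)) - F x\<bar>
        \<le> real (Suc k) * (L * norm ((1 / real (Suc k)) *\<^sub>R (\<alpha> *\<^sub>R x + e)))"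
      by (rule mult_left_mono) simp
    also have "\<dots> = L * norm (\<alpha> *\<^sub>R x + e)" unfolding norm_scaleR by simp
    also have "\<dots> \<le> L * (\<alpha> * (R + norm e) + norm e)"
      using False \<alpha> L0 by (intro mult_left_mono order_trans[OF norm_triangle_ineq] add_mono) (auto intro: mult_left_mono)
    finally have 1: "real (Suc k) * \<bar>F (x + (1 / real (Suc k)) *\<^sub>R (\<alpha> *\<^sub>R x + e)) - F x\<bar> \<le> L * (\<alpha> * (R + norm e) + norm e)" .
    have "\<alpha>\<^sup>2 / real (Suc k) \<le> \<alpha>\<^sup>2" by (simp add: divide_le_eq mult_le_cancel_left1)
    then have 2: "\<bar>(2 * \<alpha> + \<alpha>\<^sup>2 / real (Suc k)) * F (t k + c k *\<^sub>R x)\<bar> \<le> (2 * \<alpha> + \<alpha>\<^sup>2) * M"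
      unfolding abs_mult using \<alpha> M by (intro mult_mono) auto
    have "\<bar>s k x\<bar> \<le> B" unfolding s_eq B_def
      by (rule order_trans[OF abs_triangle_ineq], rule add_mono[OF 2]) (use 1 in \<open>simp add: abs_mult\<close>)
    then show ?thesis using False by (simp add: indicator_def)
  qed (simp add: s_zero)
  have s_lim: "(\<lambda>k. s k x) \<longlonglongrightarrow> 2 * \<alpha> * F x + D x (\<alpha> *\<^sub>R x + e)" if "x \<notin> Z" for x
  proof -
    have inv: "(\<lambda>k. 1 / real (Suc k)) \<longlonglongrightarrow> 0" using LIMSEQ_inverse_real_of_nat by (simp add: inverse_eq_divide)
    define v where "v = \<alpha> *\<^sub>R x + e"
    have "(\<lambda>k. t k + c k *\<^sub>R x) \<longlonglongrightarrow> 0 *\<^sub>R e + (1 + \<alpha> * 0) *\<^sub>R x"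
      unfolding t_def c_def divide_inverse using inv by (intro tendsto_intros) (auto simp: divide_inverse)
    then have "(\<lambda>k. F (t k + c k *\<^sub>R x)) \<longlonglongrightarrow> F x"
      using continuous_on_tendsto_compose[OF cont] by simp
    moreover have "(\<lambda>k. real (Suc k) * (F (x + (1 / real (Suc k)) *\<^sub>R v) - F x)) \<longlonglongrightarrow> D x v"
    proof -
      have "((\<lambda>h. F (x + h *\<^sub>R v)) has_real_derivative D x v) (at 0)"
      proof -
        have "((\<lambda>h. x + h *\<^sub>R v) has_derivative (\<lambda>h. h *\<^sub>R v)) (at 0)"
          by (auto intro!: derivative_eq_intros)
        then have "((\<lambda>h. F (x + h *\<^sub>R v)) has_derivative (\<lambda>h. D x (h *\<^sub>R v))) (at 0)"
          by (rule has_derivative_compose) (use D[OF that] in simp)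
        moreover have "D x (h *\<^sub>R v) = D x v * h" for h
          using linear_scale[OF has_derivative_linear[OF D[OF that]], of h v] by simp
        ultimately show ?thesis by (simp add: has_field_derivative_def)
      qed
      then have "((\<lambda>h. (F (x + h *\<^sub>R v) - F x) / h) \<longlongrightarrow> D x v) (at 0)" by (simp add: DERIV_def)
      moreover have "filterlim (\<lambda>k. 1 / real (Suc k)) (at 0) sequentially"
        using inv by (simp add: filterlim_at)
      ultimately have "((\<lambda>k. (F (x + (1 / real (Suc k)) *\<^sub>R v) - F x) / (1 / real (Suc k))) \<longlonglongrightarrow> D x v)"
        by (rule filterlim_compose)
      then show ?thesis by (simp add: mult.commute)
    qed
    moreover have "(\<lambda>k. 2 * \<alpha> + \<alpha>\<^sup>2 * (1 / real (Suc k))) \<longlonglongrightarrow> 2 * \<alpha> + \<alpha>\<^sup>2 * 0"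
      by (intro tendsto_intros inv)
    ultimately have "(\<lambda>k. (2 * \<alpha> + \<alpha>\<^sup>2 * (1 / real (Suc k))) * F (t k + c k *\<^sub>R x)
      + real (Suc k) * (F (x + (1 / real (Suc k)) *\<^sub>R v) - F x)) \<longlonglongrightarrow> (2 * \<alpha> + \<alpha>\<^sup>2 * 0) * F x + D x v"
      by - (rule tendsto_add[OF tendsto_mult])
    then show ?thesis by (simp add: s_eq v_def del: of_nat_Suc)
  qed
  have lim': "(\<lambda>k. indicator (- Z) x * s k x) \<longlonglongrightarrow> h x" for x
    using s_lim[of x] by (cases "x \<in> Z") (auto simp: h_def)
  have hm: "h \<in> borel_measurable lborel"
    by (rule borel_measurable_LIMSEQ_real[OF lim'])
      (use borel_measurable_integrable[OF int_s] in measurable)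
  have bnd: "integrable lborel (\<lambda>x. B * indicator (cball 0 (R + norm e)) x)"
    by (intro integrable_mult_right integrable_real_indicator) (simp_all add: emeasure_bounded_finite[OF bounded_cball, unfolded infinity_ennreal_def])
  have AEs: "AE x in lborel. indicator (- Z) x * s k x = s k x" for k
    using AE_not_in[OF Z] by eventually_elim simp
  have sm: "s k \<in> borel_measurable lborel" for k by (rule borel_measurable_integrable[OF int_s])
  have sm': "(\<lambda>x. indicator (- Z) x * s k x) \<in> borel_measurable lborel" for k
    using sm[of k] by measurable
  have le: "AE x in lborel. norm (indicator (- Z) x * s k x) \<le> B * indicator (cball 0 (R + norm e)) x" for k
  proof (intro AE_I2)
    show "norm (indicator (- Z) x * s k x) \<le> B * indicator (cball 0 (R + norm e)) x" for x
      using s_bound[of k x] order_trans[OF abs_ge_zero s_bound[of k x]] by (cases "x \<in> Z") auto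
  qed
  have limAE: "AE x in lborel. (\<lambda>k. indicator (- Z) x * s k x) \<longlonglongrightarrow> h x" using lim' by simp
  note dc = hm sm' bnd limAE le
  have "integrable lborel h" by (rule integrable_dominated_convergence[OF dc])
  moreover have "(\<lambda>k. \<integral>x. indicator (- Z) x * s k x \<partial>lborel) \<longlonglongrightarrow> (\<integral>x. h x \<partial>lborel)"
    by (rule integral_dominated_convergence[OF dc])
  moreover have "(\<integral>x. indicator (- Z) x * s k x \<partial>lborel) = 0" for k
    using integral_cong_AE[OF sm' sm AEs, of k] s_int0 by simp
  ultimately have "has_bochner_integral lborel h 0"
    by (simp add: has_bochner_integral_iff LIMSEQ_const_iff)
  then show ?thesis using that by (simp add: h_def)
qed

text \<open>The partial derivatives are continuous with compact support, hence bounded.\<close>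

lemma C1_compact_support_lipschitz:
  assumes "Ck_on 1 UNIV f" "\<And>x. norm x > R \<Longrightarrow> f x = 0"
  obtains L where "L-lipschitz_on UNIV f"
proof -
  have pc: "continuous_on UNIV (partial i f)" for i using assms(1) by simp
  have "\<exists>M\<ge>0. \<forall>x. \<bar>partial i f x\<bar> \<le> M" for i
  proof -
    have "compact (partial i f ` cball 0 R)" by (intro compact_continuous_image continuous_on_subset[OF pc]) auto
    then obtain M where "\<forall>y\<in>partial i f ` cball 0 R. norm y \<le> M"
      using compact_imp_bounded bounded_iff by metis
    then have M: "\<bar>partial i f x\<bar> \<le> M" if "x \<in> cball 0 R" for x using that by auto
    have "partial i f x = 0" if "x \<notin> cball 0 R" for x
      using partial_cong_open[of "- cball 0 R" x f "\<lambda>x. 0" i] that assms(2)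
        partial_has_derivative[OF has_derivative_const, of i 0] by (auto simp: open_Compl)
    then have "\<bar>partial i f x\<bar> \<le> max M 0" for x
      using M[of x] by (cases "x \<in> cball 0 R") (auto simp: le_max_iff_disj)
    then show ?thesis by (metis max.cobounded2)
  qed
  then obtain M where M: "\<And>i. M i \<ge> 0" "\<And>i x. \<bar>partial i f x\<bar> \<le> M i" by metis
  have "norm (f x - f y) \<le> (\<Sum>i\<in>UNIV. M i) * norm (x - y)" for x y
  proof (rule differentiable_bound[of UNIV])
    show "(f has_derivative (\<lambda>h. \<Sum>i\<in>UNIV. partial i f x * h $ i)) (at x within UNIV)" for x
      using differentiable_has_derivative_partial assms(1) by simp
    show "onorm (\<lambda>h. \<Sum>i\<in>UNIV. partial i f x * h $ i) \<le> (\<Sum>i\<in>UNIV. M i)" for x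
    proof (rule onorm_le)
      fix h :: "real^2"
      have "\<bar>\<Sum>i\<in>UNIV. partial i f x * h $ i\<bar> \<le> (\<Sum>i\<in>UNIV. M i * norm h)"
        by (rule order_trans[OF sum_abs], rule sum_mono)
           (auto simp: abs_mult intro!: mult_mono M component_le_norm_cart)
      then show "norm (\<Sum>i\<in>UNIV. partial i f x * h $ i) \<le> (\<Sum>i\<in>UNIV. M i) * norm h"
        by (simp add: sum_distrib_right)
    qed
  qed auto
  then have "(\<Sum>i\<in>UNIV. M i)-lipschitz_on UNIV f"
    by (auto simp: lipschitz_on_def dist_norm sum_nonneg M)
  then show ?thesis by (rule that)
qed

lemma integral_partial_eq_0:
  assumes f: "Ck_on 1 UNIV f" and supp: "\<And>x. norm x > R \<Longrightarrow> f x = 0"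
  shows "has_bochner_integral lborel (partial i f) 0"
proof -
  obtain L where "L-lipschitz_on UNIV f" using C1_compact_support_lipschitz[OF assms] .
  from integral_divergence_affine[OF this supp, where Z = "{}" and \<alpha> = 0 and e = "axis i 1"
      and D = "\<lambda>x h. \<Sum>i\<in>UNIV. partial i f x * h $ i"]
  obtain h where "has_bochner_integral lborel h 0"
    "\<And>x. h x = (\<Sum>j\<in>UNIV. partial j f x * axis i 1 $ j)"
    using differentiable_has_derivative_partial f by auto
  moreover have "(\<Sum>j\<in>UNIV. partial j f x * axis i 1 $ j) = partial i f x" for x
    by (simp add: axis_def if_distrib cong: if_cong)
  ultimately have "has_bochner_integral lborel h 0" "h = partial i f" by auto
  then show ?thesis by simp
qed

section \<open>Test functions\<close>

lemma not_in_closure_support: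
  fixes f :: "'a::topological_space \<Rightarrow> real"
  shows "x \<notin> closure {x. f x \<noteq> 0} \<Longrightarrow> f x = 0"
  by (rule ccontr) (use subsetD[OF closure_subset, of x "{x. f x \<noteq> 0}"] in simp)

lemma test_functions_bounded:
  assumes "\<phi> \<in> test_functions \<Omega>"
  obtains R where "\<And>x. norm x > R \<Longrightarrow> \<phi> x = 0"
proof -
  have "bounded (closure {x. \<phi> x \<noteq> 0})" using assms by (auto simp: test_functions_def compact_imp_bounded)
  then obtain R where "\<forall>x\<in>closure {x. \<phi> x \<noteq> 0}. norm x \<le> R" unfolding bounded_iff by blast
  then have "\<phi> x = 0" if "norm x > R" for x
    using that by (intro not_in_closure_support) (auto simp: not_le[symmetric])
  then show ?thesis by (rule that)
qed

lemma test_functions_Ck: "\<phi> \<in> test_functions \<Omega> \<Longrightarrow> Ck_on k UNIV \<phi>"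
  by (simp add: test_functions_def)

lemma test_functions_zero: "\<phi> \<in> test_functions \<Omega> \<Longrightarrow> x \<notin> \<Omega> \<Longrightarrow> \<phi> x = 0"
  using not_in_closure_support[of x \<phi>] unfolding test_functions_def by blast

lemma test_functions_partial:
  assumes "\<phi> \<in> test_functions \<Omega>"
  shows "partial i \<phi> \<in> test_functions \<Omega>"
proof -
  let ?K = "closure {x. \<phi> x \<noteq> 0}"
  have K: "compact ?K" "?K \<subseteq> \<Omega>" and C: "\<And>k. Ck_on k UNIV \<phi>"
    using assms unfolding test_functions_def by blast+
  have z: "\<phi> x = 0" if "x \<notin> ?K" for x
    using that by (rule not_in_closure_support)
  have "partial i \<phi> x = 0" if "x \<notin> ?K" for x
  proof -
    have "partial i \<phi> x = partial i (\<lambda>x. 0) x"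
    proof (rule partial_cong_open)
      show "open (- ?K)" by (rule open_Compl[OF closed_closure])
      show "x \<in> - ?K" using that by blast
      show "\<phi> y = 0" if "y \<in> - ?K" for y by (rule z) (use that in blast)
    qed
    then show ?thesis using partial_has_derivative[OF has_derivative_const, of i 0] by simp
  qed
  then have "closure {x. partial i \<phi> x \<noteq> 0} \<subseteq> ?K" by (intro closure_minimal) auto
  moreover from this have "compact (closure {x. partial i \<phi> x \<noteq> 0})"
    using K(1) by (meson bounded_subset compact_eq_bounded_closed closed_closure)
  moreover have "Ck_on k UNIV (partial i \<phi>)" for k using C[of "Suc k"] by simp
  ultimately show ?thesis using K(2) unfolding test_functions_def by blast
qed

lemma test_functions_mult:
  assumes "\<phi> \<in> test_functions \<Omega>" "\<And>k. Ck_on k UNIV \<psi>"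
  shows "(\<lambda>x. \<phi> x * \<psi> x) \<in> test_functions \<Omega>"
proof -
  have *: "closure {x. \<phi> x * \<psi> x \<noteq> 0} \<subseteq> closure {x. \<phi> x \<noteq> 0}" by (intro closure_mono) auto
  then have "compact (closure {x. \<phi> x * \<psi> x \<noteq> 0})"
    using assms(1) unfolding test_functions_def
    by (metis (no_types, lifting) bounded_subset closed_closure compact_eq_bounded_closed mem_Collect_eq)
  moreover have "Ck_on k UNIV (\<lambda>x. \<phi> x * \<psi> x)" for k
    using assms by (intro Ck_on_mult) (auto simp: test_functions_def)
  ultimately show ?thesis using assms(1) * unfolding test_functions_def by blast
qed

lemma test_functions_continuous: "\<phi> \<in> test_functions \<Omega> \<Longrightarrow> continuous_on UNIV \<phi>"
  using test_functions_Ck[of \<phi> \<Omega> 0] by simp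

lemma test_functions_lborel: "\<phi> \<in> test_functions \<Omega> \<Longrightarrow> integrable lborel \<phi>"
  by (metis integrable_continuous_compact_support test_functions_continuous test_functions_bounded)

lemma partial_mult:
  "f differentiable (at x) \<Longrightarrow> g differentiable (at x) \<Longrightarrow>
    partial i (\<lambda>x. f x * g x) x = partial i f x * g x + f x * partial i g x"
  by (subst partial_has_derivative[OF has_derivative_mult[OF differentiable_has_derivative_partial
      differentiable_has_derivative_partial]])
     (auto simp: axis_def if_distrib cong: if_cong)

lemma integral_by_parts:
  assumes "\<phi> \<in> test_functions \<Omega>" "\<And>k. Ck_on k UNIV \<psi>"
  shows "has_bochner_integral lborel (\<lambda>x. partial i \<phi> x * \<psi> x + \<phi> x * partial i \<psi> x) 0"
proof -
  have t: "(\<lambda>x. \<phi> x * \<psi> x) \<in> test_functions \<Omega>" using test_functions_mult[OF assms] .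
  obtain R where R: "\<And>x. norm x > R \<Longrightarrow> \<phi> x = 0"
    using test_functions_bounded[OF assms(1)] by blast
  from integral_partial_eq_0[OF test_functions_Ck[OF t], of R]
  have "has_bochner_integral lborel (partial i (\<lambda>x. \<phi> x * \<psi> x)) 0" by (simp add: R)
  moreover have "partial i (\<lambda>x. \<phi> x * \<psi> x) x = partial i \<phi> x * \<psi> x + \<phi> x * partial i \<psi> x" for x
    using test_functions_Ck[OF assms(1), of 1] assms(2)[of 1] by (simp add: partial_mult)
  then have "partial i (\<lambda>x. \<phi> x * \<psi> x) = (\<lambda>x. partial i \<phi> x * \<psi> x + \<phi> x * partial i \<psi> x)" by auto
  ultimately show ?thesis by simp
qed

definition classical_grad :: "(real^2 \<Rightarrow> real) \<Rightarrow> real^2 \<Rightarrow> real^2"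
  where "classical_grad f x = (\<chi> i. partial i f x)"

lemma integral_lebesgue_on_lborel:
  fixes f :: "real^2 \<Rightarrow> real"
  assumes "\<Omega> \<in> sets lebesgue" "f \<in> borel_measurable borel" "\<And>x. x \<notin> \<Omega> \<Longrightarrow> f x = 0"
  shows "(\<integral>x. f x \<partial>lebesgue_on \<Omega>) = (\<integral>x. f x \<partial>lborel)"
proof -
  have "(\<integral>x. f x \<partial>lebesgue_on \<Omega>) = (\<integral>x. indicator \<Omega> x *\<^sub>R f x \<partial>lebesgue)"
    using assms(1) by (subst integral_restrict_space) auto
  also have "(\<lambda>x. indicator \<Omega> x *\<^sub>R f x) = f"
    using assms(3) by (intro ext, case_tac "x \<in> \<Omega>") simp_all
  finally show ?thesis using assms(2) by (simp add: integral_completion)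
qed

lemma integrable_lebesgue_on_lborel:
  fixes f :: "real^2 \<Rightarrow> real"
  assumes "\<Omega> \<in> sets lebesgue" "integrable lborel f"
  shows "integrable (lebesgue_on \<Omega>) f"
proof -
  have "integrable lebesgue f" using assms(2) by (simp add: integrable_completion)
  then have "integrable lebesgue (\<lambda>x. indicator \<Omega> x *\<^sub>R f x)"
    by (rule integrable_mult_indicator[OF assms(1)])
  then show ?thesis using assms(1) by (subst integrable_restrict_space) auto
qed

section \<open>The fundamental lemma of the calculus of variations\<close>

lemma integrable_lebesgue_imp_borel:
  fixes f :: "'a::euclidean_space \<Rightarrow> real"
  assumes "integrable lebesgue f"
  obtains f' where "integrable lborel f'" "AE x in lebesgue. f x = f' x"
proof -
  have "f \<in> borel_measurable (completion lborel)" using assms by simp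
  then obtain f' where f': "f' \<in> borel_measurable lborel" "AE x in lborel. f x = f' x"
    using completion_ex_borel_measurable_real[of f lborel] by metis
  have ae: "AE x in lebesgue. f x = f' x" using f'(2) by (rule AE_completion)
  have "integrable lebesgue f'"
    by (rule integrable_cong_AE_imp[OF assms measurable_completion[OF f'(1)]]) (use ae in eventually_elim, simp)
  then have "integrable lborel f'" using f'(1) by (simp add: integrable_completion)
  then show ?thesis using that ae by blast
qed

text \<open>Boxes are closed under intersection and generate the Borel sets, so the sets over which \<open>f\<close> has
  integral zero, being closed under complements and disjoint unions, are all Borel sets.\<close>

lemma AE_zero_if_box_integrals_zero:
  fixes f :: "'a::euclidean_space \<Rightarrow> real"
  assumes f: "integrable lborel f" and z: "(\<integral>x. f x \<partial>lborel) = 0"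
    and box: "\<And>a b. (\<integral>x. indicator (box a b) x * f x \<partial>lborel) = 0"
  shows "AE x in lborel. f x = 0"
proof (rule sigma_finite_measure.density_zero[OF sigma_finite_lborel f])
  fix A :: "'a set" assume "A \<in> sets lborel"
  then have A: "A \<in> sigma_sets UNIV (range (\<lambda>(a, b). box a b))"
    by (simp add: borel_eq_box)
  have si: "set_integrable lborel B f" if "B \<in> sigma_sets UNIV (range (\<lambda>(a, b). box a b))" for B
    using integrable_mult_indicator[OF _ f, of B] that by (simp add: set_integrable_def borel_eq_box)
  show "set_lebesgue_integral lborel A f = 0"
  proof (rule sigma_sets_induct_disjoint[OF _ _ A])
    show "Int_stable (range (\<lambda>(a, b). box a b))"
      by (auto simp: Int_stable_def box_Int_box)
    show "set_lebesgue_integral lborel B f = 0" if "B \<in> range (\<lambda>(a, b). box a b)" for B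
      using that box by (auto simp: set_lebesgue_integral_def)
    show "set_lebesgue_integral lborel {} f = 0" by (simp add: set_lebesgue_integral_def)
    show "set_lebesgue_integral lborel (UNIV - B) f = 0"
      if B: "B \<in> sigma_sets UNIV (range (\<lambda>(a, b). box a b))" "set_lebesgue_integral lborel B f = 0" for B
    proof -
      have "(\<lambda>x. indicator (UNIV - B) x *\<^sub>R f x) = (\<lambda>x. f x - indicator B x *\<^sub>R f x)"
        by (auto simp: indicator_def)
      then show ?thesis using z B(2) si[OF B(1)] f by (simp add: set_lebesgue_integral_def set_integrable_def)
    qed
    show "set_lebesgue_integral lborel (\<Union> (range B)) f = 0"
      if "disjoint_family B" "range B \<subseteq> sigma_sets UNIV (range (\<lambda>(a, b). box a b))"
        "\<And>i. set_lebesgue_integral lborel (B i) f = 0" for B :: "nat \<Rightarrow> _"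
    proof (subst lebesgue_integral_countable_add)
      show "B i \<in> sets lborel" for i using that(2) by (auto simp: borel_eq_box)
      show "B i \<inter> B j = {}" if "i \<noteq> j" for i j
        using \<open>disjoint_family B\<close> that by (auto simp: disjoint_family_on_def)
      show "set_integrable lborel (\<Union> (range B)) f"
        using that(2) by (intro si sigma_sets.Union) auto
    qed (simp add: that)
  qed auto
qed

text \<open>As \<open>k\<close> grows, these functions converge to the indicator of the box. The shift by \<open>- 1\<close> keeps the
  support at distance \<open>1/k\<close> from the boundary, so that boxes touching the boundary of the domain are
  allowed.\<close>

definition box_bump :: "real \<Rightarrow> real^2 \<Rightarrow> real^2 \<Rightarrow> real^2 \<Rightarrow> real" where
  "box_bump k a b x = (\<Prod>i\<in>UNIV. flat 1 (k * (k * (x $ i - a $ i) - 1)) * flat 1 (k * (k * (b $ i - x $ i) - 1)))"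

lemma box_bump_Ck: "Ck_on n UNIV (box_bump k a b)"
proof -
  have "Ck_on n UNIV (\<lambda>x. \<Prod>i\<in>I. flat 1 (k * (k * (x $ i - a $ i) - 1)) * flat 1 (k * (k * (b $ i - x $ i) - 1)))" for I :: "2 set"
    by (induction I rule: infinite_finite_induct)
       (auto intro!: Ck_on_const Ck_on_mult Ck_on_flat Ck_on_diff Ck_on_nth)
  then show ?thesis unfolding box_bump_def[abs_def] .
qed

lemma box_bump_test_function:
  assumes "box a b \<subseteq> \<Omega>" "k > 0"
  shows "box_bump k a b \<in> test_functions \<Omega>"
proof -
  define K where "K = cbox (\<chi> i. a $ i + 1 / k) (\<chi> i. b $ i - 1 / k)"
  have "x \<in> K" if "box_bump k a b x \<noteq> 0" for x
  proof -
    have "k * (k * (x $ i - a $ i) - 1) > 0" "k * (k * (b $ i - x $ i) - 1) > 0" for i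
      using that by (auto simp: box_bump_def flat_def split: if_splits)
    then have "k * (x $ i - a $ i) - 1 > 0" "k * (b $ i - x $ i) - 1 > 0" for i
      using \<open>k > 0\<close> zero_less_mult_pos by blast+
    then have "a $ i + 1 / k < x $ i" "x $ i < b $ i - 1 / k" for i
      using \<open>k > 0\<close> by (simp_all add: field_simps)
    then have "a $ i + 1 / k \<le> x $ i" "x $ i \<le> b $ i - 1 / k" for i
      by (simp_all add: order_less_imp_le)
    then show ?thesis by (simp add: K_def mem_box_cart)
  qed
  then have cl: "closure {x. box_bump k a b x \<noteq> 0} \<subseteq> K"
    by (intro closure_minimal) (auto simp: K_def)
  moreover have "K \<subseteq> box a b"
  proof
    fix x assume "x \<in> K"
    then have "a $ i + 1 / k \<le> x $ i" "x $ i \<le> b $ i - 1 / k" for i by (auto simp: K_def mem_box_cart)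
    moreover have "1 / k > 0" using \<open>k > 0\<close> by simp
    ultimately show "x \<in> box a b" unfolding mem_box_cart by (smt (verit))
  qed
  moreover have "compact (closure {x. box_bump k a b x \<noteq> 0})"
    using bounded_subset[OF _ cl] by (simp add: compact_eq_bounded_closed K_def)
  ultimately show ?thesis unfolding test_functions_def using assms(1) box_bump_Ck by blast
qed

lemma box_bump_bounds: "\<bar>box_bump k a b x\<bar> \<le> 1"
proof -
  have "0 \<le> box_bump k a b x" by (auto simp: box_bump_def intro!: prod_nonneg mult_nonneg_nonneg flat_1_bounds)
  moreover have "box_bump k a b x \<le> 1" unfolding box_bump_def
    by (intro prod_le_1 conjI mult_nonneg_nonneg mult_le_one flat_1_bounds)
  ultimately show ?thesis by simp
qed

lemma flat_1_tendsto:
  "(\<lambda>k. flat 1 (real k * (real k * c - 1))) \<longlonglongrightarrow> (if c > 0 then 1 else 0)"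
proof (cases "c > 0")
  case True
  have "filterlim (\<lambda>k. real k * (real k * c - 1)) at_top sequentially"
    by (intro filterlim_at_top_mult_at_top filterlim_real_sequentially filterlim_tendsto_add_at_top[of "\<lambda>_. -1", simplified]
         filterlim_at_top_mult_tendsto_pos[of "\<lambda>_. c" c] tendsto_const True)
      (use True in \<open>auto intro: filterlim_real_sequentially\<close>)
  then have inf: "filterlim (\<lambda>k. real k * (real k * c - 1)) at_top sequentially" .
  have h1: "((\<lambda>x::real. exp (- (1 / x))) \<longlongrightarrow> exp (- 0)) at_top"
    by (rule tendsto_exp[OF tendsto_minus[OF real_tendsto_divide_at_top[OF tendsto_const filterlim_ident]]])
  have h2: "\<forall>\<^sub>F x::real in at_top. exp (- (1 / x)) = flat 1 x"
    using eventually_gt_at_top[of 0] by eventually_elim (simp add: flat_def)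
  have "(flat 1 \<longlongrightarrow> 1) at_top" using Lim_transform_eventually[OF h1 h2] by simp
  from filterlim_compose[OF this inf] show ?thesis using True by simp
next
  case False
  then have "flat 1 (real k * (real k * c - 1)) = 0" for k
  proof -
    have "real k * c \<le> 0" using False by (simp add: mult_nonneg_nonpos)
    then have "real k * (real k * c - 1) \<le> 0" by (intro mult_nonneg_nonpos) auto
    then show ?thesis by (simp add: flat_def)
  qed
  then show ?thesis using False by simp
qed

lemma box_bump_tendsto: "(\<lambda>k. box_bump (real k) a b x) \<longlonglongrightarrow> indicator (box a b) x"
proof -
  have "(\<lambda>k. box_bump (real k) a b x) \<longlonglongrightarrow>
     (\<Prod>i\<in>UNIV. (if x $ i - a $ i > 0 then 1 else 0) * (if b $ i - x $ i > 0 then 1 else 0))"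
    unfolding box_bump_def by (intro tendsto_intros flat_1_tendsto)
  moreover have "(\<Prod>i\<in>UNIV. (if x $ i - a $ i > 0 then 1 else 0) * (if b $ i - x $ i > 0 then 1 else 0)) = (indicator (box a b) x :: real)"
    unfolding indicator_def mem_box_cart UNIV_2 by (auto simp: forall_2)
  ultimately show ?thesis by simp
qed

text \<open>Tested against the functions \<open>box_bump k a b\<close> with \<open>k \<rightarrow> \<infinity>\<close>, the hypothesis says that \<open>f\<close> has integral
  zero over every box in \<open>\<Omega>\<close>. An open set is a countable union of such boxes.\<close>

lemma fundamental_lemma:
  fixes f :: "real^2 \<Rightarrow> real"
  assumes \<Omega>: "open \<Omega>" and f: "integrable (lebesgue_on \<Omega>) f"
    and z: "\<And>\<psi>. \<psi> \<in> test_functions \<Omega> \<Longrightarrow> (\<integral>x. f x * \<psi> x \<partial>lebesgue_on \<Omega>) = 0"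
  shows "AE x in lebesgue_on \<Omega>. f x = 0"
proof -
  have \<Omega>s: "\<Omega> \<in> sets lebesgue" using \<Omega> by auto
  have int: "integrable lebesgue (\<lambda>x. indicator \<Omega> x * f x)"
    using f \<Omega>s by (subst (asm) integrable_restrict_space) auto
  \<comment> \<open>Boxes generate the Borel sets only, hence the passage to a Borel representative.\<close>
  then obtain g where g: "integrable lborel g" "AE x in lebesgue. indicator \<Omega> x * f x = g x"
    by (rule integrable_lebesgue_imp_borel)
  have gm [measurable]: "g \<in> borel_measurable borel" using g(1) by simp
  have gl: "g \<in> borel_measurable lebesgue" using gm by (intro measurable_completion) simp
  have box0: "(\<integral>x. indicator (box a b) x * g x \<partial>lborel) = 0" if "box a b \<subseteq> \<Omega>" for a b
  proof -
    have "(\<integral>x. box_bump (real (Suc k)) a b x * g x \<partial>lborel) = 0" for k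
    proof -
      have t: "box_bump (real (Suc k)) a b \<in> test_functions \<Omega>"
        using that by (intro box_bump_test_function) auto
      have bm [measurable]: "box_bump (real (Suc k)) a b \<in> borel_measurable borel"
        using test_functions_continuous[OF t] by (rule borel_measurable_continuous_onI)
      have "(\<integral>x. box_bump (real (Suc k)) a b x * g x \<partial>lborel) = (\<integral>x. box_bump (real (Suc k)) a b x * g x \<partial>lebesgue)"
        by (rule integral_completion[symmetric]) measurable
      also have "\<dots> = (\<integral>x. indicator \<Omega> x *\<^sub>R (f x * box_bump (real (Suc k)) a b x) \<partial>lebesgue)"
      proof (rule integral_cong_AE)
        have [measurable]: "box_bump (real (Suc k)) a b \<in> borel_measurable lebesgue"
          using bm by (intro measurable_completion) simp
        show "(\<lambda>x. box_bump (real (Suc k)) a b x * g x) \<in> borel_measurable lebesgue"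
          using gl by measurable
        have "(\<lambda>x. (indicator \<Omega> x * f x) * box_bump (real (Suc k)) a b x) \<in> borel_measurable lebesgue"
          using borel_measurable_integrable[OF int] by measurable
        then show "(\<lambda>x. indicator \<Omega> x *\<^sub>R (f x * box_bump (real (Suc k)) a b x)) \<in> borel_measurable lebesgue"
          by (simp add: mult.assoc)
        show "AE x in lebesgue. box_bump (real (Suc k)) a b x * g x = indicator \<Omega> x *\<^sub>R (f x * box_bump (real (Suc k)) a b x)"
          using g(2) by eventually_elim (simp add: algebra_simps flip: mult.assoc)
      qed
      also have "\<dots> = (\<integral>x. f x * box_bump (real (Suc k)) a b x \<partial>lebesgue_on \<Omega>)"
        using \<Omega>s by (subst integral_restrict_space) auto
      finally show ?thesis using z[OF t] by simp
    qed
    moreover have "(\<lambda>k. \<integral>x. box_bump (real (Suc k)) a b x * g x \<partial>lborel) \<longlonglongrightarrow> (\<integral>x. indicator (box a b) x * g x \<partial>lborel)"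
    proof (rule integral_dominated_convergence[where w = "\<lambda>x. \<bar>g x\<bar>"])
      show "(\<lambda>x. indicat_real (box a b) x * g x) \<in> borel_measurable lborel" by measurable
      show "(\<lambda>x. box_bump (real (Suc k)) a b x * g x) \<in> borel_measurable lborel" for k
      proof -
        have "continuous_on UNIV (box_bump (real (Suc k)) a b)"
          using box_bump_Ck[of 0 "real (Suc k)" a b] by simp
        then have [measurable]: "box_bump (real (Suc k)) a b \<in> borel_measurable borel"
          by (rule borel_measurable_continuous_onI)
        show ?thesis by measurable
      qed
      show "integrable lborel (\<lambda>x. \<bar>g x\<bar>)" using g(1) by simp
      show "AE x in lborel. (\<lambda>k. box_bump (real (Suc k)) a b x * g x) \<longlonglongrightarrow> indicat_real (box a b) x * g x"
        by (intro AE_I2 tendsto_intros LIMSEQ_Suc[OF box_bump_tendsto])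
      show "AE x in lborel. norm (box_bump (real (Suc k)) a b x * g x) \<le> \<bar>g x\<bar>" for k
        by (intro AE_I2) (use mult_right_mono[OF box_bump_bounds abs_ge_zero] in \<open>simp add: abs_mult\<close>)
    qed
    ultimately show ?thesis by (simp add: LIMSEQ_const_iff)
  qed
  have "AE x in lborel. x \<in> box a b \<longrightarrow> g x = 0" if "box a b \<subseteq> \<Omega>" for a b
  proof -
    have "AE x in lborel. indicator (box a b) x * g x = 0"
    proof (rule AE_zero_if_box_integrals_zero)
      show "integrable lborel (\<lambda>x. indicator (box a b) x * g x)"
        using integrable_mult_indicator[OF _ g(1), of "box a b"] by simp
      show "(\<integral>x. indicator (box a b) x * g x \<partial>lborel) = 0" using box0[OF that] .
      fix c d :: "real^2"
      obtain a' b' where ab: "box c d \<inter> box a b = box a' b'" using box_Int_box[of c d a b] by blast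
      have "indicator (box c d) x * (indicator (box a b) x * g x) = indicator (box a' b') x * g x" for x
        unfolding ab[symmetric] by (simp add: indicator_inter_arith mult.assoc)
      then show "(\<integral>x. indicator (box c d) x * (indicator (box a b) x * g x) \<partial>lborel) = 0"
        using box0[of a' b'] that ab by (simp only:) blast
    qed
    then show ?thesis by eventually_elim (auto simp: indicator_def)
  qed
  note boxae = this
  define I where "I = {f \<in> Basis \<rightarrow>\<^sub>E \<rat> \<times> \<rat>. box (\<Sum>i\<in>Basis. fst (f i) *\<^sub>R i) (\<Sum>i\<in>Basis. snd (f i) *\<^sub>R i) \<subseteq> \<Omega>}"
  have "countable I" unfolding I_def
    by (rule countable_Collect) (intro countable_PiE countable_SIGMA countable_rat finite_Basis)
  then have "AE x in lborel. \<forall>f\<in>I. x \<in> box (\<Sum>i\<in>Basis. fst (f i) *\<^sub>R i) (\<Sum>i\<in>Basis. snd (f i) *\<^sub>R i) \<longrightarrow> g x = 0"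
    unfolding AE_ball_countable[OF \<open>countable I\<close>] by (auto simp: I_def intro!: boxae)
  then have "AE x in lborel. x \<in> \<Omega> \<longrightarrow> g x = 0"
    by eventually_elim (use open_UNION_box[OF \<Omega>] in \<open>unfold I_def, blast\<close>)
  then have "AE x in lebesgue. x \<in> \<Omega> \<longrightarrow> g x = 0" by (rule AE_completion)
  then have "AE x in lebesgue. x \<in> \<Omega> \<longrightarrow> f x = 0" using g(2) by eventually_elim auto
  then show ?thesis using \<Omega>s by (simp add: AE_restrict_space_iff)
qed

section \<open>Weak gradients\<close>

lemma finite_measure_lebesgue_on:
  fixes \<Omega> :: "(real^2) set"
  assumes "open \<Omega>" "bounded \<Omega>"
  shows "finite_measure (lebesgue_on \<Omega>)"
proof
  have "emeasure lborel \<Omega> < \<infinity>" using assms(2) by (rule emeasure_bounded_finite)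
  then show "emeasure (lebesgue_on \<Omega>) (space (lebesgue_on \<Omega>)) \<noteq> \<infinity>"
    using assms by (simp add: emeasure_restrict_space space_restrict_space)
qed

lemma L2_real_iff: "L2 \<Omega> (f :: real^2 \<Rightarrow> real) \<longleftrightarrow>
   f \<in> borel_measurable (lebesgue_on \<Omega>) \<and> integrable (lebesgue_on \<Omega>) (\<lambda>x. (f x)\<^sup>2)"
  by (simp add: L2_def)

lemma L2_component:
  assumes "L2 \<Omega> (g :: real^2 \<Rightarrow> real^2)" shows "L2 \<Omega> (\<lambda>x. g x $ i)"
proof -
  have m: "g \<in> borel_measurable (lebesgue_on \<Omega>)" and g: "integrable (lebesgue_on \<Omega>) (\<lambda>x. (norm (g x))\<^sup>2)"
    using assms by (auto simp: L2_def)
  have m': "(\<lambda>x. g x $ i) \<in> borel_measurable (lebesgue_on \<Omega>)"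
    by (rule measurable_compose[OF m]) (rule borel_measurable_continuous_onI[OF linear_continuous_on[OF bounded_linear_vec_nth]])
  moreover have "integrable (lebesgue_on \<Omega>) (\<lambda>x. (g x $ i)\<^sup>2)"
  proof (rule Bochner_Integration.integrable_bound[OF g])
    have "(g x $ i)\<^sup>2 \<le> (norm (g x))\<^sup>2" for x
      using component_le_norm_cart[of "g x" i] by (simp flip: abs_le_square_iff)
    then show "AE x in lebesgue_on \<Omega>. norm ((g x $ i)\<^sup>2) \<le> norm ((norm (g x))\<^sup>2)" by simp
  qed (use m' in measurable)
  ultimately show ?thesis by (simp add: L2_real_iff)
qed

text \<open>On a set of finite measure, \<open>|f| \<le> 1 + f\<^sup>2\<close> bounds the product by an integrable function.\<close>

lemma L2_mult_bounded:
  assumes \<Omega>: "open \<Omega>" "bounded \<Omega>" and f: "L2 \<Omega> (f :: real^2 \<Rightarrow> real)"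
    and m: "\<psi> \<in> borel_measurable (lebesgue_on \<Omega>)" and b: "\<And>x. x \<in> \<Omega> \<Longrightarrow> \<bar>\<psi> x\<bar> \<le> C"
  shows "integrable (lebesgue_on \<Omega>) (\<lambda>x. f x * \<psi> x)"
proof -
  interpret finite_measure "lebesgue_on \<Omega>" using finite_measure_lebesgue_on[OF \<Omega>] .
  have fm: "f \<in> borel_measurable (lebesgue_on \<Omega>)" using f by (simp add: L2_def)
  have "integrable (lebesgue_on \<Omega>) (\<lambda>x. (1 + (f x)\<^sup>2) * C)" using f by (simp add: L2_real_iff)
  then show ?thesis
  proof (rule Bochner_Integration.integrable_bound)
    show "(\<lambda>x. f x * \<psi> x) \<in> borel_measurable (lebesgue_on \<Omega>)" using fm m by measurable
    show "AE x in lebesgue_on \<Omega>. norm (f x * \<psi> x) \<le> norm ((1 + (f x)\<^sup>2) * C)"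
    proof (rule AE_I2)
      fix x assume "x \<in> space (lebesgue_on \<Omega>)"
      then have x: "x \<in> \<Omega>" by (simp add: space_restrict_space)
      have C: "0 \<le> C" using b[OF x] by linarith
      have "\<bar>f x\<bar> \<le> 1 + (f x)\<^sup>2"
        using zero_le_power2[of "\<bar>f x\<bar> - 1"] by (simp add: power2_eq_square algebra_simps)
      then have "\<bar>f x\<bar> * \<bar>\<psi> x\<bar> \<le> (1 + (f x)\<^sup>2) * C" using b[OF x] by (intro mult_mono) auto
      then show "norm (f x * \<psi> x) \<le> norm ((1 + (f x)\<^sup>2) * C)" using C by (simp add: abs_mult)
    qed
  qed
qed

lemma L2_integrable:
  assumes "open \<Omega>" "bounded \<Omega>" "L2 \<Omega> (f :: real^2 \<Rightarrow> real)"
  shows "integrable (lebesgue_on \<Omega>) f"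
  using L2_mult_bounded[OF assms, of "\<lambda>_. 1" 1] by simp

lemma test_function_measurable:
  assumes "\<phi> \<in> test_functions \<Omega>'"
  shows "\<phi> \<in> borel_measurable (lebesgue_on \<Omega>)" "\<exists>C. \<forall>x. \<bar>\<phi> x\<bar> \<le> C"
proof -
  have c: "continuous_on UNIV \<phi>" using test_functions_continuous[OF assms] .
  then have "\<phi> \<in> borel_measurable borel" by (rule borel_measurable_continuous_onI)
  then show "\<phi> \<in> borel_measurable (lebesgue_on \<Omega>)"
    by (intro measurable_restrict_space1 measurable_completion) simp
  obtain R where R: "\<And>x. norm x > R \<Longrightarrow> \<phi> x = 0" using test_functions_bounded[OF assms] by blast
  have "compact (\<phi> ` cball 0 R)" by (intro compact_continuous_image continuous_on_subset[OF c]) auto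
  then obtain M where "\<forall>y\<in>\<phi> ` cball 0 R. norm y \<le> M"
    using compact_imp_bounded bounded_iff by metis
  then have M: "\<bar>\<phi> x\<bar> \<le> M" if "norm x \<le> R" for x using that by auto
  have "\<bar>\<phi> x\<bar> \<le> max M 0" for x
    using M[of x] R[of x] by (cases "norm x > R") auto
  then show "\<exists>C. \<forall>x. \<bar>\<phi> x\<bar> \<le> C" by blast
qed

lemma L2_mult_test:
  assumes "open \<Omega>" "bounded \<Omega>" "L2 \<Omega> (f :: real^2 \<Rightarrow> real)" "\<phi> \<in> test_functions \<Omega>"
  shows "integrable (lebesgue_on \<Omega>) (\<lambda>x. f x * \<phi> x)"
  using L2_mult_bounded[OF assms(1-3) test_function_measurable(1)[OF assms(4)]]
    test_function_measurable(2)[OF assms(4)] by metis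

lemma L2_add_scaled:
  fixes f g :: "real^2 \<Rightarrow> 'b::euclidean_space"
  assumes "L2 \<Omega> f" "L2 \<Omega> g"
  shows "L2 \<Omega> (\<lambda>x. a *\<^sub>R f x + b *\<^sub>R g x)"
proof -
  have m: "f \<in> borel_measurable (lebesgue_on \<Omega>)" "g \<in> borel_measurable (lebesgue_on \<Omega>)"
    using assms by (auto simp: L2_def)
  have "integrable (lebesgue_on \<Omega>) (\<lambda>x. 2 * a\<^sup>2 * (norm (f x))\<^sup>2 + 2 * b\<^sup>2 * (norm (g x))\<^sup>2)"
    using assms by (auto simp: L2_def)
  then have "integrable (lebesgue_on \<Omega>) (\<lambda>x. (norm (a *\<^sub>R f x + b *\<^sub>R g x))\<^sup>2)"
  proof (rule Bochner_Integration.integrable_bound)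
    show "(\<lambda>x. (norm (a *\<^sub>R f x + b *\<^sub>R g x))\<^sup>2) \<in> borel_measurable (lebesgue_on \<Omega>)" using m by measurable
    have "(norm (a *\<^sub>R f x + b *\<^sub>R g x))\<^sup>2 \<le> 2 * a\<^sup>2 * (norm (f x))\<^sup>2 + 2 * b\<^sup>2 * (norm (g x))\<^sup>2" for x
    proof -
      have "(norm (a *\<^sub>R f x + b *\<^sub>R g x))\<^sup>2 \<le> (\<bar>a\<bar> * norm (f x) + \<bar>b\<bar> * norm (g x))\<^sup>2"
        by (intro power_mono) (metis norm_scaleR norm_triangle_ineq, simp)
      also have "\<dots> \<le> 2 * (\<bar>a\<bar> * norm (f x))\<^sup>2 + 2 * (\<bar>b\<bar> * norm (g x))\<^sup>2"
        using zero_le_power2[of "\<bar>a\<bar> * norm (f x) - \<bar>b\<bar> * norm (g x)"]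
        unfolding power2_sum power2_diff by linarith
      finally show ?thesis by (simp add: power_mult_distrib)
    qed
    then show "AE x in lebesgue_on \<Omega>. norm ((norm (a *\<^sub>R f x + b *\<^sub>R g x))\<^sup>2)
        \<le> norm (2 * a\<^sup>2 * (norm (f x))\<^sup>2 + 2 * b\<^sup>2 * (norm (g x))\<^sup>2)"
      by (intro AE_I2) (simp add: abs_of_nonneg)
  qed
  then show ?thesis using m by (simp add: L2_def)
qed

lemma weak_gradient_add_scaled:
  assumes \<Omega>: "open \<Omega>" "bounded \<Omega>" and L: "L2 \<Omega> v" "L2 \<Omega> w" "L2 \<Omega> g" "L2 \<Omega> h"
    and wg: "weak_gradient \<Omega> v g" "weak_gradient \<Omega> w h"
  shows "weak_gradient \<Omega> (\<lambda>x. a * v x + b * w x) (\<lambda>x. a *\<^sub>R g x + b *\<^sub>R h x)"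
  unfolding weak_gradient_def
proof (intro ballI allI)
  fix \<phi> i assume \<phi>: "\<phi> \<in> test_functions \<Omega>"
  note I = L2_mult_test[OF \<Omega>]
  have "(\<integral>x. (a * v x + b * w x) * partial i \<phi> x \<partial>lebesgue_on \<Omega>) =
      a * (\<integral>x. v x * partial i \<phi> x \<partial>lebesgue_on \<Omega>) + b * (\<integral>x. w x * partial i \<phi> x \<partial>lebesgue_on \<Omega>)"
    using I[OF L(1) test_functions_partial[OF \<phi>]] I[OF L(2) test_functions_partial[OF \<phi>]]
    by (simp add: ring_distribs mult.assoc)
  also have "\<dots> = - (a * (\<integral>x. g x $ i * \<phi> x \<partial>lebesgue_on \<Omega>) + b * (\<integral>x. h x $ i * \<phi> x \<partial>lebesgue_on \<Omega>))"
    using wg \<phi> by (simp add: weak_gradient_def)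
  also have "a * (\<integral>x. g x $ i * \<phi> x \<partial>lebesgue_on \<Omega>) + b * (\<integral>x. h x $ i * \<phi> x \<partial>lebesgue_on \<Omega>)
     = (\<integral>x. (a *\<^sub>R g x + b *\<^sub>R h x) $ i * \<phi> x \<partial>lebesgue_on \<Omega>)"
    using I[OF L2_component[OF L(3)] \<phi>] I[OF L2_component[OF L(4)] \<phi>]
    by (simp add: ring_distribs mult.assoc)
  finally show "(\<integral>x. (a * v x + b * w x) * partial i \<phi> x \<partial>lebesgue_on \<Omega>)
     = - (\<integral>x. (a *\<^sub>R g x + b *\<^sub>R h x) $ i * \<phi> x \<partial>lebesgue_on \<Omega>)" .
qed

lemma weak_gradient_unique:
  assumes \<Omega>: "open \<Omega>" "bounded \<Omega>" and L: "L2 \<Omega> g" "L2 \<Omega> h"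
    and wg: "weak_gradient \<Omega> v g" "weak_gradient \<Omega> v h"
  shows "AE x in lebesgue_on \<Omega>. g x = h x"
proof -
  have "AE x in lebesgue_on \<Omega>. g x $ i - h x $ i = 0" for i
  proof (rule fundamental_lemma[OF \<Omega>(1)])
    show "integrable (lebesgue_on \<Omega>) (\<lambda>x. g x $ i - h x $ i)"
      using L2_integrable[OF \<Omega> L2_component[OF L(1), of i]] L2_integrable[OF \<Omega> L2_component[OF L(2), of i]]
      by (rule Bochner_Integration.integrable_diff)
    fix \<psi> assume \<psi>: "\<psi> \<in> test_functions \<Omega>"
    have "(\<integral>x. g x $ i * \<psi> x \<partial>lebesgue_on \<Omega>) = (\<integral>x. h x $ i * \<psi> x \<partial>lebesgue_on \<Omega>)"
      using wg[unfolded weak_gradient_def, rule_format, OF \<psi>, of i] by linarith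
    then show "(\<integral>x. (g x $ i - h x $ i) * \<psi> x \<partial>lebesgue_on \<Omega>) = 0"
      using L2_mult_test[OF \<Omega> L2_component[OF L(1)] \<psi>] L2_mult_test[OF \<Omega> L2_component[OF L(2)] \<psi>]
      by (simp add: left_diff_distrib)
  qed
  from this[of 1] this[of 2] show ?thesis by eventually_elim (simp add: vec_eq_iff forall_2)
qed

text \<open>The operator \<open>grad\<close> picks some weak gradient; this lemma replaces it by any given one.\<close>

lemma grad_eq_AE:
  assumes "open \<Omega>" "bounded \<Omega>" "L2 \<Omega> g" "weak_gradient \<Omega> v g"
  shows "AE x in lebesgue_on \<Omega>. grad \<Omega> v x = g x" "L2 \<Omega> (grad \<Omega> v)" "weak_gradient \<Omega> v (grad \<Omega> v)"
proof -
  have *: "L2 \<Omega> (grad \<Omega> v) \<and> weak_gradient \<Omega> v (grad \<Omega> v)"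
    unfolding grad_def by (rule someI[of _ g]) (use assms in simp)
  then show "L2 \<Omega> (grad \<Omega> v)" "weak_gradient \<Omega> v (grad \<Omega> v)" by auto
  show "AE x in lebesgue_on \<Omega>. grad \<Omega> v x = g x"
    by (rule weak_gradient_unique) (use assms * in auto)
qed

lemma H1_grad:
  assumes "open \<Omega>" "bounded \<Omega>" "v \<in> H1 \<Omega>"
  shows "L2 \<Omega> v" "L2 \<Omega> (grad \<Omega> v)" "weak_gradient \<Omega> v (grad \<Omega> v)"
  using assms grad_eq_AE unfolding H1_def by auto

lemma L2_bounded_continuous:
  fixes f :: "real^2 \<Rightarrow> 'b::euclidean_space"
  assumes \<Omega>: "open \<Omega>" "bounded \<Omega>" and "continuous_on UNIV f"
  shows "L2 \<Omega> f"
proof -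
  interpret finite_measure "lebesgue_on \<Omega>" using finite_measure_lebesgue_on[OF \<Omega>] .
  have m: "f \<in> borel_measurable (lebesgue_on \<Omega>)"
    using borel_measurable_continuous_onI[OF assms(3)] by (intro measurable_restrict_space1 measurable_completion) simp
  have "compact (f ` closure \<Omega>)" using \<Omega> by (intro compact_continuous_image continuous_on_subset[OF assms(3)]) auto
  then obtain M where "\<forall>y\<in>f ` closure \<Omega>. norm y \<le> M" using compact_imp_bounded bounded_iff by metis
  then have M: "norm (f x) \<le> M" if "x \<in> \<Omega>" for x using that closure_subset[of \<Omega>] by auto
  have "integrable (lebesgue_on \<Omega>) (\<lambda>x. (norm (f x))\<^sup>2)"
  proof (rule integrable_const_bound[where B = "M\<^sup>2"])
    show "AE x in lebesgue_on \<Omega>. norm ((norm (f x))\<^sup>2) \<le> M\<^sup>2"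
      using M by (intro AE_I2) (simp add: space_restrict_space power_mono)
  qed (use m in measurable)
  then show ?thesis using m by (simp add: L2_def)
qed

lemma classical_grad_weak_gradient:
  assumes \<Omega>: "open \<Omega>" "bounded \<Omega>" and \<phi>: "\<phi> \<in> test_functions \<Omega>"
  shows "L2 \<Omega> \<phi>" "L2 \<Omega> (classical_grad \<phi>)" "weak_gradient \<Omega> \<phi> (classical_grad \<phi>)"
proof -
  show "L2 \<Omega> \<phi>" by (rule L2_bounded_continuous[OF \<Omega> test_functions_continuous[OF \<phi>]])
  show "L2 \<Omega> (classical_grad \<phi>)" unfolding classical_grad_def[abs_def]
    by (rule L2_bounded_continuous[OF \<Omega>])
      (intro continuous_on_vec_lambda test_functions_continuous[OF test_functions_partial[OF \<phi>]])
  show "weak_gradient \<Omega> \<phi> (classical_grad \<phi>)" unfolding weak_gradient_def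
  proof (intro ballI allI)
    fix \<psi> i assume \<psi>: "\<psi> \<in> test_functions \<Omega>"
    have \<Omega>s: "\<Omega> \<in> sets lebesgue" using \<Omega> by auto
    have t1: "(\<lambda>x. partial i \<phi> x * \<psi> x) \<in> test_functions \<Omega>"
      by (intro test_functions_mult test_functions_partial \<phi> test_functions_Ck[OF \<psi>])
    have t2: "(\<lambda>x. \<phi> x * partial i \<psi> x) \<in> test_functions \<Omega>"
      by (intro test_functions_mult test_functions_Ck[OF test_functions_partial[OF \<psi>]] \<phi>)
    have "(\<integral>x. \<phi> x * partial i \<psi> x \<partial>lborel) + (\<integral>x. partial i \<phi> x * \<psi> x \<partial>lborel) = 0"
      using integral_by_parts[OF \<phi> test_functions_Ck[OF \<psi>], of i]
        test_functions_lborel[OF t1] test_functions_lborel[OF t2]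
      by (simp add: has_bochner_integral_iff)
    moreover have "(\<integral>x. \<eta> x \<partial>lebesgue_on \<Omega>) = (\<integral>x. \<eta> x \<partial>lborel)" if "\<eta> \<in> test_functions \<Omega>" for \<eta>
      by (intro integral_lebesgue_on_lborel \<Omega>s borel_measurable_continuous_onI
          test_functions_continuous[OF that] test_functions_zero[OF that])
    note this[OF t1] this[OF t2]
    ultimately show "(\<integral>x. \<phi> x * partial i \<psi> x \<partial>lebesgue_on \<Omega>) = - (\<integral>x. classical_grad \<phi> x $ i * \<psi> x \<partial>lebesgue_on \<Omega>)"
      by (simp add: classical_grad_def)
  qed
qed

text \<open>The form is continuous in the \<open>H\<^sup>1\<close> norm, so its sign passes from test functions to their closure.
  Continuity is used in the form of Young's inequality \<open>2st \<le> \<eta>s\<^sup>2 + t\<^sup>2/\<eta>\<close>, applied to \<open>\<phi> = v - w\<close> with an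
  error \<open>w\<close> of norm below \<open>\<eta>\<close>.\<close>

lemma H10_quadratic_form_nonneg:
  assumes \<Omega>: "open \<Omega>" "bounded \<Omega>" and cm: "c \<in> borel_measurable (lebesgue_on \<Omega>)"
    and cb: "\<And>x. x \<in> \<Omega> \<Longrightarrow> \<bar>c x\<bar> \<le> C"
    and pos: "\<And>\<phi>. \<phi> \<in> test_functions \<Omega> \<Longrightarrow> 0 \<le> (\<integral>x. (norm (classical_grad \<phi> x))\<^sup>2 + c x * (\<phi> x)\<^sup>2 \<partial>lebesgue_on \<Omega>)"
    and v: "v \<in> H10 \<Omega>"
  shows "0 \<le> (\<integral>x. (norm (grad \<Omega> v x))\<^sup>2 + c x * (v x)\<^sup>2 \<partial>lebesgue_on \<Omega>)"
proof -
  let ?M = "lebesgue_on \<Omega>"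
  define C' where "C' = max C 0"
  have C': "C' \<ge> 0" "\<And>x. x \<in> \<Omega> \<Longrightarrow> \<bar>c x\<bar> \<le> C'" using cb by (auto simp: C'_def le_max_iff_disj)
  have v1: "v \<in> H1 \<Omega>" using v by (simp add: H10_def)
  note vg = H1_grad[OF \<Omega> v1]
  have sqi: "integrable ?M (\<lambda>x. c x * (f x)\<^sup>2)" if "L2 \<Omega> f" for f
  proof -
    have fm: "f \<in> borel_measurable ?M" and fi: "integrable ?M (\<lambda>x. C' * (f x)\<^sup>2)" using that by (auto simp: L2_real_iff)
    show ?thesis
      by (rule Bochner_Integration.integrable_bound[OF fi])
        (use fm cm C' in \<open>auto intro!: AE_I2 mult_right_mono simp: space_restrict_space abs_mult\<close>)
  qed
  define Q where "Q = (\<integral>x. (norm (grad \<Omega> v x))\<^sup>2 + c x * (v x)\<^sup>2 \<partial>?M)"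
  define A where "A = (\<integral>x. (norm (grad \<Omega> v x))\<^sup>2 \<partial>?M) + C' * (\<integral>x. (v x)\<^sup>2 \<partial>?M)"
  have A0: "A \<ge> 0" by (simp add: A_def C')
  have main: "0 \<le> Q + \<eta> * (A + 2 * (1 + C'))" if \<eta>: "0 < \<eta>" "\<eta> \<le> 1" for \<eta> :: real
  proof -
    obtain \<phi> where \<phi>: "\<phi> \<in> test_functions \<Omega>" "H1_norm \<Omega> (\<lambda>x. v x - \<phi> x) < \<eta>"
      using v \<eta>(1) by (auto simp: H10_def)
    define w where "w x = v x - \<phi> x" for x
    note \<phi>g = classical_grad_weak_gradient[OF \<Omega> \<phi>(1)]
    have w2: "L2 \<Omega> w" using L2_add_scaled[OF vg(1) \<phi>g(1), of 1 "-1"] by (simp add: w_def[abs_def])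
    have wg2: "L2 \<Omega> (\<lambda>x. grad \<Omega> v x - classical_grad \<phi> x)" using L2_add_scaled[OF vg(2) \<phi>g(2), of 1 "-1"] by simp
    have "weak_gradient \<Omega> w (\<lambda>x. grad \<Omega> v x - classical_grad \<phi> x)"
      using weak_gradient_add_scaled[OF \<Omega> vg(1) \<phi>g(1) vg(2) \<phi>g(2) vg(3) \<phi>g(3), of 1 "-1"] by (simp add: w_def[abs_def])
    note gw = grad_eq_AE[OF \<Omega> wg2 this]
    define e where "e = (\<integral>x. (w x)\<^sup>2 \<partial>?M) + (\<integral>x. (norm (grad \<Omega> w x))\<^sup>2 \<partial>?M)"
    have e: "0 \<le> e" "e \<le> \<eta>\<^sup>2"
    proof -
      show "0 \<le> e" by (simp add: e_def)
      have "w = (\<lambda>x. v x - \<phi> x)" by (simp add: w_def[abs_def])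
      then have "H1_norm \<Omega> w < \<eta>" using \<phi>(2) by simp
      then have "sqrt e < \<eta>" by (simp add: H1_norm_def e_def)
      then show "e \<le> \<eta>\<^sup>2" by (metis \<open>0 \<le> e\<close> less_eq_real_def real_sqrt_ge_zero real_sqrt_pow2 power_mono)
    qed
    have i: "integrable ?M (\<lambda>x. (norm (grad \<Omega> v x))\<^sup>2)" "integrable ?M (\<lambda>x. (norm (grad \<Omega> w x))\<^sup>2)"
      "integrable ?M (\<lambda>x. (v x)\<^sup>2)" "integrable ?M (\<lambda>x. (w x)\<^sup>2)" "integrable ?M (\<lambda>x. (norm (classical_grad \<phi> x))\<^sup>2)"
      using vg gw w2 \<phi>g by (auto simp: L2_def)
    have "0 \<le> (\<integral>x. (norm (classical_grad \<phi> x))\<^sup>2 + c x * (\<phi> x)\<^sup>2 \<partial>?M)" using pos[OF \<phi>(1)] .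
    also have "\<dots> \<le> (\<integral>x. ((norm (grad \<Omega> v x))\<^sup>2 + c x * (v x)\<^sup>2) + \<eta> * ((norm (grad \<Omega> v x))\<^sup>2 + C' * (v x)\<^sup>2)
         + (1 + 1 / \<eta>) * (1 + C') * ((w x)\<^sup>2 + (norm (grad \<Omega> w x))\<^sup>2) \<partial>?M)"
    proof (rule integral_mono_AE)
      show "integrable ?M (\<lambda>x. (norm (classical_grad \<phi> x))\<^sup>2 + c x * (\<phi> x)\<^sup>2)" using i sqi[OF \<phi>g(1)] by simp
      show "integrable ?M (\<lambda>x. ((norm (grad \<Omega> v x))\<^sup>2 + c x * (v x)\<^sup>2) + \<eta> * ((norm (grad \<Omega> v x))\<^sup>2 + C' * (v x)\<^sup>2)
         + (1 + 1 / \<eta>) * (1 + C') * ((w x)\<^sup>2 + (norm (grad \<Omega> w x))\<^sup>2))"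
        using i sqi[OF vg(1)] by simp
      have "AE x in ?M. x \<in> \<Omega>" by (intro AE_I2) (simp add: space_restrict_space)
      with gw(1) show "AE x in ?M. (norm (classical_grad \<phi> x))\<^sup>2 + c x * (\<phi> x)\<^sup>2 \<le>
          ((norm (grad \<Omega> v x))\<^sup>2 + c x * (v x)\<^sup>2) + \<eta> * ((norm (grad \<Omega> v x))\<^sup>2 + C' * (v x)\<^sup>2)
         + (1 + 1 / \<eta>) * (1 + C') * ((w x)\<^sup>2 + (norm (grad \<Omega> w x))\<^sup>2)"
      proof eventually_elim
        case (elim x)
        let ?a = "norm (grad \<Omega> v x)" and ?b = "norm (grad \<Omega> w x)"
        have young: "2 * s * t \<le> \<eta> * s\<^sup>2 + t\<^sup>2 / \<eta>" for s t :: real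
        proof -
          have "0 \<le> (\<eta> * s - t)\<^sup>2 / \<eta>" using \<eta> by simp
          also have "\<dots> = \<eta> * s\<^sup>2 + t\<^sup>2 / \<eta> - 2 * s * t"
            using \<eta> by (simp add: power2_eq_square field_simps)
          finally show ?thesis by simp
        qed
        have "classical_grad \<phi> x = grad \<Omega> v x - grad \<Omega> w x" using elim by simp
        then have "(norm (classical_grad \<phi> x))\<^sup>2 \<le> (?a + ?b)\<^sup>2" by (intro power_mono) (simp_all add: norm_triangle_ineq4)
        also have "\<dots> \<le> ?a\<^sup>2 + \<eta> * ?a\<^sup>2 + (1 + 1 / \<eta>) * ?b\<^sup>2"
          using young[of ?a ?b] unfolding power2_sum by (simp add: ring_distribs)
        finally have 1: "(norm (classical_grad \<phi> x))\<^sup>2 \<le> ?a\<^sup>2 + \<eta> * ?a\<^sup>2 + (1 + 1 / \<eta>) * ?b\<^sup>2" .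
        have "c x * (\<phi> x)\<^sup>2 = c x * (v x)\<^sup>2 + (- 2 * c x * v x * w x) + c x * (w x)\<^sup>2"
          by (simp add: w_def power2_eq_square algebra_simps)
        also have "- 2 * c x * v x * w x \<le> C' * (2 * \<bar>v x\<bar> * \<bar>w x\<bar>)"
        proof -
          have "- 2 * c x * v x * w x \<le> \<bar>c x\<bar> * (2 * \<bar>v x\<bar> * \<bar>w x\<bar>)"
            using abs_ge_self[of "- 2 * c x * v x * w x"] by (simp add: abs_mult algebra_simps)
          also have "\<dots> \<le> C' * (2 * \<bar>v x\<bar> * \<bar>w x\<bar>)" using C'(2) elim by (intro mult_right_mono) auto
          finally show ?thesis .
        qed
        also have "C' * (2 * \<bar>v x\<bar> * \<bar>w x\<bar>) \<le> C' * (\<eta> * (v x)\<^sup>2 + (w x)\<^sup>2 / \<eta>)"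
          using young[of "\<bar>v x\<bar>" "\<bar>w x\<bar>"] C'(1) by (intro mult_left_mono) auto
        also have "c x * (w x)\<^sup>2 \<le> C' * (w x)\<^sup>2" using C'(2)[of x] elim by (intro mult_right_mono) auto
        finally have 2: "c x * (\<phi> x)\<^sup>2 \<le> c x * (v x)\<^sup>2 + C' * (\<eta> * (v x)\<^sup>2 + (w x)\<^sup>2 / \<eta>) + C' * (w x)\<^sup>2"
          by simp
        have 3: "0 \<le> (1 + 1 / \<eta>) * (w x)\<^sup>2" "0 \<le> (1 + 1 / \<eta>) * C' * ?b\<^sup>2"
          using \<eta> C' by (intro mult_nonneg_nonneg add_nonneg_nonneg; simp)+
        show ?case using 1 2 3 by (simp add: algebra_simps add_divide_distrib)
      qed
    qed
    also have "\<dots> = Q + \<eta> * A + (1 + 1 / \<eta>) * (1 + C') * e"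
      unfolding Q_def A_def e_def using i sqi[OF vg(1)] by simp
    also have "(1 + 1 / \<eta>) * (1 + C') * e \<le> (1 + 1 / \<eta>) * (1 + C') * \<eta>\<^sup>2"
      using e \<eta> C' by (intro mult_left_mono) auto
    also have "\<dots> = (1 + C') * (\<eta>\<^sup>2 + \<eta>)" using \<eta> by (simp add: power2_eq_square field_simps)
    also have "\<dots> \<le> (1 + C') * (2 * \<eta>)" using \<eta> C' by (intro mult_left_mono) (auto simp: power2_eq_square mult_le_cancel_right2)
    finally show ?thesis by (simp add: algebra_simps)
  qed
  have "0 \<le> Q"
  proof (rule ccontr)
    assume "\<not> 0 \<le> Q"
    \<comment> \<open>Chosen such that \<open>\<eta> T \<le> - Q / 2\<close>.\<close>
    define T where "T = A + 2 * (1 + C')"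
    define \<eta> where "\<eta> = min 1 (- Q / (2 * T))"
    have T: "T > 0" using A0 C' by (simp add: T_def)
    have "0 < - Q / (2 * T)" using \<open>\<not> 0 \<le> Q\<close> T by (intro divide_pos_pos) auto
    then have "0 < \<eta>" "\<eta> \<le> 1" by (auto simp: \<eta>_def)
    moreover have "\<eta> * T \<le> (- Q / (2 * T)) * T"
      using T by (intro mult_right_mono) (auto simp: \<eta>_def)
    then have "\<eta> * (A + 2 * (1 + C')) \<le> - Q / 2" using T unfolding T_def[symmetric] by simp
    ultimately show False using main[of \<eta>] \<open>\<not> 0 \<le> Q\<close> by linarith
  qed
  then show ?thesis by (simp add: Q_def)
qed

section \<open>Rayleigh quotients in an annulus\<close>

lemma annulus_basic:
  shows "open (annulus n)" "bounded (annulus n)" "annulus n \<subseteq> cball 0 1" "annulus n \<in> sets lebesgue"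
proof -
  have "annulus n = norm -` {1 / real n <..< 1}" by (auto simp: annulus_def)
  then show o: "open (annulus n)" by (metis continuous_on_norm_id open_greaterThanLessThan open_vimage)
  show s: "annulus n \<subseteq> cball 0 1" by (auto simp: annulus_def)
  then show "bounded (annulus n)" by (rule bounded_subset[OF bounded_cball])
  show "annulus n \<in> sets lebesgue" using o by auto
qed

lemma annulus_norm:
  assumes "x \<in> annulus n" "n \<ge> 1" shows "1 / real n < norm x" "norm x < 1" "0 < norm x" "1 / (norm x)\<^sup>2 \<le> (real n)\<^sup>2"
proof -
  show 1: "1 / real n < norm x" "norm x < 1" using assms by (auto simp: annulus_def)
  have "0 < 1 / real n" using assms by simp
  then show 2: "0 < norm x" using 1 by linarith
  have "1 / norm x \<le> real n" using 1 2 assms by (simp add: field_simps)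
  then have "(1 / norm x)\<^sup>2 \<le> (real n)\<^sup>2" using 2 by (intro power_mono) auto
  then show "1 / (norm x)\<^sup>2 \<le> (real n)\<^sup>2" by (simp add: power_divide)
qed

text \<open>In the annulus the weight lies between \<open>1\<close> and \<open>n\<^sup>2\<close>, so it changes neither integrability nor the
  null functions.\<close>

lemma inverse_square_weight:
  assumes "n \<ge> 1"
  shows "(\<lambda>x. 1 / (norm x)\<^sup>2) \<in> borel_measurable (lebesgue_on (annulus n))"
    "L2 (annulus n) v \<Longrightarrow> integrable (lebesgue_on (annulus n)) (\<lambda>x. (v x)\<^sup>2 / (norm x)\<^sup>2)"
    "L2 (annulus n) v \<Longrightarrow> \<not> ae_zero (annulus n) v \<Longrightarrow> 0 < (\<integral>x. (v x)\<^sup>2 / (norm x)\<^sup>2 \<partial>lebesgue_on (annulus n))"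
proof -
  let ?M = "lebesgue_on (annulus n)"
  have m: "(\<lambda>x::real^2. 1 / (norm x)\<^sup>2) \<in> borel_measurable ?M" by (intro measurable_restrict_space1 measurable_completion) measurable
  then show "(\<lambda>x::real^2. 1 / (norm x)\<^sup>2) \<in> borel_measurable ?M" .
  have i: "integrable ?M (\<lambda>x. (v x)\<^sup>2 / (norm x)\<^sup>2)" if "L2 (annulus n) v" for v :: "real^2 \<Rightarrow> real"
  proof -
    have vm: "v \<in> borel_measurable ?M" and vi: "integrable ?M (\<lambda>x. (real n)\<^sup>2 * (v x)\<^sup>2)" using that by (auto simp: L2_real_iff)
    show ?thesis
    proof (rule Bochner_Integration.integrable_bound[OF vi])
      have "(\<lambda>x. (v x)\<^sup>2 * (1 / (norm x)\<^sup>2)) \<in> borel_measurable ?M" using vm m by measurable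
      then show "(\<lambda>x. (v x)\<^sup>2 / (norm x)\<^sup>2) \<in> borel_measurable ?M" by simp
      show "AE x in ?M. norm ((v x)\<^sup>2 / (norm x)\<^sup>2) \<le> norm ((real n)\<^sup>2 * (v x)\<^sup>2)"
      proof (rule AE_I2)
        fix x assume "x \<in> space ?M"
        then have "x \<in> annulus n" by (simp add: space_restrict_space)
        from mult_right_mono[OF annulus_norm(4)[OF this assms], of "(v x)\<^sup>2"]
        show "norm ((v x)\<^sup>2 / (norm x)\<^sup>2) \<le> norm ((real n)\<^sup>2 * (v x)\<^sup>2)" by simp
      qed
    qed
  qed
  then show "L2 (annulus n) v \<Longrightarrow> integrable ?M (\<lambda>x. (v x)\<^sup>2 / (norm x)\<^sup>2)" .
  assume v: "L2 (annulus n) v" "\<not> ae_zero (annulus n) v"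
  have "(\<integral>x. (v x)\<^sup>2 / (norm x)\<^sup>2 \<partial>?M) \<noteq> 0"
  proof
    assume "(\<integral>x. (v x)\<^sup>2 / (norm x)\<^sup>2 \<partial>?M) = 0"
    then have "AE x in ?M. (v x)\<^sup>2 / (norm x)\<^sup>2 = 0"
      using integral_nonneg_eq_0_iff_AE[OF i[OF v(1)]] by simp
    moreover have "AE x in ?M. x \<in> annulus n" by (intro AE_I2) (simp add: space_restrict_space)
    ultimately have "AE x in ?M. v x = 0"
      by eventually_elim (use annulus_norm(3) assms in force)
    then show False using v by (simp add: ae_zero_def)
  qed
  moreover have "0 \<le> (\<integral>x. (v x)\<^sup>2 / (norm x)\<^sup>2 \<partial>?M)" by simp
  ultimately show "0 < (\<integral>x. (v x)\<^sup>2 / (norm x)\<^sup>2 \<partial>?M)" by linarith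
qed

lemma potential_facts:
  assumes p: "p > 1" and u: "continuous_on (cball 0 1) (u :: real^2 \<Rightarrow> real)"
  shows "(\<lambda>x. p * \<bar>u x\<bar> powr (p - 1)) \<in> borel_measurable (lebesgue_on (annulus n))"
    "\<exists>C. \<forall>x\<in>cball 0 1. \<bar>p * \<bar>u x\<bar> powr (p - 1)\<bar> \<le> C"
proof -
  have c: "continuous_on (cball 0 1) (\<lambda>x. p * \<bar>u x\<bar> powr (p - 1))"
    using p by (intro continuous_intros continuous_on_powr' u) auto
  have "continuous_on (annulus n) (\<lambda>x. p * \<bar>u x\<bar> powr (p - 1))"
    using continuous_on_subset[OF c annulus_basic(3)] .
  then show "(\<lambda>x. p * \<bar>u x\<bar> powr (p - 1)) \<in> borel_measurable (lebesgue_on (annulus n))"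
    using annulus_basic(4) by (rule continuous_imp_measurable_on_sets_lebesgue)
  have "compact ((\<lambda>x. p * \<bar>u x\<bar> powr (p - 1)) ` cball 0 1)" by (intro compact_continuous_image c) simp
  then obtain C where "\<forall>y\<in>(\<lambda>x. p * \<bar>u x\<bar> powr (p - 1)) ` cball 0 1. norm y \<le> C"
    using compact_imp_bounded bounded_iff by metis
  then show "\<exists>C. \<forall>x\<in>cball 0 1. \<bar>p * \<bar>u x\<bar> powr (p - 1)\<bar> \<le> C" by auto
qed

lemma potential_integrable:
  assumes p: "p > 1" and u: "continuous_on (cball 0 1) (u :: real^2 \<Rightarrow> real)" and v: "L2 (annulus n) v"
  shows "integrable (lebesgue_on (annulus n)) (\<lambda>x. p * \<bar>u x\<bar> powr (p - 1) * (v x)\<^sup>2)"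
proof -
  obtain C where C: "\<And>x. x \<in> cball 0 1 \<Longrightarrow> \<bar>p * \<bar>u x\<bar> powr (p - 1)\<bar> \<le> C"
    using potential_facts(2)[OF p u] by blast
  have vm: "v \<in> borel_measurable (lebesgue_on (annulus n))"
    and vi: "integrable (lebesgue_on (annulus n)) (\<lambda>x. C * (v x)\<^sup>2)" using v by (auto simp: L2_real_iff)
  show ?thesis
  proof (rule Bochner_Integration.integrable_bound[OF vi])
    show "(\<lambda>x. p * \<bar>u x\<bar> powr (p - 1) * (v x)\<^sup>2) \<in> borel_measurable (lebesgue_on (annulus n))"
      using vm potential_facts(1)[OF p u] by measurable
    show "AE x in lebesgue_on (annulus n). norm (p * \<bar>u x\<bar> powr (p - 1) * (v x)\<^sup>2) \<le> norm (C * (v x)\<^sup>2)"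
    proof (rule AE_I2)
      fix x assume "x \<in> space (lebesgue_on (annulus n))"
      then have "x \<in> annulus n" by (simp add: space_restrict_space)
      then have "x \<in> cball 0 1" using annulus_basic(3) by blast
      from mult_right_mono[OF C[OF this], of "(v x)\<^sup>2"]
      show "norm (p * \<bar>u x\<bar> powr (p - 1) * (v x)\<^sup>2) \<le> norm (C * (v x)\<^sup>2)"
        by (simp add: abs_mult) (smt (verit) mult_right_mono zero_le_power2)
    qed
  qed
qed

lemma rayleigh_lower_bound:
  assumes p: "p > 1" and u: "continuous_on (cball 0 1) u" and n: "n \<ge> 1"
    and pos: "\<And>\<phi>. \<phi> \<in> test_functions (annulus n) \<Longrightarrow>
       0 \<le> (\<integral>x. (norm (classical_grad \<phi> x))\<^sup>2 + (lam / (norm x)\<^sup>2 - p * \<bar>u x\<bar> powr (p - 1)) * (\<phi> x)\<^sup>2 \<partial>lebesgue_on (annulus n))"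
    and v: "v \<in> H10 (annulus n)" "\<not> ae_zero (annulus n) v"
  shows "- lam \<le> rayleigh p u n v"
proof -
  let ?M = "lebesgue_on (annulus n)"
  note A = annulus_basic(1,2)[of n]
  have v1: "v \<in> H1 (annulus n)" using v by (simp add: H10_def)
  note vg = H1_grad[OF A v1]
  obtain C where C: "\<And>x. x \<in> cball 0 1 \<Longrightarrow> \<bar>p * \<bar>u x\<bar> powr (p - 1)\<bar> \<le> C"
    using potential_facts(2)[OF p u] by blast
  have "0 \<le> (\<integral>x. (norm (grad (annulus n) v x))\<^sup>2 + (lam / (norm x)\<^sup>2 - p * \<bar>u x\<bar> powr (p - 1)) * (v x)\<^sup>2 \<partial>?M)"
  proof (rule H10_quadratic_form_nonneg[OF A _ _ pos v(1)])
    have "(\<lambda>x. lam * (1 / (norm x)\<^sup>2) - p * \<bar>u x\<bar> powr (p - 1)) \<in> borel_measurable ?M"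
      using inverse_square_weight(1)[OF n] potential_facts(1)[OF p u, of n] by measurable
    then show "(\<lambda>x. lam / (norm x)\<^sup>2 - p * \<bar>u x\<bar> powr (p - 1)) \<in> borel_measurable ?M" by simp
    fix x assume x: "x \<in> annulus n"
    have "\<bar>lam / (norm x)\<^sup>2\<bar> \<le> \<bar>lam\<bar> * (real n)\<^sup>2"
      using mult_left_mono[OF annulus_norm(4)[OF x n], of "\<bar>lam\<bar>"] by simp
    then show "\<bar>lam / (norm x)\<^sup>2 - p * \<bar>u x\<bar> powr (p - 1)\<bar> \<le> \<bar>lam\<bar> * (real n)\<^sup>2 + C"
      using C[OF subsetD[OF annulus_basic(3) x]] by linarith
  qed
  also have "\<dots> = (\<integral>x. ((norm (grad (annulus n) v x))\<^sup>2 - p * \<bar>u x\<bar> powr (p - 1) * (v x)\<^sup>2) + lam * ((v x)\<^sup>2 / (norm x)\<^sup>2) \<partial>?M)"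
    by (intro Bochner_Integration.integral_cong) (auto simp: algebra_simps)
  also have "\<dots> = (\<integral>x. ((norm (grad (annulus n) v x))\<^sup>2 - p * \<bar>u x\<bar> powr (p - 1) * (v x)\<^sup>2) \<partial>?M) + lam * (\<integral>x. (v x)\<^sup>2 / (norm x)\<^sup>2 \<partial>?M)"
    (is "_ = integral\<^sup>L ?M ?f + lam * integral\<^sup>L ?M ?g")
  proof -
    have "integrable ?M ?f" using potential_integrable[OF p u vg(1)] vg(2) by (simp add: L2_def)
    moreover have "integrable ?M (\<lambda>x. lam * ?g x)"
      using inverse_square_weight(2)[OF n vg(1)] by (rule integrable_mult_right)
    ultimately show ?thesis
      by (simp only: Bochner_Integration.integral_add integral_mult_right_zero)
  qed
  finally show ?thesis
    using inverse_square_weight(3)[OF n vg(1) v(2)] by (simp add: rayleigh_def pos_le_divide_eq)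
qed

lemma test_functions_H10:
  assumes \<Omega>: "open \<Omega>" "bounded \<Omega>" and \<phi>: "\<phi> \<in> test_functions \<Omega>"
  shows "\<phi> \<in> H10 \<Omega>"
proof -
  note g = classical_grad_weak_gradient[OF \<Omega> \<phi>]
  have z: "L2 \<Omega> (\<lambda>x. 0 :: real^2)" by (simp add: L2_def)
  have "weak_gradient \<Omega> (\<lambda>x. 0) (\<lambda>x. 0)" by (simp add: weak_gradient_def)
  from grad_eq_AE(1)[OF \<Omega> z this] have "AE x in lebesgue_on \<Omega>. (norm (grad \<Omega> (\<lambda>x. 0) x))\<^sup>2 = 0"
    by eventually_elim simp
  then have "(\<integral>x. (norm (grad \<Omega> (\<lambda>x. 0) x))\<^sup>2 \<partial>lebesgue_on \<Omega>) = 0" by (rule integral_eq_zero_AE)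
  then have "H1_norm \<Omega> (\<lambda>x. \<phi> x - \<phi> x) = 0" by (simp add: H1_norm_def)
  then show ?thesis using g \<phi> unfolding H10_def H1_def by force
qed

lemma green_identity:
  assumes \<phi>: "\<phi> \<in> test_functions \<Omega>"
  shows "(\<integral>x. (norm (classical_grad \<phi> x))\<^sup>2 \<partial>lborel) = - (\<integral>x. \<phi> x * laplacian \<phi> x \<partial>lborel)"
proof -
  have p: "partial i \<phi> \<in> test_functions \<Omega>" "partial i (partial i \<phi>) \<in> test_functions \<Omega>" for i
    by (intro test_functions_partial \<phi>)+
  have t: "integrable lborel (\<lambda>x. partial i \<phi> x * partial i \<phi> x)"
      "integrable lborel (\<lambda>x. \<phi> x * partial i (partial i \<phi>) x)" for i
    by (rule test_functions_lborel[OF test_functions_mult[OF p(1) test_functions_Ck[OF p(1)]]],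
        rule test_functions_lborel[OF test_functions_mult[OF \<phi> test_functions_Ck[OF p(2)]]])
  have "(\<integral>x. partial i \<phi> x * partial i \<phi> x \<partial>lborel) + (\<integral>x. \<phi> x * partial i (partial i \<phi>) x \<partial>lborel) = 0" for i
    using integral_by_parts[OF \<phi> test_functions_Ck[OF p(1)[of i]], of i] t[of i]
    by (simp add: has_bochner_integral_iff)
  from this[of 1] this[of 2] show ?thesis using t
    by (simp add: norm_vec_def L2_set_def classical_grad_def laplacian_def sum_2 power2_eq_square ring_distribs)
qed

text \<open>By Green's identity, a pointwise inequality for the Laplacian, such as the one satisfied by a
  nonnegative subsolution of the eigenvalue equation, bounds the Rayleigh quotient.\<close>

lemma rayleigh_upper_bound:
  assumes p: "p > 1" and u: "continuous_on (cball 0 1) u" and n: "n \<ge> 1"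
    and v: "v \<in> test_functions (annulus n)" "\<not> ae_zero (annulus n) v"
    and le: "\<And>x. x \<in> annulus n \<Longrightarrow> - v x * laplacian v x - p * \<bar>u x\<bar> powr (p - 1) * (v x)\<^sup>2 \<le> \<Lambda> * ((v x)\<^sup>2 / (norm x)\<^sup>2)"
  shows "rayleigh p u n v \<le> \<Lambda>"
proof -
  let ?M = "lebesgue_on (annulus n)"
  note A = annulus_basic(1,2)[of n]
  note g = classical_grad_weak_gradient[OF A v(1)]
  note gr = grad_eq_AE[OF A g(2,3)]
  have cg: "(\<lambda>x. (norm (classical_grad v x))\<^sup>2) \<in> borel_measurable borel" unfolding classical_grad_def
    by (intro borel_measurable_continuous_onI continuous_intros continuous_on_vec_lambda
      test_functions_continuous[OF test_functions_partial[OF v(1)]])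
  have cz: "classical_grad v x = 0" if "x \<notin> annulus n" for x
    using test_functions_zero[OF test_functions_partial[OF v(1)] that] by (simp add: classical_grad_def vec_eq_iff)
  have lt: "(\<lambda>x. v x * partial i (partial i v) x) \<in> test_functions (annulus n)" for i
    by (intro test_functions_mult v test_functions_Ck[OF test_functions_partial[OF test_functions_partial[OF v(1)]]])
  have li: "integrable lborel (\<lambda>x. v x * laplacian v x)"
    using test_functions_lborel[OF lt[of 1]] test_functions_lborel[OF lt[of 2]]
    by (simp add: laplacian_def sum_2 ring_distribs)
  then have li': "integrable ?M (\<lambda>x. v x * laplacian v x)"
    by (rule integrable_lebesgue_on_lborel[OF annulus_basic(4)])
  have "(\<integral>x. (norm (grad (annulus n) v x))\<^sup>2 \<partial>?M) = (\<integral>x. (norm (classical_grad v x))\<^sup>2 \<partial>?M)"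
    using gr(1,2) g(2) by (intro integral_cong_AE) (auto simp: L2_def)
  also have "\<dots> = (\<integral>x. (norm (classical_grad v x))\<^sup>2 \<partial>lborel)"
    by (rule integral_lebesgue_on_lborel[OF annulus_basic(4) cg]) (simp add: cz)
  also have "\<dots> = - (\<integral>x. v x * laplacian v x \<partial>lborel)" by (rule green_identity[OF v(1)])
  also have "(\<integral>x. v x * laplacian v x \<partial>lborel) = (\<integral>x. v x * laplacian v x \<partial>?M)"
    by (rule integral_lebesgue_on_lborel[OF annulus_basic(4), symmetric])
      (use li test_functions_zero[OF v(1)] in auto)
  finally have eq: "(\<integral>x. (norm (grad (annulus n) v x))\<^sup>2 \<partial>?M) = - (\<integral>x. v x * laplacian v x \<partial>?M)" .
  note pi = potential_integrable[OF p u g(1)] and wi = inverse_square_weight(2)[OF n g(1)]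
  have "(\<integral>x. (norm (grad (annulus n) v x))\<^sup>2 - p * \<bar>u x\<bar> powr (p - 1) * (v x)\<^sup>2 \<partial>?M)
     = (\<integral>x. - v x * laplacian v x - p * \<bar>u x\<bar> powr (p - 1) * (v x)\<^sup>2 \<partial>?M)"
    using eq pi li' gr(2) by (simp add: L2_def)
  also have "\<dots> \<le> (\<integral>x. \<Lambda> * ((v x)\<^sup>2 / (norm x)\<^sup>2) \<partial>?M)"
  proof (rule integral_mono)
    show "integrable ?M (\<lambda>x. \<Lambda> * ((v x)\<^sup>2 / (norm x)\<^sup>2))" using wi by (rule integrable_mult_right)
  qed (use pi li' le in \<open>auto simp: space_restrict_space\<close>)
  also have "\<dots> = \<Lambda> * (\<integral>x. (v x)\<^sup>2 / (norm x)\<^sup>2 \<partial>?M)" by (rule integral_mult_right_zero)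
  finally show ?thesis
    using inverse_square_weight(3)[OF n g(1) v(2)] by (simp add: rayleigh_def pos_divide_le_eq)
qed

lemma rayleigh_scale:
  assumes p: "p > 1" and u: "continuous_on (cball 0 1) u" and v: "v \<in> H1 (annulus n)" and c: "c \<noteq> 0"
  shows "rayleigh p u n (\<lambda>x. c * v x) = rayleigh p u n v"
proof -
  let ?M = "lebesgue_on (annulus n)"
  note A = annulus_basic(1,2)[of n]
  note g = H1_grad[OF A v]
  have l2: "L2 (annulus n) (\<lambda>x. c *\<^sub>R grad (annulus n) v x)" using L2_add_scaled[OF g(2,2), of c 0] by simp
  have "weak_gradient (annulus n) (\<lambda>x. c * v x) (\<lambda>x. c *\<^sub>R grad (annulus n) v x)"
    using weak_gradient_add_scaled[OF A g(1,1,2,2,3,3), of c 0] by simp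
  note gr = grad_eq_AE[OF A l2 this]
  have "(\<integral>x. (norm (grad (annulus n) (\<lambda>x. c * v x) x))\<^sup>2 \<partial>?M) = (\<integral>x. c\<^sup>2 * (norm (grad (annulus n) v x))\<^sup>2 \<partial>?M)"
  proof (rule integral_cong_AE)
    show "(\<lambda>x. (norm (grad (annulus n) (\<lambda>x. c * v x) x))\<^sup>2) \<in> borel_measurable ?M"
      "(\<lambda>x. c\<^sup>2 * (norm (grad (annulus n) v x))\<^sup>2) \<in> borel_measurable ?M"
      using gr(2) g(2) by (auto simp: L2_def)
    show "AE x in ?M. (norm (grad (annulus n) (\<lambda>x. c * v x) x))\<^sup>2 = c\<^sup>2 * (norm (grad (annulus n) v x))\<^sup>2"
      using gr(1) by eventually_elim (simp add: power_mult_distrib)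
  qed
  moreover have "(\<integral>x. p * \<bar>u x\<bar> powr (p - 1) * (c * v x)\<^sup>2 \<partial>?M) = c\<^sup>2 * (\<integral>x. p * \<bar>u x\<bar> powr (p - 1) * (v x)\<^sup>2 \<partial>?M)"
  proof -
    have "p * \<bar>u x\<bar> powr (p - 1) * (c * v x)\<^sup>2 = c\<^sup>2 * (p * \<bar>u x\<bar> powr (p - 1) * (v x)\<^sup>2)" for x
      by (simp add: power_mult_distrib)
    then show ?thesis by (simp only: integral_mult_right_zero)
  qed
  moreover have "L2 (annulus n) (\<lambda>x. c * v x)" using L2_add_scaled[OF g(1,1), of c 0] by simp
  ultimately have "(\<integral>x. (norm (grad (annulus n) (\<lambda>x. c * v x) x))\<^sup>2 - p * \<bar>u x\<bar> powr (p - 1) * (c * v x)\<^sup>2 \<partial>?M)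
    = c\<^sup>2 * (\<integral>x. (norm (grad (annulus n) v x))\<^sup>2 - p * \<bar>u x\<bar> powr (p - 1) * (v x)\<^sup>2 \<partial>?M)"
    using gr(2) g(2) potential_integrable[OF p u g(1)] potential_integrable[OF p u, of n "\<lambda>x. c * v x"]
    by (simp add: L2_def right_diff_distrib)
  moreover have "(\<integral>x. (c * v x)\<^sup>2 / (norm x)\<^sup>2 \<partial>?M) = c\<^sup>2 * (\<integral>x. (v x)\<^sup>2 / (norm x)\<^sup>2 \<partial>?M)"
    by (simp add: power_mult_distrib flip: times_divide_eq_right)
  ultimately show ?thesis using c by (simp add: rayleigh_def)
qed

text \<open>For \<open>i = 1\<close> the maximum in the min-max formula is taken over multiples of one function, on which
  the Rayleigh quotient is constant.\<close>

lemma radial_eigenvalue_1_bounds: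
  assumes p: "p > 1" and u: "continuous_on (cball 0 1) u"
    and low: "\<And>v. v \<in> H10_rad (annulus n) \<Longrightarrow> \<not> ae_zero (annulus n) v \<Longrightarrow> lo \<le> rayleigh p u n v"
    and v0: "v0 \<in> H10_rad (annulus n)" "\<not> ae_zero (annulus n) v0" "rayleigh p u n v0 \<le> hi"
  shows "lo \<le> radial_eigenvalue p u n 1" "radial_eigenvalue p u n 1 \<le> hi"
proof -
  define S where "S = {v. (\<forall>j<1::nat. v j \<in> H10_rad (annulus n)) \<and> ae_independent (annulus n) 1 v}"
  define q where "q v = (SUP c \<in> {c. \<exists>j<1::nat. c j \<noteq> 0}. rayleigh p u n (lincomb 1 c v))" for v
  have re: "radial_eigenvalue p u n 1 = (INF v \<in> S. q v)"
    by (simp add: radial_eigenvalue_def S_def q_def)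
  have lc: "lincomb 1 c v = (\<lambda>x. c 0 * v 0 x)" for c v by (simp add: lincomb_def fun_eq_iff)
  have ind: "ae_independent (annulus n) 1 v \<longleftrightarrow> \<not> ae_zero (annulus n) (v 0)" for v
  proof
    assume *: "ae_independent (annulus n) 1 v"
    show "\<not> ae_zero (annulus n) (v 0)"
    proof
      assume "ae_zero (annulus n) (v 0)"
      then have "ae_zero (annulus n) (lincomb 1 (\<lambda>_. 1) v)" unfolding lc by simp
      then show False using * unfolding ae_independent_def by fastforce
    qed
  next
    assume *: "\<not> ae_zero (annulus n) (v 0)"
    show "ae_independent (annulus n) 1 v" unfolding ae_independent_def
    proof (intro allI impI)
      fix c and j :: nat assume c: "ae_zero (annulus n) (lincomb 1 c v)" and "j < 1"
      have "c 0 = 0"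
      proof (rule ccontr)
        assume "c 0 \<noteq> 0"
        then have "ae_zero (annulus n) (v 0)" using c unfolding ae_zero_def lc by simp
        then show False using * by simp
      qed
      then show "c j = 0" using \<open>j < 1\<close> by simp
    qed
  qed
  have q: "q v = rayleigh p u n (v 0)" if "v \<in> S" for v
  proof -
    have v1: "v 0 \<in> H1 (annulus n)" using that by (simp add: S_def H10_rad_def H10_def)
    have "rayleigh p u n (lincomb 1 c v) = rayleigh p u n (v 0)" if "c \<in> {c. \<exists>j<1::nat. c j \<noteq> 0}" for c
      using rayleigh_scale[OF p u v1, of "c 0"] that unfolding lc by simp
    then have "q v = (SUP c \<in> {c :: nat \<Rightarrow> real. \<exists>j<1::nat. c j \<noteq> 0}. rayleigh p u n (v 0))"
      unfolding q_def by (intro SUP_cong) auto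
    also have "\<dots> = rayleigh p u n (v 0)"
      by (rule cSUP_const) (auto intro!: exI[of _ "\<lambda>_. 1"])
    finally show ?thesis .
  qed
  have inS: "(\<lambda>_. v0) \<in> S" using v0 ind[of "\<lambda>_. v0"] by (simp add: S_def)
  have lowS: "lo \<le> q v" if "v \<in> S" for v
    using low[of "v 0"] that q[OF that] ind[of v] by (simp add: S_def)
  show "lo \<le> radial_eigenvalue p u n 1" unfolding re using inS lowS by (intro cINF_greatest) auto
  have "(INF v \<in> S. q v) \<le> q (\<lambda>_. v0)"
    by (rule cINF_lower[OF _ inS]) (use lowS in \<open>auto intro!: bdd_belowI[of _ lo]\<close>)
  then show "radial_eigenvalue p u n 1 \<le> hi" using q[OF inS] v0(3) re by simp
qed

section \<open>A Hardy inequality\<close>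

text \<open>Clamping the argument extends a Lipschitz function from an interval to the line. Finitely many
  kinks are admitted, since the fundamental theorem of calculus tolerates them.\<close>

lemma lipschitz_clamp:
  fixes k :: "real \<Rightarrow> real"
  assumes ab: "a \<le> b" and S: "finite S" and cont: "continuous_on {a..b} k"
    and d: "\<And>r. a < r \<Longrightarrow> r < b \<Longrightarrow> r \<notin> S \<Longrightarrow> (k has_real_derivative k' r) (at r)"
    and M: "\<And>r. a < r \<Longrightarrow> r < b \<Longrightarrow> r \<notin> S \<Longrightarrow> \<bar>k' r\<bar> \<le> M" and M0: "0 \<le> M"
  shows "M-lipschitz_on UNIV (\<lambda>r. k (max a (min b r)))"
proof -
  have le: "\<bar>k s - k r\<bar> \<le> M * (s - r)" if rs: "a \<le> r" "r \<le> s" "s \<le> b" for r s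
  proof -
    define f where "f x = (if x \<in> {r<..<s} - S then k' x else 0)" for x
    have "(f has_integral (k s - k r)) {r..s}"
    proof (rule fundamental_theorem_of_calculus_interior_strong[OF S rs(2)])
      show "(k has_vector_derivative f x) (at x)" if "x \<in> {r<..<s} - S" for x
        using d[of x] that rs by (simp add: f_def has_real_derivative_iff_has_vector_derivative)
      show "continuous_on {r..s} k" using continuous_on_subset[OF cont] rs by auto
    qed
    then have "norm (k s - k r) \<le> M * measure lebesgue {r..s}"
      using has_integral_bound[of M f "k s - k r" r s] M rs M0 by (auto simp: f_def)
    then show ?thesis using rs by simp
  qed
  have le': "\<bar>k s - k r\<bar> \<le> M * \<bar>s - r\<bar>" if "r \<in> {a..b}" "s \<in> {a..b}" for r s
    using le[of r s] le[of s r] that by (cases "r \<le> s") (auto simp: abs_minus_commute)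
  show ?thesis
  proof (rule lipschitz_onI[OF _ M0])
    fix r s :: real
    let ?r = "max a (min b r)" and ?s = "max a (min b s)"
    have "\<bar>k ?r - k ?s\<bar> \<le> M * \<bar>?r - ?s\<bar>" using ab by (intro le') auto
    also have "\<dots> \<le> M * \<bar>r - s\<bar>" by (intro mult_left_mono M0) (auto simp: max_def min_def)
    finally show "dist (k ?r) (k ?s) \<le> M * dist r s" by (simp add: dist_real_def)
  qed
qed

lemma compact_in_annulus:
  assumes "compact K" "K \<subseteq> annulus n" "n \<ge> 2"
  obtains a b where "1 / real n < a" "a < b" "b < 1" "\<And>x. x \<in> K \<Longrightarrow> a < norm x \<and> norm x < b"
proof -
  have n: "1 / real n < 1" using assms(3) by simp
  obtain c d where cd: "1 / real n < c" "c \<le> d" "d < 1" "\<And>x. x \<in> K \<Longrightarrow> c \<le> norm x \<and> norm x \<le> d"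
  proof (cases "K = {}")
    case True
    then show ?thesis using that[of "(1 / real n + 1) / 2" "(1 / real n + 1) / 2"] n by simp
  next
    case False
    obtain x where x: "x \<in> K" "\<And>y. y \<in> K \<Longrightarrow> norm x \<le> norm y"
      using continuous_attains_inf[OF assms(1) False continuous_on_norm_id] by blast
    obtain z where z: "z \<in> K" "\<And>y. y \<in> K \<Longrightarrow> norm y \<le> norm z"
      using continuous_attains_sup[OF assms(1) False continuous_on_norm_id] by blast
    show ?thesis
      by (rule that[of "norm x" "norm z"]) (use x z assms(2) in \<open>auto simp: annulus_def\<close>)
  qed
  show ?thesis
  proof (rule that[of "(1 / real n + c) / 2" "(d + 1) / 2"])
    fix x assume "x \<in> K"
    then show "(1 / real n + c) / 2 < norm x \<and> norm x < (d + 1) / 2" using cd(4)[of x] cd(1,3) by auto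
  qed (use cd in auto)
qed

lemma has_derivative_classical_grad:
  "\<phi> differentiable (at x) \<Longrightarrow> (\<phi> has_derivative (\<lambda>h. classical_grad \<phi> x \<bullet> h)) (at x)"
  using differentiable_has_derivative_partial[of \<phi> x] by (simp add: inner_vec_def classical_grad_def)

text \<open>The inequality is \<open>0 \<le> |\<nabla>\<phi> + \<phi> g(ln |x|) x/|x|\<^sup>2|\<^sup>2\<close>, integrated: the mixed term is, up to a divergence,
  \<open>- g' \<phi>\<^sup>2/|x|\<^sup>2\<close>, because \<open>x/|x|\<^sup>2\<close> is divergence free in the plane. The divergence is that of the
  field \<open>F(x) x\<close> with \<open>F = \<phi>\<^sup>2 g(ln |x|)/|x|\<^sup>2\<close>. Since \<open>\<phi>\<close> is supported in a smaller annulus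
  \<open>a < |x| < b\<close>, the factor \<open>k(r) = g(ln r)/r\<^sup>2\<close> may be clamped outside \<open>[a, b]\<close>, which makes \<open>F\<close> Lipschitz.
  Finitely many kinks of \<open>g\<close> are admitted; they produce the null set \<open>Z\<close> of circles.\<close>

lemma radial_hardy:
  fixes g g' :: "real \<Rightarrow> real" and c :: "real^2 \<Rightarrow> real"
  assumes n: "n \<ge> 2" and E: "finite E" and gc: "continuous_on {..<0} g"
    and gd: "\<And>t. t < 0 \<Longrightarrow> t \<notin> E \<Longrightarrow> (g has_real_derivative g' t) (at t)"
    and B: "\<And>t. t < 0 \<Longrightarrow> t \<notin> E \<Longrightarrow> \<bar>g' t\<bar> \<le> B" and G: "\<And>t. t < 0 \<Longrightarrow> \<bar>g t\<bar> \<le> G"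
    and le: "\<And>x. x \<in> annulus n \<Longrightarrow> ln (norm x) \<notin> E \<Longrightarrow>
       (g (ln (norm x)))\<^sup>2 - g' (ln (norm x)) \<le> c x * (norm x)\<^sup>2"
    and \<phi>: "\<phi> \<in> test_functions (annulus n)"
  shows "0 \<le> (\<integral>x. (norm (classical_grad \<phi> x))\<^sup>2 + c x * (\<phi> x)\<^sup>2 \<partial>lebesgue_on (annulus n))"
proof -
  define K where "K = closure {x. \<phi> x \<noteq> 0}"
  have K: "compact K" "K \<subseteq> annulus n" using \<phi> by (auto simp: test_functions_def K_def)
  have \<phi>0: "\<phi> x = 0" if "x \<notin> K" for x using that unfolding K_def by (rule not_in_closure_support)
  obtain a b where ab: "1 / real n < a" "a < b" "b < 1" "\<And>x. x \<in> K \<Longrightarrow> a < norm x \<and> norm x < b"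
    using compact_in_annulus[OF K n] by blast
  have a0: "0 < a" using ab(1) by (smt (verit) divide_nonneg_nonneg of_nat_0_le_iff)
  have G0: "0 \<le> G" using G[of "-1"] by simp
  define k where "k r = g (ln r) / r\<^sup>2" for r
  define k' where "k' r = g' (ln r) / r ^ 3 - 2 * g (ln r) / r ^ 3" for r
  define M where "M = (\<bar>B\<bar> + 2 * G) / a ^ 3"
  have M0: "0 \<le> M" using a0 G0 by (simp add: M_def)
  have kd: "(k has_real_derivative k' r) (at r)" if "a \<le> r" "r \<le> b" "r \<notin> exp ` E" for r
  proof -
    have r: "0 < r" "ln r < 0" using that a0 ab by auto
    have "ln r \<notin> E" using that(3) r by (metis exp_ln imageI)
    from gd[OF r(2) this] have "((\<lambda>r. g (ln r)) has_real_derivative g' (ln r) * (1 / r)) (at r)"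
      by (rule DERIV_chain2) (use r in \<open>auto intro!: derivative_eq_intros\<close>)
    then show ?thesis unfolding k_def[abs_def] k'_def using r
      by (auto intro!: derivative_eq_intros simp: power2_eq_square power3_eq_cube field_simps)
  qed
  have lk: "M-lipschitz_on UNIV (\<lambda>r. k (max a (min b r)))"
  proof (rule lipschitz_clamp)
    show "finite (exp ` E)" using E by simp
    show "continuous_on {a..b} k" unfolding k_def using a0 ab
      by (intro continuous_intros continuous_on_compose2[OF gc]) auto
    show "(k has_real_derivative k' r) (at r)" if "a < r" "r < b" "r \<notin> exp ` E" for r
      using kd that by simp
    show "\<bar>k' r\<bar> \<le> M" if r: "a < r" "r < b" "r \<notin> exp ` E" for r
    proof -
      have l: "ln r < 0" "ln r \<notin> E" using r a0 ab by (auto, metis exp_ln imageI order_less_trans)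
      have "\<bar>k' r\<bar> = \<bar>g' (ln r) - 2 * g (ln r)\<bar> / r ^ 3"
        using r a0 by (simp add: k'_def diff_divide_distrib[symmetric])
      also have "\<dots> \<le> (\<bar>B\<bar> + 2 * G) / a ^ 3"
        using B[OF l] G[OF l(1)] r a0 by (intro frac_le power_mono) auto
      finally show ?thesis by (simp add: M_def)
    qed
  qed (use ab M0 in auto)
  have kb: "\<bar>k (max a (min b r))\<bar> \<le> G / a\<^sup>2" for r
  proof -
    have "ln (max a (min b r)) < 0" using a0 ab by (subst ln_less_zero_iff) auto
    then show ?thesis unfolding k_def using G a0 ab by (auto intro!: frac_le power_mono simp: G0)
  qed
  define F where "F x = (\<phi> x * \<phi> x) * k (max a (min b (norm x)))" for x
  have t2: "(\<lambda>x. \<phi> x * \<phi> x) \<in> test_functions (annulus n)" by (intro test_functions_mult \<phi> test_functions_Ck[OF \<phi>])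
  obtain R where R: "\<And>x. norm x > R \<Longrightarrow> \<phi> x * \<phi> x = 0" using test_functions_bounded[OF t2] by blast
  obtain L where L: "L-lipschitz_on UNIV (\<lambda>x. \<phi> x * \<phi> x)"
    using C1_compact_support_lipschitz[OF test_functions_Ck[OF t2] R] by blast
  obtain C where C: "\<And>x. \<bar>\<phi> x * \<phi> x\<bar> \<le> C" using test_function_measurable(2)[OF t2] by blast
  have L0: "0 \<le> L" using lipschitz_on_nonneg[OF L] .
  have C0: "0 \<le> C" using C[of 0] by linarith
  have FL: "(L * (G / a\<^sup>2) + C * M)-lipschitz_on UNIV F"
  proof (rule lipschitz_onI)
    fix x y :: "real^2"
    let ?k = "\<lambda>x::real^2. k (max a (min b (norm x)))" and ?f = "\<lambda>x. \<phi> x * \<phi> x"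
    have 1: "\<bar>?f x - ?f y\<bar> \<le> L * norm (x - y)" using lipschitz_onD[OF L, of x y] by (simp add: dist_norm)
    have "\<bar>?k x - ?k y\<bar> \<le> M * \<bar>norm x - norm y\<bar>" using lipschitz_onD[OF lk, of "norm x" "norm y"] by (simp add: dist_real_def)
    also have "\<dots> \<le> M * norm (x - y)" by (intro mult_left_mono M0 norm_triangle_ineq3)
    finally have 2: "\<bar>?k x - ?k y\<bar> \<le> M * norm (x - y)" .
    have "F x - F y = (?f x - ?f y) * ?k x + ?f y * (?k x - ?k y)" by (simp add: F_def algebra_simps)
    then have "\<bar>F x - F y\<bar> \<le> \<bar>?f x - ?f y\<bar> * \<bar>?k x\<bar> + \<bar>?f y\<bar> * \<bar>?k x - ?k y\<bar>"
      by (metis abs_mult abs_triangle_ineq)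
    also have "\<dots> \<le> (L * norm (x - y)) * (G / a\<^sup>2) + C * (M * norm (x - y))"
      by (intro add_mono mult_mono 1 2 kb C C0) (use L0 in auto)
    finally show "dist (F x) (F y) \<le> (L * (G / a\<^sup>2) + C * M) * dist x y"
      by (simp add: dist_norm algebra_simps)
  qed (use L0 C0 M0 G0 in auto)
  define Z where "Z = (\<Union>t\<in>E. sphere (0::real^2) (exp t))"
  have Z: "Z \<in> null_sets lborel" unfolding Z_def
  proof (intro null_sets_UN' countable_finite[OF E])
    show "sphere (0::real^2) (exp t) \<in> null_sets lborel" for t
      using negligible_sphere[of "0::real^2" "exp t"] by (simp add: negligible_iff_null_sets null_sets_completion_iff)
  qed
  define D where "D x h = (if x \<in> K then 2 * \<phi> x * (classical_grad \<phi> x \<bullet> h) * k (norm x) + \<phi> x * \<phi> x * (k' (norm x) * ((x \<bullet> h) / norm x)) else 0)" for x h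
  have FD: "(F has_derivative D x) (at x)" if x: "x \<notin> Z" for x
  proof (cases "x \<in> K")
    case True
    have nx: "a < norm x" "norm x < b" "x \<noteq> 0" using ab(4)[OF True] a0 by auto
    have "norm x \<notin> exp ` E" using x by (auto simp: Z_def dist_norm)
    then have kr: "(k has_real_derivative k' (norm x)) (at (norm x))" using kd nx by simp
    have kd': "((\<lambda>x. k (norm x)) has_derivative (\<lambda>h. k' (norm x) * ((x \<bullet> h) / norm x))) (at x)"
      using has_derivative_compose[OF has_derivative_norm[OF nx(3)] kr[unfolded has_field_derivative_def]]
      by (simp add: sgn_div_norm inner_commute divide_inverse mult.commute)
    have \<phi>d: "(\<phi> has_derivative (\<lambda>h. classical_grad \<phi> x \<bullet> h)) (at x)"
      using has_derivative_classical_grad test_functions_Ck[OF \<phi>, of 1] by simp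
    have "((\<lambda>x. (\<phi> x * \<phi> x) * k (norm x)) has_derivative D x) (at x)"
      by (rule has_derivative_eq_rhs[OF has_derivative_mult[OF has_derivative_mult[OF \<phi>d \<phi>d] kd']])
        (use True in \<open>auto simp: D_def fun_eq_iff algebra_simps\<close>)
    moreover have "open {x::real^2. a < norm x \<and> norm x < b}"
      by (intro open_Collect_conj open_Collect_less continuous_intros)
    ultimately show ?thesis
      by (rule has_derivative_transform_within_open) (use nx in \<open>auto simp: F_def\<close>)
  next
    case False
    have "(\<lambda>h. 0) = D x" using False by (auto simp: D_def)
    moreover have "((\<lambda>x::real^2. 0::real) has_derivative (\<lambda>h. 0)) (at x)" by (rule has_derivative_const)
    ultimately have "((\<lambda>x. 0) has_derivative D x) (at x)" by simp
    moreover have "open (- K)" using K by (simp add: compact_imp_closed open_Compl)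
    ultimately show ?thesis
      by (rule has_derivative_transform_within_open) (use False \<phi>0 in \<open>auto simp: F_def\<close>)
  qed
  obtain h where h: "has_bochner_integral lborel h 0" "\<And>x. x \<notin> Z \<Longrightarrow> h x = 2 * 1 * F x + D x (1 *\<^sub>R x + 0)"
    by (rule integral_divergence_affine[OF FL, of R Z D 1 0]) (use R Z FD in \<open>auto simp: F_def\<close>)
  define H where "H x = indicator (annulus n) x *\<^sub>R ((norm (classical_grad \<phi> x))\<^sup>2 + c x * (\<phi> x)\<^sup>2)" for x
  have pw: "- h x \<le> H x" if x: "x \<notin> Z" for x
  proof (cases "x \<in> K")
    case True
    have nx: "a < norm x" "norm x < b" "x \<noteq> 0" using ab(4)[OF True] a0 by auto
    have xA: "x \<in> annulus n" using K True by auto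
    define r where "r = norm x"
    define G' where "G' = g (ln r)"
    have r: "r > 0" using nx by (simp add: r_def)
    have "ln r \<notin> E" using x r by (auto simp: Z_def r_def dist_norm)
    from le[OF xA this[unfolded r_def]] have le': "G'\<^sup>2 - g' (ln r) \<le> c x * r\<^sup>2" by (simp add: r_def G'_def)
    have xx: "x \<bullet> x = r\<^sup>2" by (simp add: r_def power2_norm_eq_inner)
    have "h x = 2 * (\<phi> x)\<^sup>2 * (G' / r\<^sup>2) + 2 * \<phi> x * (classical_grad \<phi> x \<bullet> x) * (G' / r\<^sup>2)
       + (\<phi> x)\<^sup>2 * ((g' (ln r) / r ^ 3 - 2 * G' / r ^ 3) * (r\<^sup>2 / r))"
      using h(2)[OF x] True nx by (simp add: D_def F_def k_def k'_def xx G'_def power2_eq_square flip: r_def)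
    also have "\<dots> = 2 * \<phi> x * (classical_grad \<phi> x \<bullet> x) * (G' / r\<^sup>2) + (\<phi> x)\<^sup>2 * (g' (ln r) / r\<^sup>2)"
      using r by (simp add: field_simps power2_eq_square power3_eq_cube)
    finally have hx: "h x = 2 * \<phi> x * (classical_grad \<phi> x \<bullet> x) * (G' / r\<^sup>2) + (\<phi> x)\<^sup>2 * (g' (ln r) / r\<^sup>2)" .
    have "0 \<le> (norm (classical_grad \<phi> x + (\<phi> x * G' / r\<^sup>2) *\<^sub>R x))\<^sup>2" by simp
    also have "\<dots> = (norm (classical_grad \<phi> x))\<^sup>2 + 2 * (\<phi> x * G' / r\<^sup>2) * (classical_grad \<phi> x \<bullet> x) + (\<phi> x * G' / r\<^sup>2)\<^sup>2 * r\<^sup>2"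
      unfolding power2_norm_eq_inner by (simp add: inner_add_left inner_add_right inner_commute xx power2_eq_square algebra_simps)
    also have "(\<phi> x * G' / r\<^sup>2)\<^sup>2 * r\<^sup>2 = (\<phi> x)\<^sup>2 * (G'\<^sup>2 / r\<^sup>2)"
      using r by (simp add: field_simps power2_eq_square)
    also have "G'\<^sup>2 / r\<^sup>2 \<le> c x + g' (ln r) / r\<^sup>2" using le' r by (simp add: field_simps)
    finally have "0 \<le> (norm (classical_grad \<phi> x))\<^sup>2 + 2 * (\<phi> x * G' / r\<^sup>2) * (classical_grad \<phi> x \<bullet> x) + (\<phi> x)\<^sup>2 * (c x + g' (ln r) / r\<^sup>2)"
      by (simp add: mult_left_mono)
    then show ?thesis using xA unfolding hx H_def by (simp add: algebra_simps)
  next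
    case False
    have "partial i \<phi> x = 0" for i
      using partial_cong_open[of "- K" x \<phi> "\<lambda>x. 0" i] False \<phi>0 K
        partial_has_derivative[OF has_derivative_const, of i 0] by (auto simp: compact_imp_closed open_Compl)
    then have "H x = 0" using \<phi>0[OF False] by (simp add: H_def classical_grad_def zero_vec_def[symmetric])
    moreover have "h x = 0" using h(2)[OF x] False \<phi>0 by (simp add: D_def F_def)
    ultimately show ?thesis by simp
  qed
  have "(\<integral>x. (norm (classical_grad \<phi> x))\<^sup>2 + c x * (\<phi> x)\<^sup>2 \<partial>lebesgue_on (annulus n)) = (\<integral>x. H x \<partial>lebesgue)"
    unfolding H_def using annulus_basic(4) by (subst integral_restrict_space) auto
  also have "0 \<le> \<dots>"
  proof (cases "integrable lebesgue H")
    case True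
    have hl: "integrable lebesgue h" "(\<integral>x. h x \<partial>lebesgue) = 0"
      using h(1) by (auto simp: has_bochner_integral_iff integrable_completion integral_completion)
    have "AE x in lebesgue. x \<notin> Z" by (rule AE_completion[OF AE_not_in[OF Z]])
    then have "AE x in lebesgue. - h x \<le> H x" by eventually_elim (rule pw)
    then have "(\<integral>x. - h x \<partial>lebesgue) \<le> (\<integral>x. H x \<partial>lebesgue)" using hl True by (intro integral_mono_AE) auto
    then show ?thesis using hl by simp
  qed (simp add: not_integrable_integral_eq)
  finally show ?thesis .
qed

section \<open>The phase plane of a radial solution\<close>

lemma nondecreasing_from_bot:
  fixes f :: "real \<Rightarrow> real"
  assumes "\<And>s. s \<le> t \<Longrightarrow> \<exists>D. (f has_real_derivative D) (at s) \<and> D \<ge> 0" and "(f \<longlongrightarrow> L) at_bot"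
  shows "L \<le> f t"
proof (rule tendsto_upperbound[OF assms(2)])
  show "\<forall>\<^sub>F s in at_bot. f s \<le> f t"
    using eventually_le_at_bot[of t]
    by eventually_elim (rule DERIV_nonneg_imp_nondecreasing, use assms(1) in auto)
qed simp

lemma nonincreasing_from_bot:
  fixes f :: "real \<Rightarrow> real"
  assumes "\<And>s. s \<le> t \<Longrightarrow> \<exists>D. (f has_real_derivative D) (at s) \<and> D \<le> 0" and "(f \<longlongrightarrow> L) at_bot"
  shows "f t \<le> L"
proof (rule tendsto_lowerbound[OF assms(2)])
  show "\<forall>\<^sub>F s in at_bot. f t \<le> f s"
    using eventually_le_at_bot[of t]
    by eventually_elim (rule DERIV_nonpos_imp_nonincreasing, use assms(1) in auto)
qed simp

text \<open>A radial solution with one nodal circle in logarithmic polar coordinates: \<open>U(t)\<close> is its value at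
  radius \<open>e\<^sup>t\<close>, \<open>V = U'\<close>, \<open>\<tau>\<close> and \<open>\<sigma>\<close> are the logarithms of the nodal radius and of the minimum radius,
  and \<open>u0\<close> is the value at the origin.\<close>

locale nodal_profile =
  fixes p \<tau> \<sigma> u0 :: real and U V :: "real \<Rightarrow> real"
  assumes p: "p \<ge> 2" and \<tau>\<sigma>: "\<tau> < \<sigma>" and \<sigma>0: "\<sigma> < 0"
    and dU: "\<And>t. t < 0 \<Longrightarrow> (U has_real_derivative V t) (at t)"
    and dV: "\<And>t. t < 0 \<Longrightarrow> (V has_real_derivative - (exp (2 * t) * (\<bar>U t\<bar> powr (p - 1) * U t))) (at t)"
    and Upos: "\<And>t. t < \<tau> \<Longrightarrow> U t > 0" and U\<tau>: "U \<tau> = 0"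
    and Uneg: "\<And>t. \<tau> < t \<Longrightarrow> t < 0 \<Longrightarrow> U t < 0"
    and V\<sigma>: "V \<sigma> = 0"
    and Ubot: "(U \<longlongrightarrow> u0) at_bot" and Vbot: "(V \<longlongrightarrow> 0) at_bot" and u0: "u0 > 0"
begin

text \<open>The coordinates of the phase plane: \<open>W\<close> is the potential of the linearized operator and \<open>y\<close> its
  logarithmic derivative. In the limit \<open>p \<rightarrow> \<infinity>\<close>, where \<open>a = 1\<close>, the quantity \<open>F\<close> is conserved.\<close>

definition W where "W t = p * \<bar>U t\<bar> powr (p - 1) * exp (2 * t)"
definition y where "y t = 2 + (p - 1) * V t / U t"
definition a where "a = 1 - 1 / p"
definition F where "F t = a * W t + (y t)\<^sup>2 / 2"

lemma a_bounds: "1 / 2 \<le> a" "a \<le> 1" "a > 0" "a * p = p - 1"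
  using p by (auto simp: a_def field_simps)

lemma \<tau>0: "\<tau> < 0" using \<tau>\<sigma> \<sigma>0 by simp

lemma U_nz: "t < 0 \<Longrightarrow> t \<noteq> \<tau> \<Longrightarrow> U t \<noteq> 0"
  using Upos[of t] Uneg[of t] by (cases "t < \<tau>") auto

lemma W_pos: "t < 0 \<Longrightarrow> t \<noteq> \<tau> \<Longrightarrow> 0 < W t"
  using U_nz[of t] p by (simp add: W_def)

lemma W_nonneg: "0 \<le> W t" using p by (simp add: W_def)

lemma dW:
  assumes t: "t < 0" "t \<noteq> \<tau>"
  shows "(W has_real_derivative y t * W t) (at t)"
proof -
  have nz: "U t \<noteq> 0" using U_nz t by simp
  have lnd: "((\<lambda>s. ln \<bar>U s\<bar>) has_real_derivative V t / U t) (at t)"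
  proof (cases "U t > 0")
    case True
    have "((\<lambda>s. ln (U s)) has_real_derivative V t / U t) (at t)"
      using True by (auto intro!: derivative_eq_intros dU t simp: field_simps)
    moreover have "\<forall>\<^sub>F s in nhds t. \<bar>U s\<bar> = U s"
    proof -
      have "isCont U t" using dU[OF t(1)] by (rule DERIV_isCont)
      then have "\<forall>\<^sub>F s in nhds t. U s > 0"
        using order_tendstoD(1)[of U "U t" "at t" 0] True by (simp add: eventually_nhds_conv_at isCont_def)
      then show ?thesis by eventually_elim simp
    qed
    ultimately show ?thesis by (subst DERIV_cong_ev[OF refl _ refl]) (auto elim: eventually_mono)
  next
    case False
    then have neg: "U t < 0" using nz by simp
    have "((\<lambda>s. ln (- U s)) has_real_derivative V t / U t) (at t)"
      using neg by (auto intro!: derivative_eq_intros dU t simp: field_simps)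
    moreover have "\<forall>\<^sub>F s in nhds t. \<bar>U s\<bar> = - U s"
    proof -
      have "isCont U t" using dU[OF t(1)] by (rule DERIV_isCont)
      then have "\<forall>\<^sub>F s in nhds t. U s < 0"
        using order_tendstoD(2)[of U "U t" "at t" 0] neg by (simp add: eventually_nhds_conv_at isCont_def)
      then show ?thesis by eventually_elim simp
    qed
    ultimately show ?thesis by (subst DERIV_cong_ev[OF refl _ refl]) (auto elim: eventually_mono)
  qed
  have "((\<lambda>s. p * exp ((p - 1) * ln \<bar>U s\<bar> + 2 * s)) has_real_derivative y t * (p * exp ((p - 1) * ln \<bar>U t\<bar> + 2 * t))) (at t)"
    by (rule DERIV_cong[OF DERIV_cmult[OF DERIV_chain2[OF DERIV_exp
          DERIV_add[OF DERIV_cmult[OF lnd] DERIV_cmult[OF DERIV_ident]]]]]) (simp add: y_def)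
  moreover have "p * exp ((p - 1) * ln \<bar>U s\<bar> + 2 * s) = W s" if "U s \<noteq> 0" for s
    using that by (simp add: W_def powr_def exp_add)
  moreover have "\<forall>\<^sub>F s in nhds t. s \<in> {..<0} - {\<tau>}"
    using t by (intro eventually_nhds_in_open) (auto intro: open_delete)
  then have "\<forall>\<^sub>F s in nhds t. U s \<noteq> 0" by eventually_elim (use U_nz in auto)
  ultimately show ?thesis using nz
    by (subst DERIV_cong_ev[OF refl _ refl]) (auto elim: eventually_mono)
qed

lemma dy:
  assumes t: "t < 0" "t \<noteq> \<tau>"
  shows "(y has_real_derivative - (a * W t + (y t - 2)\<^sup>2 / (p - 1))) (at t)"
proof -
  have nz: "U t \<noteq> 0" using U_nz t by simp
  have "(y has_real_derivative (p - 1) * ((- (exp (2 * t) * (\<bar>U t\<bar> powr (p - 1) * U t))) * U t - V t * V t) / (U t * U t)) (at t)"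
    unfolding y_def[abs_def] using nz
    by (auto intro!: derivative_eq_intros dU dV t simp: field_simps)
  also have "(p - 1) * ((- (exp (2 * t) * (\<bar>U t\<bar> powr (p - 1) * U t))) * U t - V t * V t) / (U t * U t)
     = - ((a * p) * (\<bar>U t\<bar> powr (p - 1) * exp (2 * t)) + (p - 1) * (V t / U t)\<^sup>2)"
    unfolding a_bounds(4) using nz by (simp add: field_simps power2_eq_square)
  also have "(p - 1) * (V t / U t)\<^sup>2 = (y t - 2)\<^sup>2 / (p - 1)"
  proof -
    have "y t - 2 = (p - 1) * (V t / U t)" by (simp add: y_def)
    then show ?thesis using p by (simp add: power2_eq_square)
  qed
  finally show ?thesis by (simp add: W_def mult.assoc)
qed

text \<open>The leading terms \<open>a y W\<close> cancel; only the perturbation of order \<open>1 / (p - 1)\<close> is left.\<close>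

lemma dF:
  assumes t: "t < 0" "t \<noteq> \<tau>"
  shows "(F has_real_derivative - (y t * (y t - 2)\<^sup>2 / (p - 1))) (at t)"
proof -
  define q where "q = (y t - 2)\<^sup>2 / (p - 1)"
  have "((\<lambda>t. a * W t + (y t)\<^sup>2 / 2) has_real_derivative
      a * (y t * W t) + (real 2 * (- (a * W t + q) * y t ^ (2 - Suc 0))) / 2) (at t)"
    unfolding q_def by (intro DERIV_add DERIV_cmult DERIV_cdivide DERIV_power dW dy t)
  moreover have "a * (y t * W t) + (real 2 * (- (a * W t + q) * y t ^ (2 - Suc 0))) / 2 = - (y t * q)"
    by (simp add: field_simps)
  ultimately show ?thesis by (simp add: F_def[abs_def] q_def)
qed

lemma y_deriv_neg:
  assumes "t < 0" "t \<noteq> \<tau>" shows "- (a * W t + (y t - 2)\<^sup>2 / (p - 1)) < 0"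
proof -
  have "0 < a * W t" using a_bounds(3) W_pos[OF assms] by (rule mult_pos_pos)
  moreover have "0 \<le> (y t - 2)\<^sup>2 / (p - 1)" using p by simp
  ultimately show ?thesis by linarith
qed

lemma y_decreasing:
  assumes "s < t" "t < 0" "\<tau> < s \<or> t < \<tau>"
  shows "y t < y s"
proof (rule DERIV_neg_imp_decreasing[OF assms(1)])
  fix x assume "s \<le> x" "x \<le> t"
  then have "x < 0" "x \<noteq> \<tau>" using assms by auto
  then show "\<exists>z. (y has_real_derivative z) (at x) \<and> z < 0" using dy y_deriv_neg by blast
qed

lemma continuous_y: "S \<subseteq> {..<0} - {\<tau>} \<Longrightarrow> continuous_on S y"
  by (intro continuous_at_imp_continuous_on ballI DERIV_isCont) (auto intro!: dy)

text \<open>Where \<open>U > 0\<close> the function \<open>V\<close> decreases, and it starts at \<open>0\<close>.\<close>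

lemma V_neg_left:
  assumes t: "t \<le> \<tau>" shows "V t < 0"
proof -
  have "V (t - 1) \<le> 0"
  proof (rule nonincreasing_from_bot[OF _ Vbot])
    fix s assume "s \<le> t - 1"
    then have "s < 0" "U s > 0" using t \<tau>0 Upos[of s] by auto
    then show "\<exists>D. (V has_real_derivative D) (at s) \<and> D \<le> 0" using dV[of s] by fastforce
  qed
  moreover have "V t < V (t - 1)"
  proof (rule DERIV_neg_imp_decreasing_open[where f = V and a = "t - 1" and b = t])
    show "continuous_on {t - 1..t} V"
      using t \<tau>0 by (intro continuous_at_imp_continuous_on ballI DERIV_isCont[OF dV]) auto
    fix s assume "t - 1 < s" "s < t"
    then have "s < 0" "U s > 0" using t \<tau>0 Upos[of s] by auto
    then have "- (exp (2 * s) * (\<bar>U s\<bar> powr (p - 1) * U s)) < 0" by simp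
    then show "\<exists>D. (V has_real_derivative D) (at s) \<and> D < 0" using dV[OF \<open>s < 0\<close>] by blast
  qed simp
  ultimately show ?thesis by simp
qed

lemma y_\<sigma>: "y \<sigma> = 2" by (simp add: y_def V\<sigma>)

lemma y_gt_2: "\<tau> < t \<Longrightarrow> t < \<sigma> \<Longrightarrow> 2 < y t" using y_decreasing[of t \<sigma>] y_\<sigma> \<sigma>0 by simp

lemma V_neg:
  assumes "t < \<sigma>" shows "V t < 0"
proof (cases "t \<le> \<tau>")
  case False
  then have "0 < (p - 1) * V t / U t" "U t < 0" using assms y_gt_2[of t] Uneg[of t] \<sigma>0 by (auto simp: y_def)
  then have "(p - 1) * V t < 0" by (simp add: zero_less_divide_iff)
  then show ?thesis using p by (simp add: mult_less_0_iff)
qed (rule V_neg_left)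

text \<open>The quantity \<open>F\<close> starts at \<open>2\<close> and decreases as long as \<open>y \<ge> 0\<close>, which bounds \<open>a W\<close> by \<open>2\<close>;
  afterwards \<open>W\<close> itself decreases.\<close>

lemma W_positive_bubble:
  assumes t: "t \<le> \<tau>"
  shows "W t \<le> 4"
proof (cases "t = \<tau>")
  case True
  then show ?thesis using p by (simp add: W_def U\<tau>)
next
  case False
  then have t: "t < \<tau>" using assms by simp
  have exp0: "((\<lambda>t::real. exp (2 * t)) \<longlongrightarrow> 0) at_bot"
    by (rule filterlim_compose[OF exp_at_bot]) (intro filterlim_tendsto_pos_mult_at_bot[OF tendsto_const] filterlim_ident, simp)
  have "(W \<longlongrightarrow> p * \<bar>u0\<bar> powr (p - 1) * 0) at_bot"
    unfolding W_def[abs_def] using u0 by (intro tendsto_intros Ubot exp0) auto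
  moreover have yb: "(y \<longlongrightarrow> 2 + (p - 1) * 0 / u0) at_bot"
    unfolding y_def[abs_def] using u0 by (intro tendsto_intros Ubot Vbot) auto
  ultimately have Fb: "(F \<longlongrightarrow> a * (p * \<bar>u0\<bar> powr (p - 1) * 0) + (2 + (p - 1) * 0 / u0)\<^sup>2 / 2) at_bot"
    unfolding F_def[abs_def] by (intro tendsto_intros) auto
  have le: "a * W s \<le> 2" if s: "s < \<tau>" "0 \<le> y s" for s
  proof -
    have "F s \<le> a * (p * \<bar>u0\<bar> powr (p - 1) * 0) + (2 + (p - 1) * 0 / u0)\<^sup>2 / 2"
    proof (rule nonincreasing_from_bot[OF _ Fb])
      fix r assume "r \<le> s"
      then have r: "r < 0" "r \<noteq> \<tau>" "0 \<le> y r" using s \<tau>0 y_decreasing[of r s] by (cases "r = s"; auto)+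
      then show "\<exists>D. (F has_real_derivative D) (at r) \<and> D \<le> 0"
        using dF[OF r(1,2)] p by (intro exI[of _ "- (y r * (y r - 2)\<^sup>2 / (p - 1))"]) auto
    qed
    then show ?thesis by (simp add: F_def) (smt (verit) zero_le_power2 divide_nonneg_nonneg)
  qed
  have W4: "W s \<le> 4" if "a * W s \<le> 2" for s
    using that a_bounds(1) W_nonneg[of s] mult_right_mono[of "1/2" a "W s"] by linarith
  show ?thesis
  proof (cases "0 \<le> y t")
    case True
    then show ?thesis using le t W4 by blast
  next
    case False
    have "\<forall>\<^sub>F s in at_bot. y s > 0" using order_tendstoD(1)[OF yb, of 0] by simp
    then have "\<forall>\<^sub>F s in at_bot. y s > 0 \<and> s < t" using eventually_gt_at_bot[of t] eventually_conj by (simp add: eventually_conj_iff)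
    then obtain s where s: "y s > 0" "s < t" by (auto dest: eventually_happens)
    obtain r where r: "s \<le> r" "r \<le> t" "y r = 0"
    proof -
      have "continuous_on {s..t} y" by (rule continuous_y) (use t \<tau>0 in auto)
      then show ?thesis using IVT2'[of y t 0 s] s False that by auto
    qed
    have "W t \<le> W r"
    proof (rule DERIV_nonpos_imp_nonincreasing[OF r(2)])
      fix x assume x: "r \<le> x" "x \<le> t"
      then have "y x \<le> 0" using y_decreasing[of r x] r t \<tau>0 by (cases "r = x") auto
      moreover have "x < 0" "x \<noteq> \<tau>" using x t \<tau>0 by auto
      ultimately show "\<exists>z. (W has_real_derivative z) (at x) \<and> z \<le> 0"
        using dW[of x] W_nonneg[of x] by (intro exI[of _ "y x * W x"]) (auto simp: mult_nonpos_nonneg)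
    qed
    moreover have "W r \<le> 4" using W4 le r t by auto
    ultimately show ?thesis by simp
  qed
qed

text \<open>Since \<open>0 \<le> U \<le> u0\<close> inside the nodal circle, integrating \<open>U'' \<ge> - u0\<^sup>p e\<^sup>2\<^sup>t\<close> twice gives
  \<open>U(t) \<ge> u0 - u0\<^sup>p e\<^sup>2\<^sup>t / 4\<close>. As \<open>U\<close> vanishes at \<open>\<tau>\<close>, the nodal radius is large compared with the
  scale of the solution at the origin.\<close>

lemma initial_scale: "4 \<le> u0 powr (p - 1) * exp (2 * \<tau>)"
proof -
  have exp0: "((\<lambda>t::real. exp (2 * t)) \<longlongrightarrow> 0) at_bot"
    by (rule filterlim_compose[OF exp_at_bot]) (intro filterlim_tendsto_pos_mult_at_bot[OF tendsto_const] filterlim_ident, simp)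
  have Ule: "U t \<le> u0" if "t \<le> \<tau>" for t
  proof (rule nonincreasing_from_bot[OF _ Ubot])
    fix s assume "s \<le> t"
    then show "\<exists>D. (U has_real_derivative D) (at s) \<and> D \<le> 0"
      using dU[of s] V_neg_left[of s] that \<tau>0 by (intro exI[of _ "V s"]) auto
  qed
  have U0: "0 \<le> U t" if "t \<le> \<tau>" for t using Upos[of t] U\<tau> that by (cases "t = \<tau>") auto
  define c where "c = u0 powr (p - 1) * u0"
  have Vge: "- (c * exp (2 * t) / 2) \<le> V t" if t: "t \<le> \<tau>" for t
  proof -
    have "0 + c * 0 / 2 \<le> V t + c * exp (2 * t) / 2"
    proof (rule nondecreasing_from_bot[where f = "\<lambda>t. V t + c * exp (2 * t) / 2" and t = t])
      fix s assume "s \<le> t"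
      then have s: "s \<le> \<tau>" "s < 0" using t \<tau>0 by auto
      have "((\<lambda>t. V t + c * exp (2 * t) / 2) has_real_derivative
          - (exp (2 * s) * (\<bar>U s\<bar> powr (p - 1) * U s)) + c * exp (2 * s)) (at s)"
        by (auto intro!: derivative_eq_intros dV s)
      moreover have "\<bar>U s\<bar> powr (p - 1) * U s \<le> c" unfolding c_def
        using Ule[OF s(1)] U0[OF s(1)] p u0 by (intro mult_mono powr_mono2) auto
      then have "0 \<le> - (exp (2 * s) * (\<bar>U s\<bar> powr (p - 1) * U s)) + c * exp (2 * s)"
        by (simp add: mult.commute[of c])
      ultimately show "\<exists>D. ((\<lambda>t. V t + c * exp (2 * t) / 2) has_real_derivative D) (at s) \<and> 0 \<le> D" by blast
    qed (intro tendsto_intros Vbot exp0, simp)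
    then show ?thesis by simp
  qed
  have "u0 + c * 0 / 4 \<le> U \<tau> + c * exp (2 * \<tau>) / 4"
  proof (rule nondecreasing_from_bot[where f = "\<lambda>t. U t + c * exp (2 * t) / 4" and t = \<tau>])
    fix s assume s: "s \<le> \<tau>"
    then have "((\<lambda>t. U t + c * exp (2 * t) / 4) has_real_derivative V s + c * exp (2 * s) / 2) (at s)"
      using \<tau>0 by (auto intro!: derivative_eq_intros dU)
    then show "\<exists>D. ((\<lambda>t. U t + c * exp (2 * t) / 4) has_real_derivative D) (at s) \<and> 0 \<le> D"
      using Vge[OF s] by (intro exI[of _ "V s + c * exp (2 * s) / 2"]) auto
  qed (intro tendsto_intros Ubot exp0, simp)
  then have "u0 * 4 \<le> u0 * (u0 powr (p - 1) * exp (2 * \<tau>))" by (simp add: U\<tau> c_def algebra_simps)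
  then show ?thesis using u0 by simp
qed

text \<open>Logarithmic concavity: \<open>y = (ln W)'\<close> is decreasing.\<close>

lemma W_min:
  assumes "\<tau> < s" "s \<le> r" "r \<le> t" "t < 0"
  shows "min (W s) (W t) \<le> W r"
proof (cases "0 \<le> y r")
  case True
  have "W s \<le> W r"
  proof (rule DERIV_nonneg_imp_nondecreasing[OF assms(2)])
    fix x assume x: "s \<le> x" "x \<le> r"
    then have "0 \<le> y x" using y_decreasing[of x r] True assms by (cases "r = x") auto
    moreover have "x < 0" "x \<noteq> \<tau>" using x assms by auto
    ultimately show "\<exists>z. (W has_real_derivative z) (at x) \<and> 0 \<le> z"
      using dW[of x] W_nonneg[of x] by (intro exI[of _ "y x * W x"]) auto
  qed
  then show ?thesis by simp
next
  case False
  have "W t \<le> W r"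
  proof (rule DERIV_nonpos_imp_nonincreasing[OF assms(3)])
    fix x assume x: "r \<le> x" "x \<le> t"
    then have "y x \<le> 0" using y_decreasing[of r x] False assms by (cases "r = x") auto
    moreover have "x < 0" "x \<noteq> \<tau>" using x assms by auto
    ultimately show "\<exists>z. (W has_real_derivative z) (at x) \<and> z \<le> 0"
      using dW[of x] W_nonneg[of x] by (intro exI[of _ "y x * W x"]) (auto simp: mult_nonpos_nonneg)
  qed
  then show ?thesis by simp
qed

text \<open>Chosen such that \<open>C K d\<close> times \<open>|y'|\<close> dominates \<open>|F'|\<close> in the region \<open>|y| \<le> K\<close>, \<open>W \<ge> d\<close>; it is of order
  \<open>1/p\<close>.\<close>

definition C where "C K d = K * (K + 2)\<^sup>2 / ((p - 1) * a * d)"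

lemma C_nonneg: "K \<ge> 0 \<Longrightarrow> d > 0 \<Longrightarrow> 0 \<le> C K d"
  using p a_bounds(3) by (simp add: C_def)

lemma F_drift_derivs:
  assumes K: "2 \<le> K" and d: "0 < d" and t: "\<tau> < t" "t < 0" and yK: "\<bar>y t\<bar> \<le> K" and Wd: "d \<le> W t"
  shows "\<exists>D. ((\<lambda>t. F t + C K d * y t) has_real_derivative D) (at t) \<and> D \<le> 0"
    "\<exists>D. ((\<lambda>t. F t - C K d * y t) has_real_derivative D) (at t) \<and> 0 \<le> D"
proof -
  have t': "t < 0" "t \<noteq> \<tau>" using t by auto
  have "C K d * (a * d) \<le> C K d * (a * W t + (y t - 2)\<^sup>2 / (p - 1))"
    using C_nonneg[of K d] K d p Wd a_bounds(3)
    by (intro mult_left_mono add_increasing2) auto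
  moreover have "C K d * (a * d) = K * (K + 2)\<^sup>2 / (p - 1)"
    using p a_bounds(3) d by (simp add: C_def field_simps)
  ultimately have 1: "K * (K + 2)\<^sup>2 / (p - 1) \<le> C K d * (a * W t + (y t - 2)\<^sup>2 / (p - 1))" by simp
  have "\<bar>y t * (y t - 2)\<^sup>2\<bar> \<le> K * (K + 2)\<^sup>2"
  proof -
    have "\<bar>y t - 2\<bar> \<le> K + 2" using yK by simp
    then have "(y t - 2)\<^sup>2 \<le> (K + 2)\<^sup>2" by (metis abs_ge_zero power2_abs power_mono)
    then show ?thesis unfolding abs_mult using yK K by (intro mult_mono) auto
  qed
  then have "\<bar>y t * (y t - 2)\<^sup>2\<bar> / (p - 1) \<le> K * (K + 2)\<^sup>2 / (p - 1)"
    using p by (intro divide_right_mono) auto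
  then have 2: "\<bar>y t * (y t - 2)\<^sup>2 / (p - 1)\<bar> \<le> K * (K + 2)\<^sup>2 / (p - 1)" using p by simp
  have "((\<lambda>t. F t + C K d * y t) has_real_derivative
     - (y t * (y t - 2)\<^sup>2 / (p - 1)) + C K d * - (a * W t + (y t - 2)\<^sup>2 / (p - 1))) (at t)"
    by (auto intro!: derivative_eq_intros dF dy t')
  moreover have "- (y t * (y t - 2)\<^sup>2 / (p - 1)) + C K d * - (a * W t + (y t - 2)\<^sup>2 / (p - 1)) \<le> 0" using 1 2 by linarith
  ultimately show "\<exists>D. ((\<lambda>t. F t + C K d * y t) has_real_derivative D) (at t) \<and> D \<le> 0" by blast
  have "((\<lambda>t. F t - C K d * y t) has_real_derivative
     - (y t * (y t - 2)\<^sup>2 / (p - 1)) - C K d * - (a * W t + (y t - 2)\<^sup>2 / (p - 1))) (at t)"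
    by (auto intro!: derivative_eq_intros dF dy t')
  moreover have "0 \<le> - (y t * (y t - 2)\<^sup>2 / (p - 1)) - C K d * - (a * W t + (y t - 2)\<^sup>2 / (p - 1))" using 1 2 by linarith
  ultimately show "\<exists>D. ((\<lambda>t. F t - C K d * y t) has_real_derivative D) (at t) \<and> 0 \<le> D" by blast
qed

text \<open>By \<open>W_min\<close> the whole segment of the trajectory between \<open>t\<close> and \<open>\<sigma>\<close> stays in the region where
  \<open>F + C y\<close> decreases and \<open>F - C y\<close> increases, so \<open>F\<close> changes by at most \<open>C\<close> times the change of \<open>y\<close>. This works on
  time intervals of any length.\<close>

lemma F_almost_constant:
  assumes K: "2 \<le> K" and d: "0 < d" and t: "\<tau> < t" "t < 0" and yK: "\<bar>y t\<bar> \<le> K"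
    and Wd: "d \<le> W t" "d \<le> W \<sigma>"
  shows "\<bar>F t - F \<sigma>\<bar> \<le> C K d * (K + 2)"
proof -
  have "\<bar>F t - F \<sigma>\<bar> \<le> C K d * \<bar>y t - 2\<bar>"
  proof (cases "t \<le> \<sigma>")
    case True
    have *: "\<tau> < x \<and> x < 0 \<and> \<bar>y x\<bar> \<le> K \<and> d \<le> W x" if "t \<le> x" "x \<le> \<sigma>" for x
      using that t \<sigma>0 yK Wd W_min[of t x \<sigma>] y_decreasing[of t x] y_decreasing[of x \<sigma>] y_\<sigma>
      by (cases "t = x"; cases "x = \<sigma>") auto
    have "F \<sigma> + C K d * y \<sigma> \<le> F t + C K d * y t"
      by (rule DERIV_nonpos_imp_nonincreasing[OF True]) (use * F_drift_derivs(1)[OF K d] in blast)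
    moreover have "F t - C K d * y t \<le> F \<sigma> - C K d * y \<sigma>"
      by (rule DERIV_nonneg_imp_nondecreasing[OF True]) (use * F_drift_derivs(2)[OF K d] in blast)
    moreover have "2 \<le> y t" using y_decreasing[of t \<sigma>] True t \<sigma>0 y_\<sigma> by (cases "t = \<sigma>") auto
    ultimately show ?thesis by (simp add: y_\<sigma> algebra_simps abs_le_iff)
  next
    case False
    then have st: "\<sigma> \<le> t" by simp
    have *: "\<tau> < x \<and> x < 0 \<and> \<bar>y x\<bar> \<le> K \<and> d \<le> W x" if "\<sigma> \<le> x" "x \<le> t" for x
      using that t \<tau>\<sigma> yK K Wd W_min[of \<sigma> x t] y_decreasing[of \<sigma> x] y_decreasing[of x t] y_\<sigma>
      by (cases "t = x"; cases "x = \<sigma>") auto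
    have "F t + C K d * y t \<le> F \<sigma> + C K d * y \<sigma>"
      by (rule DERIV_nonpos_imp_nonincreasing[OF st]) (use * F_drift_derivs(1)[OF K d] in blast)
    moreover have "F \<sigma> - C K d * y \<sigma> \<le> F t - C K d * y t"
      by (rule DERIV_nonneg_imp_nondecreasing[OF st]) (use * F_drift_derivs(2)[OF K d] in blast)
    moreover have "y t \<le> 2" using y_decreasing[of \<sigma> t] False t \<tau>\<sigma> y_\<sigma> by auto
    ultimately show ?thesis by (simp add: y_\<sigma> algebra_simps abs_le_iff)
  qed
  also have "\<dots> \<le> C K d * (K + 2)" using yK C_nonneg[of K d] K d by (intro mult_left_mono) auto
  finally show ?thesis .
qed

text \<open>If \<open>W\<close> were not small, it would not be small at the time between \<open>t\<close> and \<open>\<sigma>\<close> at which \<open>|y| = K\<close>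
  either. There \<open>F\<close> would exceed \<open>K\<^sup>2 / 2\<close> noticeably, although it is almost constant and close to
  \<open>K\<^sup>2 / 2\<close> at \<open>\<sigma>\<close>.\<close>

lemma W_small_where_y_large:
  assumes K: "2 < K" and d: "0 < d" and t: "\<tau> < t" "t < 0" and yK: "K \<le> \<bar>y t\<bar>"
    and Wd: "d \<le> W \<sigma>" and deviation: "\<bar>F \<sigma> - K\<^sup>2 / 2\<bar> + C K d * (K + 2) < a * d"
  shows "W t < d"
proof (rule ccontr)
  assume "\<not> W t < d"
  then have Wt: "d \<le> W t" by simp
  have "\<exists>r. \<tau> < r \<and> r < 0 \<and> \<bar>y r\<bar> = K \<and> d \<le> W r"
  proof (cases "y t > 0")
    case True
    then have y: "K \<le> y t" using yK by simp
    have ts: "t < \<sigma>"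
      using y K y_decreasing[of \<sigma> t] \<tau>\<sigma> t y_\<sigma> by (cases "t = \<sigma>"; cases "t < \<sigma>") auto
    obtain r where r: "t \<le> r" "r \<le> \<sigma>" "y r = K"
    proof -
      have "continuous_on {t..\<sigma>} y" by (rule continuous_y) (use t \<sigma>0 in auto)
      then show ?thesis using IVT2'[of y \<sigma> K t] y y_\<sigma> K ts that by auto
    qed
    then show ?thesis using W_min[of t r \<sigma>] t \<sigma>0 Wt Wd K by (intro exI[of _ r]) auto
  next
    case False
    then have y: "y t \<le> - K" using yK by simp
    have ts: "\<sigma> < t"
      using y K y_decreasing[of t \<sigma>] \<sigma>0 t y_\<sigma> by (cases "t = \<sigma>"; cases "t < \<sigma>") auto
    obtain r where r: "\<sigma> \<le> r" "r \<le> t" "y r = - K"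
    proof -
      have "continuous_on {\<sigma>..t} y" by (rule continuous_y) (use t \<tau>\<sigma> in auto)
      then show ?thesis using IVT2'[of y t "- K" \<sigma>] y y_\<sigma> K ts that by auto
    qed
    then show ?thesis using W_min[of \<sigma> r t] t \<tau>\<sigma> Wt Wd K by (intro exI[of _ r]) auto
  qed
  then obtain r where r: "\<tau> < r" "r < 0" "\<bar>y r\<bar> = K" "d \<le> W r" by blast
  have "\<bar>F r - F \<sigma>\<bar> \<le> C K d * (K + 2)" using K d r Wd by (intro F_almost_constant) auto
  moreover have "F r \<ge> a * d + K\<^sup>2 / 2"
    using r(3,4) a_bounds(3) by (auto simp: F_def simp flip: r(3))
  ultimately show False using deviation by linarith
qed

end

section \<open>The vector field for the lower bound\<close>

context nodal_profile
begin

text \<open>Bounds the distance of \<open>F\<close> from its limiting value \<open>K\<^sup>2/2\<close> in the region \<open>|y| \<le> K\<close>, \<open>W \<ge> d\<close>.\<close>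

definition deviation where "deviation K d = \<bar>F \<sigma> - K\<^sup>2 / 2\<bar> + C K d * (K + 2)"

lemma deviation_nonneg: "0 \<le> K \<Longrightarrow> 0 < d \<Longrightarrow> 0 \<le> deviation K d"
  using C_nonneg[of K d] by (simp add: deviation_def)

lemma F_near:
  assumes "2 \<le> K" "0 < d" "\<tau> < t" "t < 0" "\<bar>y t\<bar> \<le> K" "d \<le> W t" "d \<le> W \<sigma>"
  shows "\<bar>F t - K\<^sup>2 / 2\<bar> \<le> deviation K d"
  using F_almost_constant[OF assms] by (simp add: deviation_def)

text \<open>The function \<open>g\<close> of \<open>radial_hardy\<close>. In the middle it is the negative logarithmic derivative
  \<open>- y / 2\<close> of \<open>W\<^sup>1\<^sup>/\<^sup>2\<close>. Near the nodal circle, where \<open>y\<close> tends to infinity, it has to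
  return from \<open>- K / 2\<close> to \<open>0\<close> slowly, with a slope of order \<open>1 / p\<close> and \<open>W\<close>; a multiple of
  \<open>1 / (y - 2) = U / ((p - 1) V)\<close> does this, because its derivative is \<open>1 / (p - 1) + a W / (y - 2)\<^sup>2\<close>.\<close>

definition field_fn where
  "field_fn K t = (if t \<le> \<tau> then 0 else if y t \<ge> K then - (K / 2) * (K - 2) / (y t - 2)
     else if y t \<ge> - K then - y t / 2 else K / 2)"

definition slope where
  "slope K t = (if t \<le> \<tau> then 0
     else if y t \<ge> K then - (K / 2) * (K - 2) * (a * W t / (y t - 2)\<^sup>2 + 1 / (p - 1))
     else if y t \<ge> - K then (a * W t + (y t - 2)\<^sup>2 / (p - 1)) / 2 else 0)"

definition kinks where "kinks K = insert \<tau> {t \<in> {\<tau><..<0}. y t = K \<or> y t = - K}"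

text \<open>The function \<open>y\<close> is injective where the solution is negative.\<close>

lemma finite_kinks: "finite (kinks K)"
proof -
  have *: "finite {t \<in> {\<tau><..<0}. y t = c}" for c
  proof -
    have "{t \<in> {\<tau><..<0}. y t = c} \<subseteq> {SOME t. t \<in> {\<tau><..<0} \<and> y t = c}"
    proof
      fix t assume t: "t \<in> {t \<in> {\<tau><..<0}. y t = c}"
      define t' where "t' = (SOME t. t \<in> {\<tau><..<0} \<and> y t = c)"
      have "t' \<in> {\<tau><..<0} \<and> y t' = c" unfolding t'_def by (rule someI[of _ t]) (use t in auto)
      then have "t = t'" using t y_decreasing[of t t'] y_decreasing[of t' t] by force
      then show "t \<in> {SOME t. t \<in> {\<tau><..<0} \<and> y t = c}" by (simp add: t'_def)
    qed
    then show ?thesis by (rule finite_subset) simp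
  qed
  have "{t \<in> {\<tau><..<0}. y t = K \<or> y t = - K} = {t \<in> {\<tau><..<0}. y t = K} \<union> {t \<in> {\<tau><..<0}. y t = - K}" by auto
  then show ?thesis using *[of K] *[of "- K"] by (simp add: kinks_def)
qed

lemma field_fn_bound:
  assumes K: "2 < K" shows "\<bar>field_fn K t\<bar> \<le> K / 2"
proof -
  have "(K / 2) * (K - 2) / (y t - 2) \<le> K / 2" if "y t \<ge> K"
    using that K by (simp add: divide_le_eq mult_left_mono)
  then show ?thesis using K by (auto simp: field_fn_def abs_le_iff)
qed

lemma nhds_y:
  assumes t: "\<tau> < t" "t < 0" and "open S" "y t \<in> S"
  shows "\<forall>\<^sub>F s in nhds t. \<tau> < s \<and> y s \<in> S"
proof -
  have "isCont y t" by (rule DERIV_isCont[OF dy]) (use t in auto)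
  then have "\<forall>\<^sub>F s in nhds t. y s \<in> S"
    using topological_tendstoD[of y "y t" "at t" S] assms by (simp add: eventually_nhds_conv_at isCont_def)
  moreover have "\<forall>\<^sub>F s in nhds t. s \<in> {\<tau><..}" using t by (intro eventually_nhds_in_open) auto
  ultimately show ?thesis by eventually_elim simp
qed

lemma field_fn_deriv:
  assumes K: "2 < K" and t: "t < 0" "t \<notin> kinks K"
  shows "(field_fn K has_real_derivative slope K t) (at t)"
proof -
  have tn: "t \<noteq> \<tau>" using t by (simp add: kinks_def)
  consider (l) "t < \<tau>" | (u) "\<tau> < t" "K < y t" | (m) "\<tau> < t" "- K < y t" "y t < K" | (d) "\<tau> < t" "y t < - K"
    using t tn by (fastforce simp: kinks_def)
  then show ?thesis
  proof cases
    case l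
    have "\<forall>\<^sub>F s in nhds t. s \<in> {..<\<tau>}" using l by (intro eventually_nhds_in_open) auto
    then have "\<forall>\<^sub>F s in nhds t. field_fn K s = 0" by eventually_elim (simp add: field_fn_def)
    then show ?thesis using l by (subst DERIV_cong_ev[OF refl _ refl]) (auto simp: slope_def)
  next
    case u
    have "\<forall>\<^sub>F s in nhds t. field_fn K s = - (K / 2) * (K - 2) / (y s - 2)"
      using nhds_y[of t "{K<..}"] u t by (auto simp: field_fn_def elim: eventually_mono)
    moreover have "((\<lambda>s. - (K / 2) * (K - 2) / (y s - 2)) has_real_derivative slope K t) (at t)"
    proof -
      define q where "q = y t - 2"
      have q: "q \<noteq> 0" using u K by (simp add: q_def)
      have "((\<lambda>s. - (K / 2) * (K - 2) / (y s - 2)) has_real_derivative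
         (0 * (y t - 2) - (- (K / 2) * (K - 2)) * (- (a * W t + (y t - 2)\<^sup>2 / (p - 1)) - 0)) / ((y t - 2) * (y t - 2))) (at t)"
        by (intro DERIV_divide DERIV_const DERIV_diff dy) (use u K t in auto)
      also have "(0 * (y t - 2) - (- (K / 2) * (K - 2)) * (- (a * W t + (y t - 2)\<^sup>2 / (p - 1)) - 0)) / ((y t - 2) * (y t - 2)) = slope K t"
        using u q p unfolding slope_def q_def[symmetric] by (simp add: field_simps power2_eq_square)
      finally show ?thesis .
    qed
    ultimately show ?thesis by (subst DERIV_cong_ev[OF refl _ refl])
  next
    case m
    have "\<forall>\<^sub>F s in nhds t. field_fn K s = - y s / 2"
      using nhds_y[of t "{-K<..<K}"] m t by (auto simp: field_fn_def elim: eventually_mono)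
    moreover have "((\<lambda>s. - y s / 2) has_real_derivative - (- (a * W t + (y t - 2)\<^sup>2 / (p - 1))) / 2) (at t)"
      by (intro DERIV_cdivide DERIV_minus dy) (use m t in auto)
    ultimately show ?thesis using m by (subst DERIV_cong_ev[OF refl _ refl]) (auto simp: slope_def add.commute)
  next
    case d
    have "\<forall>\<^sub>F s in nhds t. field_fn K s = K / 2"
      using nhds_y[of t "{..<-K}"] d t K by (auto simp: field_fn_def elim: eventually_mono)
    moreover have "((\<lambda>s. K / 2) has_real_derivative slope K t) (at t)" using d K by (auto simp: slope_def)
    ultimately show ?thesis by (subst DERIV_cong_ev[OF refl _ refl])
  qed
qed

text \<open>At the nodal circle \<open>|g|\<close> is at most a multiple of \<open>|U / V|\<close>, which tends to \<open>0\<close> because \<open>U\<close> has a simple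
  zero there.\<close>

lemma field_fn_continuous:
  assumes K: "2 < K"
  shows "continuous_on {..<0} (field_fn K)"
proof (intro continuous_at_imp_continuous_on ballI)
  fix t :: real assume "t \<in> {..<0}"
  then have t: "t < 0" by simp
  consider (l) "t < \<tau>" | (e) "t = \<tau>" | (r) "\<tau> < t" by linarith
  then show "isCont (field_fn K) t"
  proof cases
    case l
    then have "t \<notin> kinks K" by (auto simp: kinks_def)
    then show ?thesis using field_fn_deriv[OF K t] DERIV_isCont by blast
  next
    case e
    define s where "s x = (K / 2) * (K - 2) * \<bar>U x / ((p - 1) * V x)\<bar>" for x
    have "isCont U \<tau>" "isCont V \<tau>" using dU dV \<tau>0 DERIV_isCont by blast+
    moreover have V\<tau>: "V \<tau> < 0" using V_neg_left by simp
    ultimately have "isCont s \<tau>" unfolding s_def using p by (intro continuous_intros) auto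
    moreover have "s \<tau> = 0" by (simp add: s_def U\<tau>)
    ultimately have "(s \<longlongrightarrow> 0) (at \<tau>)" by (simp add: isCont_def)
    moreover have "\<forall>\<^sub>F x in at \<tau>. norm (field_fn K x) \<le> s x"
    proof -
      have "\<forall>\<^sub>F x in nhds \<tau>. x \<in> {..<\<sigma>}" using \<tau>\<sigma> by (intro eventually_nhds_in_open) auto
      then have "\<forall>\<^sub>F x in at \<tau>. x < \<sigma>" by (simp add: eventually_nhds_conv_at)
      then show ?thesis
      proof eventually_elim
        case (elim x)
        show ?case
        proof (cases "x \<le> \<tau>")
          case True
          then show ?thesis using K by (simp add: field_fn_def s_def)
        next
          case False
          have x: "U x < 0" "V x < 0" "y x > 2" using False elim Uneg V_neg y_gt_2 \<sigma>0 by auto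
          have "\<bar>U x / ((p - 1) * V x)\<bar> = U x / ((p - 1) * V x)"
            using x p by (intro abs_of_nonneg divide_nonpos_nonpos mult_nonneg_nonpos) auto
          also have "\<dots> = 1 / (y x - 2)" using x p by (simp add: y_def)
          finally have s: "s x = (K / 2) * (K - 2) / (y x - 2)" by (simp add: s_def)
          show ?thesis
          proof (cases "y x \<ge> K")
            case True
            then show ?thesis using False K x by (simp add: field_fn_def s)
          next
            case yK: False
            have "norm (field_fn K x) \<le> K / 2" using field_fn_bound[OF K] by simp
            also have "\<dots> \<le> s x" unfolding s using yK x K by (simp add: pos_le_divide_eq)
            finally show ?thesis .
          qed
        qed
      qed
    qed
    ultimately have "(field_fn K \<longlongrightarrow> 0) (at \<tau>)" by (rule Lim_null_comparison[rotated])
    then show ?thesis using e by (simp add: isCont_def field_fn_def)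
  next
    case r
    define h where "h z = min (K / 2) (- (min z K) / 2) + (K / 2 - (K / 2) * (K - 2) / (max z K - 2))" for z
    have "isCont y t" by (rule DERIV_isCont[OF dy]) (use r t in auto)
    then have "isCont (\<lambda>t. h (y t)) t" unfolding h_def
      using K by (intro continuous_intros) auto
    moreover have "field_fn K s = h (y s)" if "\<tau> < s" for s
    proof (cases "y s \<ge> K")
      case True
      then have "max (y s) K = y s" "min (y s) K = K" by auto
      then show ?thesis using that K True by (simp add: field_fn_def h_def)
    next
      case False
      then have "max (y s) K = K" "min (y s) K = y s" by auto
      moreover have "(K / 2) * (K - 2) / (K - 2) = K / 2"
        by (rule nonzero_mult_div_cancel_right) (use K in simp)
      ultimately have "h (y s) = min (K / 2) (- y s / 2)" by (simp only: h_def)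
      then show ?thesis using that False by (auto simp: field_fn_def min_def)
    qed
    moreover have "\<forall>\<^sub>F s in nhds t. s \<in> {\<tau><..}" using r by (intro eventually_nhds_in_open) auto
    ultimately show ?thesis by (subst isCont_cong[of _ "\<lambda>t. h (y t)"]) (auto elim: eventually_mono)
  qed
qed

text \<open>The Riccati inequality \<open>g' - g\<^sup>2 \<ge> W - (k\<^sup>2 + \<delta>)\<close> with \<open>k = K / 2\<close>. For \<open>|y| \<le> K\<close> it amounts to
  \<open>(1 - a/2) W + y\<^sup>2/4 \<le> k\<^sup>2 + \<delta>\<close>, where the left hand side is \<open>F/2 + (1 - a) W\<close>. Where \<open>|y| > K\<close> the
  potential is below \<open>d\<close> and \<open>g\<^sup>2 \<le> k\<^sup>2\<close>, and inside the nodal circle \<open>g = 0\<close> and \<open>W \<le> 4 \<le> k\<^sup>2\<close>.\<close>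

lemma field_fn_inequality:
  assumes K: "4 \<le> K" and d: "0 < d" "d \<le> W \<sigma>" "deviation K d < a * d" and \<delta>: "d \<le> \<delta>"
    and c1: "deviation K d / 2 + (K\<^sup>2 / 2 + deviation K d) / (p - 1) \<le> \<delta>"
    and c2: "(K / 2) * (K - 2) / (p - 1) + (K / (2 * (K - 2)) + 1) * d \<le> \<delta>"
    and t: "t < 0" "t \<notin> kinks K"
  shows "W t + (field_fn K t)\<^sup>2 - (K\<^sup>2 / 4 + \<delta>) \<le> slope K t"
proof -
  have tn: "t \<noteq> \<tau>" using t by (simp add: kinks_def)
  have K2: "2 < K" "2 \<le> K" using K by auto
  have KK: "16 \<le> K\<^sup>2" using power_mono[OF K, of 2] by simp
  have Wd: "W t < d" if "\<tau> < t" "K \<le> \<bar>y t\<bar>"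
    using W_small_where_y_large[OF K2(1) d(1) that(1) t(1) that(2) d(2)] d(3) by (simp add: deviation_def)
  consider (l) "t < \<tau>" | (u) "\<tau> < t" "K < y t" | (m) "\<tau> < t" "- K < y t" "y t < K" | (d) "\<tau> < t" "y t < - K"
    using t tn by (fastforce simp: kinks_def)
  then show ?thesis
  proof cases
    case l
    then show ?thesis using W_positive_bubble[of t] KK d \<delta> by (simp add: field_fn_def slope_def)
  next
    case u
    have W: "W t < d" "0 \<le> W t" using Wd u W_nonneg by auto
    have y: "K - 2 \<le> y t - 2" "0 < K - 2" using u K by auto
    have "a * W t / (y t - 2)\<^sup>2 \<le> d / (K - 2)\<^sup>2"
    proof (rule frac_le)
      show "a * W t \<le> d" using a_bounds(2,3) W mult_right_mono[of a 1 "W t"] by simp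
      show "(K - 2)\<^sup>2 \<le> (y t - 2)\<^sup>2" using y by (intro power_mono) auto
    qed (use d y in auto)
    then have "(K / 2) * (K - 2) * (a * W t / (y t - 2)\<^sup>2 + 1 / (p - 1)) \<le> (K / 2) * (K - 2) * (d / (K - 2)\<^sup>2 + 1 / (p - 1))"
      using K by (intro mult_left_mono) auto
    also have "\<dots> = (K / (2 * (K - 2))) * d + (K / 2) * (K - 2) / (p - 1)"
    proof -
      have "(K - 2) * (d / (K - 2)\<^sup>2) = d / (K - 2)" using y by (simp add: power2_eq_square)
      then have "(K / 2) * (K - 2) * (d / (K - 2)\<^sup>2) = (K / (2 * (K - 2))) * d"
        by (metis mult.assoc times_divide_times_eq times_divide_eq_left)
      then show ?thesis by (simp only: distrib_left) simp
    qed
    finally have 1: "(K / 2) * (K - 2) * (a * W t / (y t - 2)\<^sup>2 + 1 / (p - 1)) \<le> (K / (2 * (K - 2))) * d + (K / 2) * (K - 2) / (p - 1)" .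
    have "(field_fn K t)\<^sup>2 \<le> (K / 2)\<^sup>2" using field_fn_bound[OF K2(1), of t] by (metis abs_ge_zero power2_abs power_mono)
    then have "(field_fn K t)\<^sup>2 \<le> K\<^sup>2 / 4" by (simp add: power_divide)
    moreover have "slope K t = - ((K / 2) * (K - 2) * (a * W t / (y t - 2)\<^sup>2 + 1 / (p - 1)))"
      using u by (simp add: slope_def)
    moreover have "(K / (2 * (K - 2)) + 1) * d = (K / (2 * (K - 2))) * d + d" by (simp add: ring_distribs)
    ultimately show ?thesis using 1 W c2 by linarith
  next
    case m
    have q: "0 \<le> (y t - 2)\<^sup>2 / (p - 1)" using p by simp
    have g: "field_fn K t = - y t / 2" "slope K t = (a * W t + (y t - 2)\<^sup>2 / (p - 1)) / 2" using m by (auto simp: field_fn_def slope_def)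
    have "(1 - a / 2) * W t + (y t)\<^sup>2 / 4 \<le> K\<^sup>2 / 4 + \<delta>"
    proof (cases "d \<le> W t")
      case True
      have Fn: "F t \<le> K\<^sup>2 / 2 + deviation K d" using F_near[OF K2(2) d(1) m(1) t(1) _ True d(2)] m by (auto simp: abs_le_iff)
      have "a * W t \<le> F t" by (simp add: F_def)
      then have "a * W t / (a * p) \<le> (K\<^sup>2 / 2 + deviation K d) / (p - 1)"
        unfolding a_bounds(4) using Fn p by (intro divide_right_mono) auto
      moreover have "a * W t / (a * p) = (1 - a) * W t" using a_bounds(3) p by (simp add: a_def field_simps)
      moreover have "(1 - a / 2) * W t + (y t)\<^sup>2 / 4 = F t / 2 + (1 - a) * W t" by (simp add: F_def field_simps)
      ultimately show ?thesis using Fn c1 by linarith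
    next
      case False
      have "(1 - a / 2) * W t \<le> 1 * W t" using a_bounds W_nonneg by (intro mult_right_mono) auto
      moreover have "\<bar>y t\<bar> \<le> K" using m by auto
      then have "(y t)\<^sup>2 \<le> K\<^sup>2" by (metis abs_ge_zero power2_abs power_mono)
      ultimately show ?thesis using False \<delta> by linarith
    qed
    then show ?thesis unfolding g using q by (simp add: field_simps power_divide)
  next
    case d
    then have "W t < d" using Wd[OF d(1)] by auto
    moreover have f: "field_fn K t = K / 2" and "slope K t = 0" using d K by (auto simp: field_fn_def slope_def)
    ultimately show ?thesis using \<delta> unfolding f by (simp add: power_divide)
  qed
qed

lemma slope_bounded:
  assumes K: "4 \<le> K" and d: "0 < d" "d \<le> W \<sigma>" "deviation K d < a * d"
  obtains B where "\<And>t. t < 0 \<Longrightarrow> t \<notin> kinks K \<Longrightarrow> \<bar>slope K t\<bar> \<le> B"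
proof -
  have K2: "2 < K" "2 \<le> K" using K by auto
  define B1 where "B1 = (K / 2) * (K - 2) * (d / (K - 2)\<^sup>2 + 1 / (p - 1))"
  define B2 where "B2 = (d + (K\<^sup>2 / 2 + deviation K d) + (K + 2)\<^sup>2 / (p - 1)) / 2"
  have B: "0 \<le> B1" "0 \<le> B2" using K d p deviation_nonneg[of K d] by (auto simp: B1_def B2_def)
  have "\<bar>slope K t\<bar> \<le> B1 + B2" if t: "t < 0" "t \<notin> kinks K" for t
  proof -
    have tn: "t \<noteq> \<tau>" using t by (simp add: kinks_def)
    have aW: "0 \<le> a * W t" "a * W t \<le> W t" using a_bounds W_nonneg[of t] mult_right_mono[of a 1 "W t"] by auto
    consider (l) "t < \<tau>" | (u) "\<tau> < t" "K < y t" | (m) "\<tau> < t" "- K < y t" "y t < K" | (d) "\<tau> < t" "y t < - K"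
      using t tn by (fastforce simp: kinks_def)
    then show ?thesis
    proof cases
      case u
      have "W t < d" using W_small_where_y_large[OF K2(1) d(1) u(1) t(1) _ d(2)] u d(3) by (simp add: deviation_def)
      then have "a * W t / (y t - 2)\<^sup>2 \<le> d / (K - 2)\<^sup>2"
        using aW d K u by (intro frac_le power_mono) auto
      then have "(K / 2) * (K - 2) * (a * W t / (y t - 2)\<^sup>2 + 1 / (p - 1)) \<le> B1"
        unfolding B1_def using K by (intro mult_left_mono) auto
      moreover have "0 \<le> (K / 2) * (K - 2) * (a * W t / (y t - 2)\<^sup>2 + 1 / (p - 1))"
        using K p a_bounds(3) W_nonneg[of t] by (intro mult_nonneg_nonneg add_nonneg_nonneg divide_nonneg_nonneg) auto
      ultimately show ?thesis using u B by (simp add: slope_def)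
    next
      case m
      have "a * W t \<le> d + (K\<^sup>2 / 2 + deviation K d)"
      proof (cases "d \<le> W t")
        case True
        have "F t \<le> K\<^sup>2 / 2 + deviation K d" using F_near[OF K2(2) d(1) m(1) t(1) _ True d(2)] m by (auto simp: abs_le_iff)
        moreover have "a * W t \<le> F t" by (simp add: F_def)
        ultimately show ?thesis using d by linarith
      next
        case False
        then show ?thesis using aW deviation_nonneg[of K d] K d by (simp add: add_increasing2)
      qed
      moreover have "(y t - 2)\<^sup>2 / (p - 1) \<le> (K + 2)\<^sup>2 / (p - 1)"
      proof -
        have "\<bar>y t - 2\<bar> \<le> K + 2" using m by auto
        then have "(y t - 2)\<^sup>2 \<le> (K + 2)\<^sup>2" by (metis abs_ge_zero power2_abs power_mono)
        then show ?thesis using p by (intro divide_right_mono) auto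
      qed
      moreover have "0 \<le> (y t - 2)\<^sup>2 / (p - 1)" using p by simp
      moreover have "slope K t = (a * W t + (y t - 2)\<^sup>2 / (p - 1)) / 2" using m by (simp add: slope_def)
      moreover have "f \<le> (D + r) / 2" if "A \<le> D" "s \<le> r" "f = (A + s) / 2" for A D f r s :: real
        using that by simp
      ultimately have "0 \<le> slope K t" "slope K t \<le> B2" using aW unfolding B2_def by (simp, blast)
      then show ?thesis using B by linarith
    qed (use B K in \<open>auto simp: slope_def\<close>)
  qed
  then show ?thesis by (rule that)
qed

section \<open>The test function for the upper bound\<close>

definition w where "w t = sqrt (W t)"

lemma dw:
  assumes t: "t < 0" "t \<noteq> \<tau>"
  shows "(w has_real_derivative y t * w t / 2) (at t)"
proof -
  have W: "0 < W t" by (rule W_pos[OF t])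
  have "(w has_real_derivative (inverse (sqrt (W t)) / 2) * (y t * W t)) (at t)"
    unfolding w_def[abs_def] by (rule DERIV_chain2[OF DERIV_real_sqrt[OF W] dW[OF t]])
  moreover have "(inverse (sqrt (W t)) / 2) * (y t * W t) = y t * w t / 2"
  proof -
    have "inverse s / 2 * (y t * (s * s)) = y t * s / 2" if "s > 0" for s :: real
      using that by simp
    from this[of "sqrt (W t)"] show ?thesis using W by (simp add: w_def)
  qed
  ultimately show ?thesis by metis
qed

text \<open>For \<open>e > 0\<close> and \<open>x > 0\<close> this is increasing and convex with \<open>x cut'(x) \<ge> cut(x)\<close>, and it vanishes to
  infinite order as \<open>x\<close> decreases to \<open>0\<close>.\<close>

definition cut where "cut e x = x * exp (- (e / x))" for e x :: real

lemma cut_derivs: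
  assumes "x > 0"
  shows "(cut e has_real_derivative (1 + e / x) * exp (- (e / x))) (at x)"
    "((\<lambda>x. (1 + e / x) * exp (- (e / x))) has_real_derivative e\<^sup>2 / x ^ 3 * exp (- (e / x))) (at x)"
  unfolding cut_def[abs_def] using assms
  by (auto intro!: derivative_eq_intros simp: field_simps power2_eq_square power3_eq_cube)

text \<open>The first two derivatives of \<open>cut e (w t - e)\<close>, the second one with \<open>w''\<close> written out.\<close>

definition cut_w' where "cut_w' e t = (1 + e / (w t - e)) * exp (- (e / (w t - e))) * (y t * w t / 2)"
definition cut_w'' where "cut_w'' e t = (e\<^sup>2 / (w t - e) ^ 3 * exp (- (e / (w t - e)))) * (y t * w t / 2)\<^sup>2
   + (1 + e / (w t - e)) * exp (- (e / (w t - e))) * (w t * (F t / 2 - a * W t - (y t - 2)\<^sup>2 / (2 * (p - 1))))"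

lemma cut_w_derivs:
  assumes t: "t < 0" "t \<noteq> \<tau>" and e: "e < w t"
  shows "((\<lambda>t. cut e (w t - e)) has_real_derivative cut_w' e t) (at t)" "(cut_w' e has_real_derivative cut_w'' e t) (at t)"
proof -
  have x: "0 < w t - e" using e by simp
  have dwe: "((\<lambda>t. w t - e) has_real_derivative y t * w t / 2) (at t)"
    using DERIV_diff[OF dw[OF t] DERIV_const[of e]] by simp
  show "((\<lambda>t. cut e (w t - e)) has_real_derivative cut_w' e t) (at t)"
    unfolding cut_w'_def by (rule DERIV_chain2[OF cut_derivs(1)[OF x] dwe])
  have 1: "((\<lambda>t. (1 + e / (w t - e)) * exp (- (e / (w t - e)))) has_real_derivative
     e\<^sup>2 / (w t - e) ^ 3 * exp (- (e / (w t - e))) * (y t * w t / 2)) (at t)"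
    by (rule DERIV_chain2[OF cut_derivs(2)[OF x] dwe])
  have 2: "((\<lambda>t. y t * w t / 2) has_real_derivative w t * (F t / 2 - a * W t - (y t - 2)\<^sup>2 / (2 * (p - 1)))) (at t)"
  proof -
    define q where "q = (y t - 2)\<^sup>2 / (p - 1)"
    have "((\<lambda>t. y t * w t / 2) has_real_derivative (- (a * W t + q) * w t + y t * w t / 2 * y t) / 2) (at t)"
      unfolding q_def by (intro DERIV_cdivide DERIV_mult dw dy t)
    moreover have "(- (a * W t + q) * w t + y t * w t / 2 * y t) / 2 = w t * (F t / 2 - a * W t - q / 2)"
      by (simp add: F_def field_simps power2_eq_square)
    moreover have "q / 2 = (y t - 2)\<^sup>2 / (2 * (p - 1))" by (simp add: q_def)
    ultimately show ?thesis by simp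
  qed
  show "(cut_w' e has_real_derivative cut_w'' e t) (at t)"
  proof -
    have alg: "P * S * S + T * M = P * S\<^sup>2 + M * T" for P S T M :: real by (simp add: power2_eq_square)
    have "((\<lambda>t. (1 + e / (w t - e)) * exp (- (e / (w t - e))) * (y t * w t / 2)) has_real_derivative cut_w'' e t) (at t)"
      by (rule DERIV_cong[OF DERIV_mult[OF 1 2]]) (unfold cut_w''_def, rule alg)
    then show ?thesis by (simp only: cut_w'_def[abs_def])
  qed
qed

text \<open>Write \<open>x = w - e\<close> and \<open>f = cut e x\<close>. By convexity \<open>f'' \<ge> cut'(x) w''\<close>, and
  \<open>w'' \<ge> (K\<^sup>2/4 - W - e') w\<close> since \<open>F\<close> is close to \<open>K\<^sup>2/2\<close>. Where the factor is nonnegative,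
  \<open>cut'(x) w \<ge> f\<close> suffices. Otherwise \<open>W\<close> is large, hence \<open>x \<ge> 1\<close>, and \<open>cut'(x) w\<close> exceeds \<open>f\<close> by at most
  \<open>3 e f\<close>, which is absorbed by \<open>\<delta>\<close>.\<close>

lemma cut_w_subsolution:
  assumes K: "4 \<le> K" and e: "0 < e" "e \<le> 1 / 2" "e\<^sup>2 \<le> W \<sigma>" "deviation K (e\<^sup>2) < a * e\<^sup>2" and \<delta>: "\<delta> \<le> 1"
    and c1: "deviation K (e\<^sup>2) / 2 + (K + 2)\<^sup>2 / (2 * (p - 1)) \<le> \<delta> / 2" and c2: "3 * e * (K\<^sup>2 + 3 * \<delta>) \<le> \<delta> / 2"
    and t: "\<tau> < t" "t < 0" and wt: "e < w t"
  shows "- cut e (w t - e) * cut_w'' e t \<le> (W t - K\<^sup>2 / 4 + \<delta>) * (cut e (w t - e))\<^sup>2"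
proof -
  have K2: "2 < K" "2 \<le> K" using K by auto
  have KK: "16 \<le> K\<^sup>2" using power_mono[OF K, of 2] by simp
  define x where "x = w t - e"
  define X where "X = exp (- (e / x))"
  have x: "0 < x" and X: "0 < X" using wt by (auto simp: x_def X_def)
  have e2: "0 < e\<^sup>2" using e by simp
  have Ww: "W t = (w t)\<^sup>2" using W_nonneg by (simp add: w_def)
  have We: "e\<^sup>2 < W t" unfolding Ww using wt e by (intro power_strict_mono) auto
  have yK: "\<bar>y t\<bar> < K"
  proof (rule ccontr)
    assume "\<not> \<bar>y t\<bar> < K"
    then have "W t < e\<^sup>2" using W_small_where_y_large[OF K2(1) e2 t _ e(3)] e(4) by (simp add: deviation_def)
    then show False using We by simp
  qed
  have Fn: "\<bar>F t - K\<^sup>2 / 2\<bar> \<le> deviation K (e\<^sup>2)" using F_near[OF K2(2) e2 t _ _ e(3)] yK We by simp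
  define e' where "e' = deviation K (e\<^sup>2) / 2 + (K + 2)\<^sup>2 / (2 * (p - 1))"
  have e'0: "0 \<le> e'" using deviation_nonneg[OF _ e2, of K] K p by (simp add: e'_def)
  have "e' \<le> \<delta> / 2" using c1 by (simp only: e'_def)
  with e'0 have \<delta>0: "0 \<le> \<delta>" "e' \<le> \<delta> / 2" by auto
  have "(y t - 2)\<^sup>2 / (2 * (p - 1)) \<le> (K + 2)\<^sup>2 / (2 * (p - 1))"
  proof -
    have "\<bar>y t - 2\<bar> \<le> K + 2" using yK by auto
    then have "(y t - 2)\<^sup>2 \<le> (K + 2)\<^sup>2" by (metis abs_ge_zero power2_abs power_mono)
    then show ?thesis using p by (intro divide_right_mono) auto
  qed
  moreover have "a * W t \<le> W t" using a_bounds W_nonneg[of t] mult_right_mono[of a 1 "W t"] by auto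
  ultimately have Q: "K\<^sup>2 / 4 - W t - e' \<le> F t / 2 - a * W t - (y t - 2)\<^sup>2 / (2 * (p - 1))"
    using Fn unfolding e'_def by (simp add: abs_le_iff)
  define q where "q = W t + e' - K\<^sup>2 / 4"
  have cx: "cut e (w t - e) = x * X" by (simp add: cut_def x_def X_def)
  have cx0: "0 < x * X" using x X by simp
  have cut_w'': "(1 + e / x) * X * (w t * (- q)) \<le> cut_w'' e t"
  proof -
    have "0 \<le> (e\<^sup>2 / x ^ 3 * X) * (y t * w t / 2)\<^sup>2" using x X by simp
    moreover have "(1 + e / x) * X * (w t * (- q)) \<le> (1 + e / x) * X * (w t * (F t / 2 - a * W t - (y t - 2)\<^sup>2 / (2 * (p - 1))))"
      using Q x X e wt by (intro mult_left_mono) (auto simp: q_def)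
    ultimately show ?thesis by (simp add: cut_w''_def x_def X_def)
  qed
  have "(e' - \<delta> - q) * (x * X) \<le> (1 + e / x) * X * (w t * (- q))"
  proof (cases "q \<le> 0")
    case True
    have "x * X \<le> (1 + e / x) * X * w t"
    proof -
      have "x * 1 \<le> w t * (1 + e / x)" using x e by (intro mult_mono) (auto simp: x_def)
      then show ?thesis using X by (simp add: mult.commute mult.left_commute mult_left_mono)
    qed
    then have "(- q) * (x * X) \<le> (- q) * ((1 + e / x) * X * w t)" using True by (intro mult_left_mono) auto
    moreover have "(e' - \<delta>) * (x * X) \<le> 0" using cx0 \<delta>0 by (intro mult_nonpos_nonneg) auto
    ultimately show ?thesis by (simp add: algebra_simps)
  next
    case False
    have "x \<ge> 1"
    proof (rule ccontr)
      assume "\<not> x \<ge> 1"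
      then have "w t \<le> 3 / 2" using e by (simp add: x_def)
      then have "W t \<le> (3 / 2)\<^sup>2" unfolding Ww using wt e by (intro power_mono) auto
      then show False using False KK \<delta>0 \<delta> by (simp add: q_def power_divide)
    qed
    have "q \<le> K\<^sup>2 + 3 * \<delta>"
    proof -
      have "a * W t \<le> F t" by (simp add: F_def)
      then have "1 / 2 * W t \<le> K\<^sup>2 / 2 + deviation K (e\<^sup>2)"
        using mult_right_mono[OF a_bounds(1) W_nonneg[of t]] Fn by (simp add: abs_le_iff)
      moreover have "deviation K (e\<^sup>2) \<le> \<delta>" using c1 p by (simp add: e'_def) (smt (verit) divide_nonneg_pos zero_le_power2 mult_pos_pos)
      ultimately show ?thesis using \<delta>0 KK by (simp add: q_def)
    qed
    then have "q * (3 * e) \<le> (K\<^sup>2 + 3 * \<delta>) * (3 * e)" using e by (intro mult_right_mono) auto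
    then have qe: "q * (3 * e) \<le> \<delta> / 2" using c2 by (simp add: algebra_simps)
    have "(1 + e / x) * w t - x \<le> 3 * e"
    proof -
      have "(1 + e / x) * w t - x = 2 * e + e * (e / x)" using x by (simp add: x_def field_simps)
      also have "e * (e / x) \<le> e * 1" using e \<open>x \<ge> 1\<close> by (intro mult_left_mono) (auto simp: divide_le_eq)
      finally show ?thesis by simp
    qed
    then have "q * ((1 + e / x) * w t - x) \<le> q * (3 * e)" using False by (intro mult_left_mono) auto
    also have "\<dots> \<le> \<delta> - e'" using qe \<delta>0 by linarith
    also have "\<dots> \<le> (\<delta> - e') * x" using \<delta>0 \<open>x \<ge> 1\<close> mult_left_mono[of 1 x "\<delta> - e'"] by simp
    finally have "X * (q * ((1 + e / x) * w t - x)) \<le> X * ((\<delta> - e') * x)" using X by (intro mult_left_mono) auto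
    then show ?thesis by (simp add: algebra_simps)
  qed
  then have "(e' - \<delta> - q) * (x * X) \<le> cut_w'' e t" using cut_w'' by simp
  then have "(x * X) * ((e' - \<delta> - q) * (x * X)) \<le> (x * X) * cut_w'' e t" using cx0 by (intro mult_left_mono) auto
  then show ?thesis unfolding cx by (simp add: q_def power2_eq_square algebra_simps)
qed

end

section \<open>Radial functions on the plane\<close>

lemma radial_has_derivative:
  fixes x :: "'a::real_inner"
  assumes "(G has_real_derivative G') (at (ln (norm x)))" "x \<noteq> 0"
  shows "((\<lambda>x. G (ln (norm x))) has_derivative (\<lambda>h. G' * ((x \<bullet> h) / (norm x)\<^sup>2))) (at x)"
proof -
  have "(ln has_real_derivative inverse (norm x)) (at (norm x))"
    using assms(2) by (intro DERIV_ln) simp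
  then have "(ln has_derivative (*) (inverse (norm x))) (at (norm x))"
    by (simp add: has_field_derivative_def)
  from has_derivative_compose[OF has_derivative_norm[OF assms(2)] this]
  have "((\<lambda>x. ln (norm x)) has_derivative (\<lambda>h. inverse (norm x) * (h \<bullet> sgn x))) (at x)" .
  from has_derivative_compose[OF this assms(1)[unfolded has_field_derivative_def]]
  have "((\<lambda>x. G (ln (norm x))) has_derivative (\<lambda>h. G' * (inverse (norm x) * (h \<bullet> sgn x)))) (at x)" .
  moreover have "inverse (norm x) * (h \<bullet> sgn x) = (x \<bullet> h) / (norm x)\<^sup>2" for h
    by (simp add: sgn_div_norm inner_commute power2_eq_square divide_inverse)
  ultimately show ?thesis by simp
qed

lemma open_log_norm:
  assumes "open I"
  shows "open {x::'a::real_normed_vector. x \<noteq> 0 \<and> ln (norm x) \<in> I}"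
proof -
  have "continuous_on (- {0::'a}) (\<lambda>x. ln (norm x))" by (intro continuous_intros) auto
  then have "open (- {0::'a} \<inter> (\<lambda>x. ln (norm x)) -` I)"
    using assms by (intro continuous_open_preimage) auto
  moreover have "- {0::'a} \<inter> (\<lambda>x. ln (norm x)) -` I = {x. x \<noteq> 0 \<and> ln (norm x) \<in> I}" by auto
  ultimately show ?thesis by simp
qed

text \<open>In logarithmic polar coordinates the Laplacian of a radial function is \<open>|x|\<^sup>-\<^sup>2\<close> times the second
  derivative. Only a derivative of \<open>G'\<close> at the single point is assumed, so that the lemma also
  serves to identify this derivative when the Laplacian is known.\<close>

lemma laplacian_radial:
  fixes v :: "real^2 \<Rightarrow> real"
  assumes I: "open I" and d1: "\<And>t. t \<in> I \<Longrightarrow> (G has_real_derivative G1 t) (at t)"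
    and d2: "(G1 has_real_derivative G2) (at (ln (norm x)))"
    and x: "x \<noteq> 0" "ln (norm x) \<in> I"
    and v: "\<And>z. z \<noteq> 0 \<Longrightarrow> ln (norm z) \<in> I \<Longrightarrow> v z = G (ln (norm z))"
  shows "laplacian v x = G2 / (norm x)\<^sup>2"
proof -
  define T where "T = {z::real^2. z \<noteq> 0 \<and> ln (norm z) \<in> I}"
  have T: "open T" "x \<in> T" using open_log_norm[OF I] x by (auto simp: T_def)
  define H where "H t = G1 t * exp (- 2 * t)" for t
  have e2: "exp (- 2 * ln (norm z)) = 1 / (norm z)\<^sup>2" if "z \<noteq> 0" for z :: "real^2"
    using that by (simp add: exp_minus exp_double divide_inverse)
  have p1: "partial i v z = z $ i * H (ln (norm z))" if z: "z \<in> T" for i z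
  proof -
    have "partial i v z = partial i (\<lambda>z. G (ln (norm z))) z"
      by (rule partial_cong_open[OF T(1) z]) (simp add: T_def v)
    also have "\<dots> = G1 (ln (norm z)) * ((z \<bullet> axis i 1) / (norm z)\<^sup>2)"
      by (rule partial_has_derivative[OF radial_has_derivative[OF d1]]) (use z in \<open>auto simp: T_def\<close>)
    finally show ?thesis using e2[of z] z by (simp add: inner_axis H_def T_def)
  qed
  have dH: "(H has_real_derivative (G2 - 2 * G1 (ln (norm x))) * exp (- 2 * ln (norm x))) (at (ln (norm x)))"
    unfolding H_def[abs_def] by (auto intro!: derivative_eq_intros d2 simp: algebra_simps)
  have p2: "partial i (partial i v) x = x $ i * ((G2 - 2 * G1 (ln (norm x))) * exp (- 2 * ln (norm x)) * (x $ i / (norm x)\<^sup>2)) + H (ln (norm x))" for i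
  proof -
    have "partial i (partial i v) x = partial i (\<lambda>z. z $ i * H (ln (norm z))) x"
      by (rule partial_cong_open[OF T]) (rule p1)
    also have "\<dots> = x $ i * ((G2 - 2 * G1 (ln (norm x))) * exp (- 2 * ln (norm x)) * ((x \<bullet> axis i 1) / (norm x)\<^sup>2))
        + (axis i 1 :: real^2) $ i * H (ln (norm x))"
      by (rule partial_has_derivative[OF has_derivative_mult[OF bounded_linear_imp_has_derivative[OF bounded_linear_vec_nth]
            radial_has_derivative[OF dH x(1)]]])
    finally show ?thesis by (simp add: inner_axis)
  qed
  have xx: "(x $ 1)\<^sup>2 + (x $ 2)\<^sup>2 = (norm x)\<^sup>2" by (simp add: norm_vec_def L2_set_def sum_2)
  have "laplacian v x = (G2 - 2 * G1 (ln (norm x))) * exp (- 2 * ln (norm x)) * (((x $ 1)\<^sup>2 + (x $ 2)\<^sup>2) / (norm x)\<^sup>2) + 2 * H (ln (norm x))"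
    unfolding laplacian_def sum_2 p2 by (simp add: power2_eq_square algebra_simps add_divide_distrib)
  also have "\<dots> = G2 * exp (- 2 * ln (norm x))" unfolding xx using x by (simp add: H_def algebra_simps)
  finally show ?thesis unfolding e2[OF x(1)] by simp
qed

lemma less_ln_iff_exp_less: "0 < x \<Longrightarrow> t < ln x \<longleftrightarrow> exp t < x" for x t :: real
  by (metis exp_less_cancel_iff exp_ln)

text \<open>The functions \<open>w = W\<^sup>1\<^sup>/\<^sup>2\<close>, \<open>y\<close> and \<open>|x|\<^sup>-\<^sup>2\<close> are treated together, because their partial derivatives are
  polynomials in these three functions and the coordinates. This gives all derivatives at once,
  although the solution itself is only known to be twice continuously differentiable.\<close>

lemma (in nodal_profile) Ck_on_log_polar:
  defines "S \<equiv> {x::real^2. exp \<tau> < norm x \<and> norm x < 1}"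
  shows "Ck_on k S (\<lambda>x. w (ln (norm x))) \<and> Ck_on k S (\<lambda>x. y (ln (norm x))) \<and> Ck_on k S (\<lambda>x. 1 / (norm x)\<^sup>2)"
proof -
  have S: "open S" unfolding S_def by (intro open_Collect_conj open_Collect_less continuous_intros)
  have x: "x \<noteq> 0" "ln (norm x) < 0" "\<tau> < ln (norm x)" if "x \<in> S" for x
  proof -
    have "0 < norm x" using that exp_gt_zero[of \<tau>] unfolding S_def by (metis (mono_tags) less_trans mem_Collect_eq)
    then show "x \<noteq> 0" "ln (norm x) < 0" "\<tau> < ln (norm x)"
      using that by (auto simp: S_def less_ln_iff_exp_less)
  qed
  have dw': "((\<lambda>x. w (ln (norm x))) has_derivative
      (\<lambda>h. (y (ln (norm x)) * w (ln (norm x)) / 2) * ((x \<bullet> h) / (norm x)\<^sup>2))) (at x)" if "x \<in> S" for x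
    by (rule radial_has_derivative[OF dw]) (use x[OF that] in auto)
  have dy': "((\<lambda>x. y (ln (norm x))) has_derivative
      (\<lambda>h. - (a * W (ln (norm x)) + (y (ln (norm x)) - 2)\<^sup>2 / (p - 1)) * ((x \<bullet> h) / (norm x)\<^sup>2))) (at x)" if "x \<in> S" for x
    by (rule radial_has_derivative[OF dy]) (use x[OF that] in auto)
  have dJ: "((\<lambda>x. 1 / (norm x)\<^sup>2) has_derivative (\<lambda>h. - 2 * (1 / (norm x)\<^sup>2) * ((x \<bullet> h) / (norm x)\<^sup>2))) (at x)" if "x \<in> S" for x
  proof -
    have e2: "exp (- 2 * ln (norm z)) = 1 / (norm z)\<^sup>2" if "z \<in> S" for z
      using x[OF that] by (simp add: exp_minus exp_double divide_inverse)
    have "((\<lambda>t. exp (- 2 * t)) has_real_derivative - 2 * exp (- 2 * ln (norm x))) (at (ln (norm x)))"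
      by (auto intro!: derivative_eq_intros)
    from radial_has_derivative[OF this x(1)[OF that]]
    have "((\<lambda>x. exp (- 2 * ln (norm x))) has_derivative (\<lambda>h. - 2 * (1 / (norm x)\<^sup>2) * ((x \<bullet> h) / (norm x)\<^sup>2))) (at x)"
      unfolding e2[OF that] .
    then show ?thesis
      by (rule has_derivative_transform_within_open[OF _ S that]) (rule e2)
  qed
  have Ww: "W t = w t * w t" for t using W_nonneg[of t] by (simp add: w_def)
  show ?thesis
  proof (induction k)
    case 0
    have "isCont (\<lambda>x. w (ln (norm x))) x" "isCont (\<lambda>x. y (ln (norm x))) x" "isCont (\<lambda>x. 1 / (norm x)\<^sup>2) x" if "x \<in> S" for x
      using has_derivative_continuous dw'[OF that] dy'[OF that] dJ[OF that] by blast+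
    then show ?case by (auto intro!: continuous_at_imp_continuous_on)
  next
    case (Suc k)
    note C = Suc[THEN conjunct1] Suc[THEN conjunct2, THEN conjunct1] Suc[THEN conjunct2, THEN conjunct2]
    note CI = Ck_on_mult[OF S] Ck_on_add[OF S] Ck_on_minus[OF S] Ck_on_diff[OF S] Ck_on_const[OF S] Ck_on_nth[OF S] C
    show ?case
    proof (intro conjI)
      show "Ck_on (Suc k) S (\<lambda>x. w (ln (norm x)))"
      proof (rule Ck_on_SucI[OF S dw'])
        fix i
        have "Ck_on k S (\<lambda>x. (1 / 2 * (y (ln (norm x)) * w (ln (norm x)))) * (x $ i * (1 / (norm x)\<^sup>2)))" by (intro CI)
        then show "Ck_on k S (\<lambda>x. y (ln (norm x)) * w (ln (norm x)) / 2 * (x \<bullet> axis i 1 / (norm x)\<^sup>2))"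
          by (simp add: inner_axis)
      qed
      show "Ck_on (Suc k) S (\<lambda>x. y (ln (norm x)))"
      proof (rule Ck_on_SucI[OF S dy'])
        fix i
        have "Ck_on k S (\<lambda>x. - (a * (w (ln (norm x)) * w (ln (norm x))) + (1 / (p - 1)) * ((y (ln (norm x)) - 2) * (y (ln (norm x)) - 2))) * (x $ i * (1 / (norm x)\<^sup>2)))" by (intro CI)
        then show "Ck_on k S (\<lambda>x. - (a * W (ln (norm x)) + (y (ln (norm x)) - 2)\<^sup>2 / (p - 1)) * (x \<bullet> axis i 1 / (norm x)\<^sup>2))"
          by (simp add: inner_axis Ww power2_eq_square)
      qed
      show "Ck_on (Suc k) S (\<lambda>x. 1 / (norm x)\<^sup>2)"
      proof (rule Ck_on_SucI[OF S dJ])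
        fix i
        have "Ck_on k S (\<lambda>x. - 2 * (1 / (norm x)\<^sup>2) * (x $ i * (1 / (norm x)\<^sup>2)))" by (intro CI)
        then show "Ck_on k S (\<lambda>x. - 2 * (1 / (norm x)\<^sup>2) * (x \<bullet> axis i 1 / (norm x)\<^sup>2))"
          by (simp add: inner_axis)
      qed
    qed
  qed
qed

text \<open>The set where \<open>v \<noteq> 0\<close> is open and nonempty in \<open>\<Omega>\<close>, hence not a null set.\<close>

lemma continuous_not_ae_zero:
  assumes "open \<Omega>" "continuous_on UNIV (v :: real^2 \<Rightarrow> real)" "x \<in> \<Omega>" "v x \<noteq> 0"
  shows "\<not> ae_zero \<Omega> v"
proof
  assume "ae_zero \<Omega> v"
  then have "AE z in lebesgue. z \<in> \<Omega> \<longrightarrow> v z = 0"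
    using assms(1) by (simp add: ae_zero_def AE_restrict_space_iff)
  then have "AE z in lebesgue. z \<notin> \<Omega> \<inter> {z. v z \<noteq> 0}" by eventually_elim simp
  moreover have "open {z. v z \<noteq> 0}"
    using open_vimage[OF open_Compl[OF closed_singleton[of 0]] assms(2)] by (simp add: vimage_def Compl_eq)
  then have o: "open (\<Omega> \<inter> {z. v z \<noteq> 0})" by (rule open_Int[OF assms(1)])
  ultimately have "\<Omega> \<inter> {z. v z \<noteq> 0} \<in> null_sets lebesgue"
    by (subst AE_iff_null_sets) auto
  then show False
    using open_not_negligible[OF o] assms(3,4) by (auto simp: negligible_iff_null_sets)
qed

text \<open>The function \<open>v\<close> is \<open>cut e (w - e)\<close>, extended by \<open>0\<close>; writing it with \<open>flat\<close> makes it a smooth function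
  of \<open>w\<close> also where \<open>w = e\<close>. The closed set \<open>K\<close> contains the support and keeps it away from the nodal
  circle and from the boundary.\<close>

lemma (in nodal_profile) bump_test_function:
  fixes n :: nat and e :: real
  defines "S \<equiv> {x::real^2. exp \<tau> < norm x \<and> norm x < 1}"
  defines "v \<equiv> (\<lambda>x::real^2. if x \<in> S then (w (ln (norm x)) - e) * flat 1 ((w (ln (norm x)) - e) / e) else 0)"
  assumes e: "0 < e" "e < w \<sigma>" and n: "1 / real n \<le> exp \<tau>" "n \<ge> 1"
    and K: "closed K" "K \<subseteq> S" "{x \<in> S. e \<le> w (ln (norm x))} \<subseteq> K"
  shows "v \<in> test_functions (annulus n)" "\<not> ae_zero (annulus n) v" "v \<in> H10_rad (annulus n)"
    "\<And>x. x \<in> S \<Longrightarrow> e < w (ln (norm x)) \<Longrightarrow> v x = cut e (w (ln (norm x)) - e) \<and> laplacian v x = cut_w'' e (ln (norm x)) / (norm x)\<^sup>2"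
    "\<And>x. \<not> (x \<in> S \<and> e < w (ln (norm x))) \<Longrightarrow> v x = 0"
proof -
  have S: "open S" unfolding S_def by (intro open_Collect_conj open_Collect_less continuous_intros)
  have SA: "S \<subseteq> annulus n" using n by (auto simp: S_def annulus_def)
  have K3: "x \<in> K" if "x \<in> S" "e \<le> w (ln (norm x))" for x using K(3) that by auto
  have v0: "v x = 0" if "\<not> (x \<in> S \<and> e < w (ln (norm x)))" for x
  proof -
    have "flat 1 ((w (ln (norm x)) - e) / e) = 0" if "w (ln (norm x)) \<le> e"
      using that e by (simp add: flat_def zero_less_divide_iff)
    then show ?thesis using that by (auto simp: v_def)
  qed
  then show "\<And>x. \<not> (x \<in> S \<and> e < w (ln (norm x))) \<Longrightarrow> v x = 0" .
  have v1: "v x = cut e (w (ln (norm x)) - e)" if "x \<in> S" "e < w (ln (norm x))" for x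
    using that e by (simp add: v_def flat_def cut_def)
  have Ck: "Ck_on k UNIV v" for k
  proof (rule Ck_on_UNIV_extend[OF S K(1,2)])
    show "v x = 0" if "x \<notin> K" for x using v0[of x] K3[of x] that by (meson less_imp_le)
    have A: "Ck_on k S (\<lambda>x. w (ln (norm x)) - e)"
      using Ck_on_diff[OF S Ck_on_log_polar[THEN conjunct1, of k, folded S_def] Ck_on_const[OF S]] .
    have "Ck_on k S (\<lambda>x. (1 / e) * (w (ln (norm x)) - e))" by (rule Ck_on_mult[OF S Ck_on_const[OF S] A])
    then have "Ck_on k S (\<lambda>x. (w (ln (norm x)) - e) / e)" by simp
    from Ck_on_mult[OF S A Ck_on_flat[OF S this, of 1]]
    show "Ck_on k S v" by (rule Ck_on_cong_open[OF S, rotated]) (simp add: v_def)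
  qed
  have cl: "closure {x. v x \<noteq> 0} \<subseteq> K"
    by (intro closure_minimal K(1) subsetI) (use v0 K3 less_imp_le in blast)
  have "bounded S" by (rule bounded_subset[OF bounded_ball[of 0 1]]) (auto simp: S_def)
  then have "bounded (closure {x. v x \<noteq> 0})" using cl K(2) bounded_subset by metis
  then have "compact (closure {x. v x \<noteq> 0})" by (simp add: compact_eq_bounded_closed)
  then show vt: "v \<in> test_functions (annulus n)"
    using cl K(2) SA Ck unfolding test_functions_def by blast
  show "\<not> ae_zero (annulus n) v"
  proof (rule continuous_not_ae_zero[OF annulus_basic(1) test_functions_continuous[OF vt]])
    define x :: "real^2" where "x = exp \<sigma> *\<^sub>R axis 1 1"
    have nx: "norm x = exp \<sigma>" by (simp add: x_def)
    then have xS: "x \<in> S" using \<tau>\<sigma> \<sigma>0 by (simp add: S_def)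
    then show "x \<in> annulus n" using SA by auto
    have "e < w (ln (norm x))" using e nx by simp
    then show "v x \<noteq> 0" using v1[OF xS] by (simp add: cut_def)
  qed
  have "v x = v z" if "norm x = norm z" for x z by (simp only: v_def S_def mem_Collect_eq that)
  then show "v \<in> H10_rad (annulus n)"
    using test_functions_H10[OF annulus_basic(1,2) vt] unfolding H10_rad_def by blast
  show "v x = cut e (w (ln (norm x)) - e) \<and> laplacian v x = cut_w'' e (ln (norm x)) / (norm x)\<^sup>2"
    if x: "x \<in> S" "e < w (ln (norm x))" for x
  proof
    show "v x = cut e (w (ln (norm x)) - e)" using v1 x by blast
    define I where "I = {t \<in> {\<tau><..<0}. e < w t}"
    have "continuous_on {\<tau><..<0} w"
      by (intro continuous_at_imp_continuous_on ballI DERIV_isCont[OF dw]) auto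
    then have "open ({\<tau><..<0} \<inter> w -` {e<..})" by (rule continuous_open_preimage) auto
    moreover have "{\<tau><..<0} \<inter> w -` {e<..} = I" by (auto simp: I_def)
    ultimately have I: "open I" by simp
    have pos: "0 < norm z" if "z \<in> S" for z
      using that exp_gt_zero[of \<tau>] unfolding S_def by (metis (mono_tags) less_trans mem_Collect_eq)
    have xI: "ln (norm x) \<in> I" "x \<noteq> 0" using x pos[OF x(1)] by (auto simp: I_def S_def less_ln_iff_exp_less)
    show "laplacian v x = cut_w'' e (ln (norm x)) / (norm x)\<^sup>2"
    proof (rule laplacian_radial[OF I _ _ xI(2,1)])
      show "((\<lambda>t. cut e (w t - e)) has_real_derivative cut_w' e t) (at t)" if "t \<in> I" for t
        by (rule cut_w_derivs(1)) (use that in \<open>auto simp: I_def\<close>)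
      show "(cut_w' e has_real_derivative cut_w'' e (ln (norm x))) (at (ln (norm x)))"
        by (rule cut_w_derivs(2)) (use xI in \<open>auto simp: I_def\<close>)
      show "v z = cut e (w (ln (norm z)) - e)" if "z \<noteq> 0" "ln (norm z) \<in> I" for z
        by (rule v1) (use that in \<open>auto simp: I_def S_def less_ln_iff_exp_less ln_less_zero_iff\<close>)
    qed
  qed
qed

section \<open>Two-sided bounds for the first radial eigenvalue\<close>

context nodal_profile
begin

text \<open>At \<open>\<sigma>\<close> one has \<open>F = a W + 2\<close>, so the deviation tends to \<open>0\<close> if \<open>W(\<sigma>)\<close> tends to \<open>L = K\<^sup>2/2 - 2\<close>.\<close>

lemma deviation_le:
  assumes "K\<^sup>2 / 2 = L + 2" "0 \<le> K" "0 < d"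
  shows "deviation K d \<le> \<bar>W \<sigma> - L\<bar> + W \<sigma> / p + 2 * K * (K + 2) ^ 3 / ((p - 1) * d)"
proof -
  have "F \<sigma> - K\<^sup>2 / 2 = (W \<sigma> - L) - W \<sigma> / p"
    using assms(1) by (simp add: F_def y_\<sigma> a_def field_simps)
  moreover have "0 \<le> W \<sigma> / p" using W_nonneg p by simp
  ultimately have 1: "\<bar>F \<sigma> - K\<^sup>2 / 2\<bar> \<le> \<bar>W \<sigma> - L\<bar> + W \<sigma> / p" by linarith
  have "C K d * (K + 2) = K * (K + 2) ^ 3 / ((p - 1) * a * d)"
    by (simp add: C_def power2_eq_square power3_eq_cube mult.assoc)
  also have "\<dots> \<le> K * (K + 2) ^ 3 / ((p - 1) * (1 / 2) * d)"
    using assms p a_bounds by (intro divide_left_mono mult_right_mono mult_left_mono mult_pos_pos) auto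
  also have "\<dots> = 2 * K * (K + 2) ^ 3 / ((p - 1) * d)" by simp
  finally show ?thesis using 1 by (simp add: deviation_def)
qed

context
  fixes u :: "real^2 \<Rightarrow> real" and n :: nat
  assumes cont: "continuous_on (cball 0 1) u" and bd: "\<And>x. norm x = 1 \<Longrightarrow> u x = 0"
    and rad: "\<And>x. x \<noteq> 0 \<Longrightarrow> norm x < 1 \<Longrightarrow> u x = U (ln (norm x))"
    and n: "n \<ge> 2" "1 / real n \<le> exp \<tau>"
begin

lemma potential_W:
  assumes "x \<noteq> 0" "norm x < 1"
  shows "p * \<bar>u x\<bar> powr (p - 1) * (norm x)\<^sup>2 = W (ln (norm x))"
  using rad[OF assms] assms by (simp add: W_def exp_double)

lemma rayleigh_ge_of_deviation:
  assumes K: "4 \<le> K" and d: "0 < d" "d \<le> W \<sigma>" "deviation K d < a * d" and \<delta>: "d \<le> \<delta>"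
    and c1: "deviation K d / 2 + (K\<^sup>2 / 2 + deviation K d) / (p - 1) \<le> \<delta>"
    and c2: "(K / 2) * (K - 2) / (p - 1) + (K / (2 * (K - 2)) + 1) * d \<le> \<delta>"
    and v: "v \<in> H10_rad (annulus n)" "\<not> ae_zero (annulus n) v"
  shows "- (K\<^sup>2 / 4 + \<delta>) \<le> rayleigh p u n v"
proof (rule rayleigh_lower_bound[OF _ cont])
  have K2: "2 < K" using K by simp
  obtain B where B: "\<And>t. t < 0 \<Longrightarrow> t \<notin> kinks K \<Longrightarrow> \<bar>slope K t\<bar> \<le> B" using slope_bounded[OF K d] by blast
  fix \<phi> assume \<phi>: "\<phi> \<in> test_functions (annulus n)"
  show "0 \<le> (\<integral>x. (norm (classical_grad \<phi> x))\<^sup>2 + ((K\<^sup>2 / 4 + \<delta>) / (norm x)\<^sup>2 - p * \<bar>u x\<bar> powr (p - 1)) * (\<phi> x)\<^sup>2 \<partial>lebesgue_on (annulus n))"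
  proof (rule radial_hardy[OF n(1) finite_kinks field_fn_continuous[OF K2] field_fn_deriv[OF K2] B field_fn_bound[OF K2] _ \<phi>])
    fix x assume x: "x \<in> annulus n" "ln (norm x) \<notin> kinks K"
    have nx: "0 < norm x" "norm x < 1" using annulus_norm[OF x(1)] n by auto
    have "((K\<^sup>2 / 4 + \<delta>) / (norm x)\<^sup>2 - p * \<bar>u x\<bar> powr (p - 1)) * (norm x)\<^sup>2 = (K\<^sup>2 / 4 + \<delta>) - W (ln (norm x))"
      using nx potential_W[of x] by (simp add: left_diff_distrib)
    moreover have "W (ln (norm x)) + (field_fn K (ln (norm x)))\<^sup>2 - (K\<^sup>2 / 4 + \<delta>) \<le> slope K (ln (norm x))"
      using nx by (intro field_fn_inequality[OF K d \<delta> c1 c2 _ x(2)]) simp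
    ultimately show "(field_fn K (ln (norm x)))\<^sup>2 - slope K (ln (norm x)) \<le> ((K\<^sup>2 / 4 + \<delta>) / (norm x)\<^sup>2 - p * \<bar>u x\<bar> powr (p - 1)) * (norm x)\<^sup>2"
      by linarith
  qed
qed (use p n v in \<open>auto simp: H10_rad_def\<close>)

text \<open>The set \<open>Kc\<close> below is closed up to the boundary, because the potential is continuous on the closed
  disc, and it misses the nodal circle and the boundary, because the potential vanishes there.\<close>

lemma exists_rayleigh_le_of_deviation:
  assumes K: "4 \<le> K" and e: "0 < e" "e \<le> 1 / 2" "e\<^sup>2 < W \<sigma>" "deviation K (e\<^sup>2) < a * e\<^sup>2" and \<delta>: "\<delta> \<le> 1"
    and c1: "deviation K (e\<^sup>2) / 2 + (K + 2)\<^sup>2 / (2 * (p - 1)) \<le> \<delta> / 2" and c2: "3 * e * (K\<^sup>2 + 3 * \<delta>) \<le> \<delta> / 2"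
  obtains v where "v \<in> H10_rad (annulus n)" "\<not> ae_zero (annulus n) v" "rayleigh p u n v \<le> - (K\<^sup>2 / 4) + \<delta>"
proof -
  define S where "S = {x::real^2. exp \<tau> < norm x \<and> norm x < 1}"
  define v where "v = (\<lambda>x::real^2. if x \<in> S then (w (ln (norm x)) - e) * flat 1 ((w (ln (norm x)) - e) / e) else 0)"
  define P where "P x = p * \<bar>u x\<bar> powr (p - 1) * (norm x)\<^sup>2" for x
  have Pc: "continuous_on (cball 0 1) P" unfolding P_def using p
    by (intro continuous_intros continuous_on_powr' cont) auto
  have ew: "e < w \<sigma>"
  proof -
    have "sqrt (e\<^sup>2) < sqrt (W \<sigma>)" using e(3) by (rule real_sqrt_less_mono)
    then show ?thesis using e(1) by (simp add: w_def)
  qed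
  define Kc where "Kc = {x \<in> cball 0 1. e\<^sup>2 \<le> P x \<and> exp \<tau> \<le> norm x}"
  have "closed (cball 0 1 \<inter> P -` {e\<^sup>2..})" by (rule continuous_closed_preimage[OF Pc]) auto
  moreover have "closed {x::real^2. exp \<tau> \<le> norm x}" by (intro closed_Collect_le continuous_intros)
  ultimately have "closed ((cball 0 1 \<inter> P -` {e\<^sup>2..}) \<inter> {x. exp \<tau> \<le> norm x})" by (rule closed_Int)
  moreover have "(cball 0 1 \<inter> P -` {e\<^sup>2..}) \<inter> {x. exp \<tau> \<le> norm x} = Kc" by (auto simp: Kc_def)
  ultimately have Kc: "closed Kc" by simp
  have nz: "x \<noteq> 0" if "exp \<tau> \<le> norm x" for x :: "real^2" using that exp_gt_zero[of \<tau>] by auto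
  have PW: "P x = W (ln (norm x))" if "x \<in> S" for x
    using potential_W[of x] nz[of x] that by (simp add: P_def S_def)
  have KcS: "Kc \<subseteq> S"
  proof
    fix x assume x: "x \<in> Kc"
    then have Px: "0 < P x" using e(1) by (auto simp: Kc_def intro: less_le_trans[of 0 "e\<^sup>2"])
    then have ux: "u x \<noteq> 0" by (auto simp: P_def)
    have n1: "norm x < 1" using x bd[of x] ux by (auto simp: Kc_def less_le)
    have "norm x \<noteq> exp \<tau>"
    proof
      assume *: "norm x = exp \<tau>"
      then have "u x = U \<tau>" using rad[of x] n1 nz[of x] by simp
      then show False using ux U\<tau> by simp
    qed
    then show "x \<in> S" using x n1 by (auto simp: Kc_def S_def)
  qed
  have inK: "{x \<in> S. e \<le> w (ln (norm x))} \<subseteq> Kc"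
  proof
    fix x assume "x \<in> {x \<in> S. e \<le> w (ln (norm x))}"
    then have that: "x \<in> S" "e \<le> w (ln (norm x))" by auto
    have "e\<^sup>2 \<le> (w (ln (norm x)))\<^sup>2" using that e by (intro power_mono) auto
    then have "e\<^sup>2 \<le> P x" using PW[OF that(1)] W_nonneg by (simp add: w_def)
    then show "x \<in> Kc" using that(1) by (simp add: Kc_def S_def)
  qed
  have n1: "n \<ge> 1" using n by simp
  note b = bump_test_function[OF e(1) ew n(2) n1 Kc, folded S_def, OF KcS inK]
  have pw: "- v x * laplacian v x - p * \<bar>u x\<bar> powr (p - 1) * (v x)\<^sup>2 \<le> (- (K\<^sup>2 / 4) + \<delta>) * ((v x)\<^sup>2 / (norm x)\<^sup>2)"
    if x: "x \<in> annulus n" for x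
  proof (cases "x \<in> S \<and> e < w (ln (norm x))")
    case False
    then have "v x = 0" using b(5)[OF False] by (simp only: v_def)
    then show ?thesis by simp
  next
    case True
    define t where "t = ln (norm x)"
    define q where "q = (norm x)\<^sup>2"
    have nx: "0 < norm x" "norm x < 1" by (rule annulus_norm(3)[OF x n1], rule annulus_norm(2)[OF x n1])
    then have q: "0 < q" by (simp add: q_def)
    have vx: "v x = cut e (w t - e)" "laplacian v x = cut_w'' e t / q"
      using b(4)[OF conjunct1[OF True] conjunct2[OF True]] by (simp_all only: t_def q_def v_def)
    have t: "\<tau> < t" "t < 0" "e < w t"
      using True nx less_ln_iff_exp_less[of "norm x" \<tau>] by (simp_all add: t_def S_def)
    have sub: "- v x * cut_w'' e t \<le> (W t - K\<^sup>2 / 4 + \<delta>) * (v x)\<^sup>2"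
      unfolding vx(1) by (rule cut_w_subsolution[OF K e(1,2) less_imp_le[OF e(3)] e(4) \<delta> c1 c2 t])
    have "p * \<bar>u x\<bar> powr (p - 1) * q = W t"
      using potential_W[of x] nx by (simp add: t_def q_def)
    then have pot: "p * \<bar>u x\<bar> powr (p - 1) = W t / q" using q by (simp add: field_simps)
    have "- v x * laplacian v x - W t / q * (v x)\<^sup>2 = (- v x * cut_w'' e t - W t * (v x)\<^sup>2) / q"
      unfolding vx(2) by (simp add: diff_divide_distrib)
    also have "\<dots> \<le> (- (K\<^sup>2 / 4) + \<delta>) * (v x)\<^sup>2 / q"
      using sub q by (intro divide_right_mono) (simp_all add: algebra_simps)
    finally show ?thesis unfolding pot by (simp add: q_def)
  qed
  have "rayleigh p u n v \<le> - (K\<^sup>2 / 4) + \<delta>"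
    by (rule rayleigh_upper_bound[OF _ cont n1 b(1)[folded v_def] b(2)[folded v_def] pw]) (use p in simp_all)
  then show ?thesis using that b(2,3)[folded v_def] by blast
qed

end

end

section \<open>Nodal solutions in the phase plane\<close>

lemma ray_derivative:
  fixes f :: "real^2 \<Rightarrow> real"
  assumes "f differentiable (at (exp t *\<^sub>R axis 1 1))"
  shows "((\<lambda>t. f (exp t *\<^sub>R axis 1 1)) has_real_derivative exp t * partial 1 f (exp t *\<^sub>R axis 1 1)) (at t)"
proof -
  have "((\<lambda>t. exp t *\<^sub>R axis 1 1 :: real^2) has_derivative (\<lambda>h. (h * exp t) *\<^sub>R axis 1 1)) (at t)"
    by (auto intro!: derivative_eq_intros)
  note d = has_derivative_compose[OF this differentiable_has_derivative_partial[OF assms]]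
  have "(\<Sum>i\<in>UNIV. partial i f z * ((h * exp t) *\<^sub>R axis 1 1 :: real^2) $ i) = (exp t * partial 1 f z) * h" for h z
    by (simp add: sum_2 axis_def)
  then show ?thesis
    unfolding has_field_derivative_def by (intro has_derivative_eq_rhs[OF d]) (auto simp: fun_eq_iff)
qed

lemma profile_radial:
  assumes "u \<in> H10_rad disc" "norm x < 1"
  shows "u x = profile u (norm x)"
proof -
  have *: "\<forall>x\<in>disc. \<forall>z\<in>disc. norm x = norm z \<longrightarrow> u x = u z"
    using assms(1) unfolding H10_rad_def by blast
  have "u x = u (norm x *\<^sub>R axis 1 1)"
    by (rule *[rule_format]) (use assms(2) in auto)
  then show ?thesis by (simp add: profile_def)
qed

text \<open>The sign of the profile between its zeros follows from the intermediate value theorem, \<open>V\<close> is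
  differentiable because the partial derivatives of the solution are, and \<open>laplacian_radial\<close> turns the
  partial differential equation into the value of this derivative.\<close>

lemma solution_is_nodal_profile:
  assumes p: "p \<ge> 2" and u: "least_energy_nodal_radial_solution p u" and u0: "u 0 > 0"
    and r: "nodal_radius u r" and s: "min_radius u s" "r < s"
  shows "nodal_profile p (ln r) (ln s) (u 0) (\<lambda>t. profile u (exp t)) (\<lambda>t. exp t * partial 1 u (exp t *\<^sub>R axis 1 1))"
proof -
  let ?e = "axis 1 1 :: real^2"
  have sol: "solution p u" and rad: "u \<in> H10_rad disc"
    using u by (auto simp: least_energy_nodal_radial_solution_def nodal_set_def)
  have cont: "continuous_on (cball 0 1) u" and bd: "\<And>x. norm x = 1 \<Longrightarrow> u x = 0"
    and eq: "\<And>x. norm x < 1 \<Longrightarrow> - laplacian u x = \<bar>u x\<bar> powr (p - 1) * u x"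
    using sol by (auto simp: solution_def dist_norm)
  have C2: "Ck_on (Suc (Suc 0)) disc u" using sol by (simp add: solution_def numeral_2_eq_2)
  have d1: "u differentiable (at x)" "partial i u differentiable (at x)" if "norm x < 1" for x i
    using C2 that by (auto simp: dist_norm)
  have rs: "0 < r" "r < 1" "0 < s" "s < 1" using r s by (auto simp: nodal_radius_def min_radius_def)
  have prc: "continuous_on {0..1} (profile u)" unfolding profile_def
    by (rule continuous_on_compose2[OF cont]) (auto intro!: continuous_intros)
  have pr0: "profile u 0 = u 0" "profile u 1 = 0" using bd[of ?e] by (auto simp: profile_def)
  have prz: "profile u t = 0 \<longleftrightarrow> t = r" if "0 < t" "t < 1" for t
    using r that by (auto simp: nodal_radius_def)
  have ppos: "0 < profile u t" if t: "0 < t" "t < r" for t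
  proof (rule ccontr)
    assume "\<not> 0 < profile u t"
    then obtain x where x: "0 \<le> x" "x \<le> t" "profile u x = 0"
      using IVT2'[of "profile u" t 0 0] continuous_on_subset[OF prc, of "{0..t}"] t rs u0 pr0 by auto
    then have "0 < x" using pr0 u0 by (cases "x = 0") auto
    then show False using prz[of x] x t rs by auto
  qed
  have ps: "profile u s < 0"
    using s rs pr0 by (auto simp: min_radius_def)
  have pneg: "profile u t < 0" if t: "r < t" "t < 1" for t
  proof (rule ccontr)
    assume "\<not> profile u t < 0"
    then have pt: "0 \<le> profile u t" by simp
    obtain x where x: "min s t \<le> x" "x \<le> max s t" "profile u x = 0"
    proof (cases "t \<le> s")
      case True
      then show ?thesis using IVT2'[of "profile u" s 0 t] continuous_on_subset[OF prc, of "{t..s}"] pt ps t rs that by auto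
    next
      case False
      then show ?thesis using IVT'[of "profile u" s 0 t] continuous_on_subset[OF prc, of "{s..t}"] pt ps t rs that by auto
    qed
    then show False using prz[of x] t s(2) rs by auto
  qed
  have dU: "((\<lambda>t. profile u (exp t)) has_real_derivative exp t * partial 1 u (exp t *\<^sub>R ?e)) (at t)" if "t < 0" for t
    unfolding profile_def by (rule ray_derivative[OF d1(1)]) (use that in simp)
  have dV: "((\<lambda>t. exp t * partial 1 u (exp t *\<^sub>R ?e)) has_real_derivative
      - (exp (2 * t) * (\<bar>profile u (exp t)\<bar> powr (p - 1) * profile u (exp t)))) (at t)" if t: "t < 0" for t
  proof -
    let ?x = "exp t *\<^sub>R ?e"
    have "\<exists>Z. ((\<lambda>t. exp t * partial 1 u (exp t *\<^sub>R ?e)) has_real_derivative Z) (at t)"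
      using DERIV_mult[OF DERIV_exp ray_derivative[OF d1(2)[of ?x 1]]] t by auto
    then obtain Z where Z: "((\<lambda>t. exp t * partial 1 u (exp t *\<^sub>R ?e)) has_real_derivative Z) (at t)" by blast
    have "laplacian u ?x = Z / (norm ?x)\<^sup>2"
    proof (rule laplacian_radial[of "{..<0}" "\<lambda>t. profile u (exp t)", OF _ dU])
      show "u z = profile u (exp (ln (norm z)))" if "z \<noteq> 0" "ln (norm z) \<in> {..<0}" for z :: "real^2"
        using profile_radial[OF rad, of z] that by simp
    qed (use t Z in auto)
    then have "Z = exp (2 * t) * laplacian u ?x" unfolding exp_double[of t] by simp
    also have "laplacian u ?x = - (\<bar>u ?x\<bar> powr (p - 1) * u ?x)" using eq[of ?x] t by simp
    finally show ?thesis using Z by (simp add: profile_def)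
  qed
  have ebot: "((\<lambda>t::real. exp t *\<^sub>R ?e) \<longlongrightarrow> 0 *\<^sub>R ?e) at_bot" by (intro tendsto_intros exp_at_bot)
  have "isCont u 0" "isCont (partial 1 u) 0"
    using d1[of 0] differentiable_imp_continuous_within by (metis norm_zero zero_less_one)+
  then have lims: "((\<lambda>t. u (exp t *\<^sub>R ?e)) \<longlongrightarrow> u 0) at_bot" "((\<lambda>t. partial 1 u (exp t *\<^sub>R ?e)) \<longlongrightarrow> partial 1 u 0) at_bot"
    using isCont_tendsto_compose[of 0] ebot by auto
  show ?thesis
  proof
    show "p \<ge> 2" by fact
    show "ln r < ln s" "ln s < 0" using rs s by auto
    show "u 0 > 0" by fact
    show "profile u (exp t) > 0" if "t < ln r" for t
      using ppos[of "exp t"] that rs by (metis exp_gt_zero exp_less_cancel_iff exp_ln)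
    show "profile u (exp (ln r)) = 0" using prz[of r] rs by simp
    show "profile u (exp t) < 0" if "ln r < t" "t < 0" for t
      using pneg[of "exp t"] that rs by (metis exp_less_cancel_iff exp_ln exp_less_one_iff)
    show "exp (ln s) * partial 1 u (exp (ln s) *\<^sub>R ?e) = 0"
    proof (rule DERIV_local_min[OF dU])
      show "ln s < 0" using rs by simp
      show "0 < - ln s" using rs by simp
      show "\<forall>y. \<bar>ln s - y\<bar> < - ln s \<longrightarrow> profile u (exp (ln s)) \<le> profile u (exp y)"
      proof (intro allI impI)
        fix y assume "\<bar>ln s - y\<bar> < - ln s"
        then have "exp y < 1" by (simp add: abs_less_iff)
        then have "exp y \<noteq> s \<Longrightarrow> profile u s < profile u (exp y)" using s(1) by (simp add: min_radius_def)
        then show "profile u (exp (ln s)) \<le> profile u (exp y)" using rs by (cases "exp y = s") auto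
      qed
    qed
    show "((\<lambda>t. profile u (exp t)) \<longlongrightarrow> u 0) at_bot" using lims(1) by (simp add: profile_def)
    have "((\<lambda>t. exp t * partial 1 u (exp t *\<^sub>R ?e)) \<longlongrightarrow> 0 * partial 1 u 0) at_bot"
      by (intro tendsto_mult exp_at_bot lims)
    then show "((\<lambda>t. exp t * partial 1 u (exp t *\<^sub>R ?e)) \<longlongrightarrow> 0) at_bot" by simp
  qed (use dU dV in auto)
qed

section \<open>The limit of the first radial eigenvalue\<close>

text \<open>The smallness conditions are separated from their verification. Here \<open>d\<close> is the threshold below
  which \<open>W\<close> counts as small in the lower bound, \<open>e\<close> is the level of the cut-off in the upper bound,
  and \<open>R\<close> bounds the deviation. The assumption on \<open>n\<close> makes \<open>1 / n\<close> smaller than the nodal radius.\<close>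

lemma eigenvalue_estimate:
  fixes u :: "real^2 \<Rightarrow> real" and n :: nat and p r s X K L d e \<delta> :: real and R :: "real \<Rightarrow> real"
  assumes p: "p \<ge> 2" and u: "least_energy_nodal_radial_solution p u" "u 0 > 0"
    and r: "nodal_radius u r" and s: "min_radius u s" "r < s"
    and n: "real n > eps_plus p u powr (-2)"
    and X_def: "X = (s / eps_minus p u s)\<^sup>2"
    and R_def: "\<And>d. R d = \<bar>X - L\<bar> + X / p + 2 * K * (K + 2) ^ 3 / ((p - 1) * d)"
    and K: "4 \<le> K" "K\<^sup>2 / 2 = L + 2" and \<delta>: "d \<le> \<delta>" "\<delta> \<le> 1"
    and d: "0 < d" "d \<le> X" "R d < d / 2"
    and c: "R d / 2 + (K\<^sup>2 / 2 + R d) / (p - 1) \<le> \<delta>"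
      "(K / 2) * (K - 2) / (p - 1) + (K / (2 * (K - 2)) + 1) * d \<le> \<delta>"
    and e: "0 < e" "e \<le> 1 / 2" "e\<^sup>2 < X" "R (e\<^sup>2) < e\<^sup>2 / 2"
      "R (e\<^sup>2) / 2 + (K + 2)\<^sup>2 / (2 * (p - 1)) \<le> \<delta> / 2" "3 * e * (K\<^sup>2 + 3 * \<delta>) \<le> \<delta> / 2"
  shows "\<bar>radial_eigenvalue p u n 1 + K\<^sup>2 / 4\<bar> \<le> \<delta>"
proof -
  let ?U = "\<lambda>t. profile u (exp t)" and ?V = "\<lambda>t. exp t * partial 1 u (exp t *\<^sub>R axis 1 1)"
  interpret nodal_profile p "ln r" "ln s" "u 0" ?U ?V
    using solution_is_nodal_profile[OF p u r s] .
  have rs: "0 < r" "r < 1" "0 < s" "s < 1" using r s by (auto simp: nodal_radius_def min_radius_def)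
  have sol: "solution p u" and rad: "u \<in> H10_rad disc"
    using u by (auto simp: least_energy_nodal_radial_solution_def nodal_set_def)
  have cont: "continuous_on (cball 0 1) u" and bd: "\<And>x. norm x = 1 \<Longrightarrow> u x = 0"
    using sol by (auto simp: solution_def dist_norm)
  have radU: "u x = ?U (ln (norm x))" if "x \<noteq> 0" "norm x < 1" for x
    using profile_radial[OF rad that(2)] that by simp
  have WX: "W (ln s) = X"
  proof -
    define m where "m = p * \<bar>profile u s\<bar> powr (p - 1)"
    have "profile u s \<noteq> 0" using Uneg[of "ln s"] rs s by simp
    then have m: "0 < m" using p by (simp add: m_def)
    have em: "eps_minus p u s = m powr (- 1 / 2)" by (simp add: eps_minus_def scale_def m_def)
    have "m powr (- 1 / 2) * m powr (- 1 / 2) = m powr (- 1 / 2 + - 1 / 2)" by (rule powr_add[symmetric])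
    also have "\<dots> = m powr (- 1)" by simp
    also have "\<dots> = 1 / m" using m powr_minus_divide[of m 1] by simp
    finally have "X = s\<^sup>2 * m" unfolding X_def em by (simp add: power2_eq_square)
    moreover have "W (ln s) = m * s\<^sup>2"
      unfolding W_def exp_double[of "ln s"] m_def using rs by simp
    ultimately show ?thesis by simp
  qed
  have deviation: "deviation K d' \<le> R d'" if "0 < d'" for d'
    using deviation_le[of K L d'] K that unfolding WX R_def by simp
  have nn: "real n * r > 1" "n \<ge> 2"
  proof -
    define m where "m = u 0 powr (p - 1)"
    have m: "0 < m" using u by (simp add: m_def)
    have "eps_plus p u = (p * m) powr (- 1 / 2)" using u by (simp add: eps_plus_def scale_def m_def)
    then have "eps_plus p u powr (-2) = p * m" using m p by (simp add: powr_powr)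
    then have nm: "p * m < real n" using n by simp
    have "4 \<le> m * r\<^sup>2" using initial_scale rs by (simp add: m_def exp_double)
    moreover have "m * r\<^sup>2 \<le> m * r" using m rs by (intro mult_left_mono) (auto simp: power2_eq_square mult_le_cancel_left1)
    moreover have "m * r \<le> m" using m rs by (simp add: mult_le_cancel_left1)
    ultimately have "4 \<le> m * r" "4 \<le> m" by simp_all
    have "1 * m \<le> p * m" using m p by (intro mult_right_mono) auto
    then have "m < real n" using nm by linarith
    show "n \<ge> 2" using \<open>4 \<le> m\<close> \<open>m < real n\<close> by linarith
    have "m * r \<le> real n * r" using \<open>m < real n\<close> rs by (intro mult_right_mono) auto
    then show "real n * r > 1" using \<open>4 \<le> m * r\<close> by linarith
  qed
  then have nr: "1 / real n \<le> exp (ln r)" using rs by (simp add: field_simps)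
  have pp: "1 < p" "0 < p - 1" using p by auto
  have ad: "d' / 2 \<le> a * d'" if "0 < d'" for d' using a_bounds(1) that mult_right_mono[of "1/2" a d'] by simp
  have E1: "deviation K d \<le> R d" "deviation K d < a * d" using deviation[OF d(1)] d(3) ad[OF d(1)] by auto
  have e2: "0 < e\<^sup>2" using e by simp
  have E2: "deviation K (e\<^sup>2) \<le> R (e\<^sup>2)" "deviation K (e\<^sup>2) < a * e\<^sup>2" using deviation[OF e2] e(4) ad[OF e2] by auto
  have "deviation K d / 2 + (K\<^sup>2 / 2 + deviation K d) / (p - 1) \<le> R d / 2 + (K\<^sup>2 / 2 + R d) / (p - 1)"
    using E1 pp by (intro add_mono divide_right_mono) auto
  then have C1: "deviation K d / 2 + (K\<^sup>2 / 2 + deviation K d) / (p - 1) \<le> \<delta>" using c(1) by simp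
  have C2: "deviation K (e\<^sup>2) / 2 + (K + 2)\<^sup>2 / (2 * (p - 1)) \<le> \<delta> / 2" using E2 e(5) by linarith
  note ctx = cont bd radU nn(2) nr
  obtain v where v: "v \<in> H10_rad (annulus n)" "\<not> ae_zero (annulus n) v" "rayleigh p u n v \<le> - (K\<^sup>2 / 4) + \<delta>"
    by (rule exists_rayleigh_le_of_deviation[OF ctx K(1) e(1,2) _ E2(2) \<delta>(2) C2 e(6)]) (use e(3) WX in auto)
  have low: "- (K\<^sup>2 / 4 + \<delta>) \<le> rayleigh p u n v" if "v \<in> H10_rad (annulus n)" "\<not> ae_zero (annulus n) v" for v
    by (rule rayleigh_ge_of_deviation[OF ctx K(1) d(1) _ E1(2) \<delta>(1) C1 c(2) that]) (use d(2) WX in auto)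
  have "- (K\<^sup>2 / 4 + \<delta>) \<le> radial_eigenvalue p u n 1" "radial_eigenvalue p u n 1 \<le> - (K\<^sup>2 / 4) + \<delta>"
    by (rule radial_eigenvalue_1_bounds[OF pp(1) cont low v]; assumption)+
  then show ?thesis by (simp add: abs_le_iff)
qed

lemma tendsto_const_over_shift: "((\<lambda>p::real. c / ((p - 1) * d)) \<longlongrightarrow> 0) at_top" if "d > 0"
proof -
  have "filterlim (\<lambda>p::real. -1 + p) at_top at_top"
    by (rule filterlim_tendsto_add_at_top[OF tendsto_const filterlim_ident])
  then have "filterlim (\<lambda>p::real. (p - 1) * d) at_top at_top"
    using filterlim_at_top_mult_tendsto_pos[OF tendsto_const that, of "\<lambda>p. p - 1" at_top] by simp
  then show ?thesis by (rule real_tendsto_divide_at_top[OF tendsto_const])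
qed

theorem theorem6p1:
  fixes u :: "real \<Rightarrow> real^2 \<Rightarrow> real"
    and r s :: "real \<Rightarrow> real"
    and n1 n2 N :: "real \<Rightarrow> nat"
    and l :: real
  assumes "\<And>p. p > 1 \<Longrightarrow> least_energy_nodal_radial_solution p (u p)"
    and "\<And>p. p > 1 \<Longrightarrow> u p 0 > 0"
    and "\<And>p. p > 1 \<Longrightarrow> nodal_radius (u p) (r p)"
    and "\<And>p. p > 1 \<Longrightarrow> min_radius (u p) (s p) \<and> r p < s p"
    and "((\<lambda>p. s p / eps_minus p (u p) (s p)) \<longlongrightarrow> l) at_top"
    and "\<bar>l - 7.1979\<bar> < 0.0001"
    and "\<And>p n. p > 1 \<Longrightarrow> n \<ge> 2 \<Longrightarrow> n \<ge> n1 p \<Longrightarrow>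
           card {i. i \<ge> 1 \<and> eigenvalue p (u p) n i < 0} \<ge> 4 \<and>
           card {i. i \<ge> 1 \<and> radial_eigenvalue p (u p) n i < 0} = 2"
    and "\<And>p n. p > 1 \<Longrightarrow> n \<ge> 2 \<Longrightarrow> n \<ge> n2 p \<Longrightarrow> radial_eigenvalue p (u p) n 2 > -1"
    and "\<And>p. p > 1 \<Longrightarrow> N p = Max {n1 p, n2 p, nat \<lfloor>eps_plus p (u p) powr (-2)\<rfloor> + 1}"
  shows "((\<lambda>p. radial_eigenvalue p (u p) (N p) 1) \<longlongrightarrow> - (l\<^sup>2 + 2) / 2) at_top \<and>
         \<bar>- (l\<^sup>2 + 2) / 2 - (- 26.9)\<bar> < 0.05"
proof
  have "l - 7.1979 < 0.0001 \<and> - (l - 7.1979) < 0.0001" using assms(6) unfolding abs_less_iff .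
  then have l: "7.1978 < l" "l < 7.198" by simp_all
  have l2: "7.1978\<^sup>2 \<le> l\<^sup>2" "l\<^sup>2 \<le> 7.198\<^sup>2" using l by (auto intro!: power_mono)
  show "\<bar>- (l\<^sup>2 + 2) / 2 - (- 26.9)\<bar> < 0.05"
  proof -
    have "51.8 \<le> l\<^sup>2" "l\<^sup>2 \<le> 51.82" using l2 by (simp_all add: power2_eq_square)
    then show ?thesis unfolding abs_less_iff by (simp add: field_simps)
  qed
  define X where "X p = (s p / eps_minus p (u p) (s p))\<^sup>2" for p
  have X: "(X \<longlongrightarrow> l\<^sup>2) at_top" unfolding X_def by (intro tendsto_intros assms(5))
  define K where "K = sqrt (2 * l\<^sup>2 + 4)"
  have K2: "K\<^sup>2 = 2 * l\<^sup>2 + 4" by (simp add: K_def)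
  have l50: "50 \<le> l\<^sup>2" using l2(1) by (simp add: power2_eq_square)
  have K: "4 \<le> K"
  proof -
    have "sqrt (4\<^sup>2) \<le> K" unfolding K_def using l50 by (intro real_sqrt_le_mono) simp
    then show ?thesis by simp
  qed
  define R where "R p d = \<bar>X p - l\<^sup>2\<bar> + X p / p + 2 * K * (K + 2) ^ 3 / ((p - 1) * d)" for p d
  have R: "((\<lambda>p. R p d) \<longlongrightarrow> 0) at_top" if "d > 0" for d
  proof -
    have "((\<lambda>p. R p d) \<longlongrightarrow> \<bar>l\<^sup>2 - l\<^sup>2\<bar> + 0 + 0) at_top" unfolding R_def
      by (intro tendsto_add tendsto_rabs tendsto_diff X tendsto_const
          real_tendsto_divide_at_top[OF X filterlim_ident] tendsto_const_over_shift that)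
    then show ?thesis by simp
  qed
  show "((\<lambda>p. radial_eigenvalue p (u p) (N p) 1) \<longlongrightarrow> - (l\<^sup>2 + 2) / 2) at_top"
  proof (rule tendstoI)
    fix \<epsilon> :: real assume \<epsilon>: "\<epsilon> > 0"
    define \<delta> where "\<delta> = min 1 (\<epsilon> / 2)"
    have \<delta>: "0 < \<delta>" "\<delta> \<le> 1" "\<delta> < \<epsilon>" using \<epsilon> by (auto simp: \<delta>_def)
    \<comment> \<open>The threshold \<open>d\<close> uses up one half of \<open>\<delta>\<close> in the condition where \<open>y \<ge> K\<close>.\<close>
    define c where "c = K / (2 * (K - 2)) + 1"
    have c: "1 \<le> c" using K by (simp add: c_def)
    define d where "d = \<delta> / (2 * c)"
    have d: "0 < d" "c * d = \<delta> / 2" "d \<le> \<delta>" "d < l\<^sup>2"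
    proof -
      show "0 < d" using \<delta> c by (simp add: d_def)
      show cd: "c * d = \<delta> / 2" using c by (simp add: d_def)
      have "1 * d \<le> c * d" using c \<open>0 < d\<close> by (intro mult_right_mono) auto
      then show "d \<le> \<delta>" "d < l\<^sup>2" using cd \<delta> l50 by linarith+
    qed
    \<comment> \<open>The largest level for which \<open>3 e (K\<^sup>2 + 3 \<delta>) \<le> \<delta> / 2\<close>.\<close>
    define e where "e = \<delta> / (6 * (K\<^sup>2 + 3 * \<delta>))"
    have e: "0 < e" "3 * e * (K\<^sup>2 + 3 * \<delta>) \<le> \<delta> / 2" "e \<le> 1 / 2" "e\<^sup>2 < l\<^sup>2"
    proof -
      have T: "104 \<le> K\<^sup>2 + 3 * \<delta>" using K2 l50 \<delta> by linarith
      then have T0: "0 < K\<^sup>2 + 3 * \<delta>" by linarith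
      show e0: "0 < e" using \<delta> T0 by (simp add: e_def)
      have "e * (6 * (K\<^sup>2 + 3 * \<delta>)) = \<delta>" unfolding e_def using T0 by simp
      then have eT: "3 * e * (K\<^sup>2 + 3 * \<delta>) = \<delta> / 2" by (simp add: algebra_simps)
      then show "3 * e * (K\<^sup>2 + 3 * \<delta>) \<le> \<delta> / 2" by simp
      have "3 * e * 104 \<le> 3 * e * (K\<^sup>2 + 3 * \<delta>)" using e0 T by (intro mult_left_mono) auto
      then show e1: "e \<le> 1 / 2" using eT \<delta> by linarith
      have "e\<^sup>2 \<le> (1 / 2)\<^sup>2" using e0 e1 by (intro power_mono) auto
      then show "e\<^sup>2 < l\<^sup>2" using l50 by (simp add: power_divide)
    qed
    have e2: "0 < e\<^sup>2" using e by simp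
    have q: "((\<lambda>p::real. x / (p - 1)) \<longlongrightarrow> 0) at_top" for x using tendsto_const_over_shift[of 1 x] by simp
    have "((\<lambda>p. R p d / 2 + ((K\<^sup>2 / 2) / (p - 1) + R p d * (1 / (p - 1)))) \<longlongrightarrow> 0 / 2 + (0 + 0 * 0)) at_top"
      by (intro tendsto_add tendsto_mult tendsto_divide R d q tendsto_const) simp
    then have l1: "((\<lambda>p. R p d / 2 + (K\<^sup>2 / 2 + R p d) / (p - 1)) \<longlongrightarrow> 0) at_top"
      by (simp add: add_divide_distrib)
    have "((\<lambda>p. R p (e\<^sup>2) / 2 + ((K + 2)\<^sup>2 / 2) / (p - 1)) \<longlongrightarrow> 0 / 2 + 0) at_top"
      by (intro tendsto_add tendsto_divide R e2 q tendsto_const) simp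
    then have l2': "((\<lambda>p. R p (e\<^sup>2) / 2 + (K + 2)\<^sup>2 / (2 * (p - 1))) \<longlongrightarrow> 0) at_top" by simp
    have "\<forall>\<^sub>F p::real in at_top. 2 \<le> p" by (rule eventually_ge_at_top)
    moreover have "\<forall>\<^sub>F p in at_top. d < X p" by (rule order_tendstoD(1)[OF X d(4)])
    moreover have "\<forall>\<^sub>F p in at_top. e\<^sup>2 < X p" by (rule order_tendstoD(1)[OF X e(4)])
    moreover have "\<forall>\<^sub>F p in at_top. R p d < d / 2"
      using d(1) by (intro order_tendstoD(2)[OF R]) auto
    moreover have "\<forall>\<^sub>F p in at_top. R p (e\<^sup>2) < e\<^sup>2 / 2"
      using e2 by (intro order_tendstoD(2)[OF R]) auto
    moreover have "\<forall>\<^sub>F p in at_top. R p d / 2 + (K\<^sup>2 / 2 + R p d) / (p - 1) < \<delta>"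
      by (rule order_tendstoD(2)[OF l1 \<delta>(1)])
    moreover have "\<forall>\<^sub>F p in at_top. ((K / 2) * (K - 2)) / (p - 1) < \<delta> / 2"
      using \<delta>(1) by (intro order_tendstoD(2)[OF q]) auto
    moreover have "\<forall>\<^sub>F p in at_top. R p (e\<^sup>2) / 2 + (K + 2)\<^sup>2 / (2 * (p - 1)) < \<delta> / 2"
      using \<delta>(1) by (intro order_tendstoD(2)[OF l2']) auto
    ultimately show "\<forall>\<^sub>F p in at_top. dist (radial_eigenvalue p (u p) (N p) 1) (- (l\<^sup>2 + 2) / 2) < \<epsilon>"
    proof eventually_elim
      case (elim p)
      have p1: "p > 1" using elim by simp
      have "nat \<lfloor>eps_plus p (u p) powr (-2)\<rfloor> + 1 \<le> N p" unfolding assms(9)[OF p1] by (intro Max_ge) auto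
      then have Np: "eps_plus p (u p) powr (-2) < real (N p)" by linarith
      have "\<bar>radial_eigenvalue p (u p) (N p) 1 + K\<^sup>2 / 4\<bar> \<le> \<delta>"
      proof (rule eigenvalue_estimate[OF _ assms(1-3)[OF p1] _ _ Np X_def R_def K _ d(3) \<delta>(2) d(1)])
        show "min_radius (u p) (s p)" "r p < s p" using assms(4)[OF p1] by auto
        show "K / 2 * (K - 2) / (p - 1) + (K / (2 * (K - 2)) + 1) * d \<le> \<delta>"
          using elim(7) d(2) unfolding c_def by linarith
        show "K\<^sup>2 / 2 = l\<^sup>2 + 2" using K2 by simp
        show "3 * e * (K\<^sup>2 + 3 * \<delta>) \<le> \<delta> / 2" by (rule e(2))
        show "R p (e\<^sup>2) / 2 + (K + 2)\<^sup>2 / (2 * (p - 1)) \<le> \<delta> / 2" using elim(8) by (rule less_imp_le)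
        show "R p d / 2 + (K\<^sup>2 / 2 + R p d) / (p - 1) \<le> \<delta>" using elim(6) by (rule less_imp_le)
      qed (use elim e in auto)
      moreover have "- (l\<^sup>2 + 2) / 2 = - (K\<^sup>2 / 4)" unfolding K2 by (simp add: field_simps)
      ultimately show ?case using \<delta> by (simp add: dist_real_def)
    qed
  qed
qed

end
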